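(* Let $\pi_1:V_1\to X_1$ and $\pi_2:V_2\to X_2$ be diffeological vector pseudo-bundles, locally trivial and with finite-dimensional fibres, and let $(\tilde f,f)$ be a gluing of $V_1$ to $V_2$, where $f:X_1\supseteq Y\to X_2$ is a diffeomorphism with its image. Suppose that $V_1$ and $V_2$ admit pseudo-metrics compatible with this gluing, and let $g_1$ and $g_2$ be a fixed choice of such pseudo-metrics. Assume that the induced pseudo-metrics $g_2^*$ and $g_1^*$ on the dual pseudo-bundles $V_2^*$ and $V_1^*$ are compatible with the gluing along $(\tilde f^*,f^{-1})$. Then $V_1$, $V_2$ and $(\tilde f,f)$ satisfy the gluing-dual commutativity condition.
   Context: Diffeological spaces, plots, smooth maps, and the subset, quotient, product, disjoint union and functional diffeologies are in the usual sense of Souriau. A diffeological vector space is a real vector space with a diffeology making addition and scalar multiplication smooth; $E^*$ denotes the space of smooth linear maps $E\to\mathbb R$ ($\mathbb R$ with its usual diffeology), with the functional diffeology. Pseudo-bundles. A diffeological vector pseudo-bundle is a smooth surjective map $\pi:V\to X$ of diffeological spaces with a vector space structure on each fibre such that fibrewise addition $V\times_XV\to V$, scalar multiplication $\mathbb R\times V\to V$ and the zero section $X\to V$ are smooth. The dual pseudo-bundle is $V^*=\bigcup_{x\in X}(\pi^{-1}(x))^*$ with the obvious projection $\pi^*$; a map $q:U'\to V^*$ is a plot iff for every plot $p:U\to V$ the map $(u',u)\mapsto q(u')(p(u))$ is smooth on $\{(u',u):\pi^*(q(u'))=\pi(p(u))\}$ (subset diffeology). $V\otimes V'$ is the fibrewise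 tensor product, with the finest pseudo-bundle diffeology making $V\times_XV'\to V\otimes V'$ smooth. Pseudo-metrics. A pseudo-metric on a finite-dimensional diffeological vector space $E$ is a smooth symmetric positive semi-definite bilinear form of rank $\dim(E^* )$. A pseudo-metric on $\pi:V\to X$ (finite-dimensional fibres) is a smooth section $g$ of $V^*\otimes V^*$ with $g(x)$ a pseudo-metric on $\pi^{-1}(x)$ for all $x$. For $V$ locally trivial, the induced pseudo-metric $g^*$ on $V^*$ is defined by $g^*(x)(\Psi_g(v),\Psi_g(w))=g(x)(v,w)$ for $v,w\in\pi^{-1}(x)$, where $\Psi_g:V\to V^*$, $\Psi_g(v)=g(\pi(v))(v,\cdot)$ (a fibrewise surjective map). Gluing. For $h:Z_1\supseteq Y'\to Z_2$ smooth, $Z_1\cup_hZ_2=(Z_1\sqcup Z_2)/(z\sim h(z),\ z\in Y')$ with the quotient of the disjoint union diffeology. The natural inclusions $Z_1\setminus Y'\to Z_1\cup_hZ_2$ and $Z_2\to Z_1\cup_hZ_2$ have disjoint images covering $Z_1\cup_hZ_2$; for base spaces they are denoted $i_1^{Z_1},i_2^{Z_2}$ and for total spaces $j_1^{Z_1},j_2^{Z_2}$. A gluing $(\tilde f,f)$ of $\pi_1:V_1\to X_1$ to $\pi_2:V_2\to X_2$ consists of a smooth $f:X_1\supseteq Y\to X_2$ and a smooth fibrewise linear lift $\tilde f:\pi_1^{-1}(Y)\to V_2$ of $f$; it yields the pseudo-bundle $\pi_1\cup_{(\tilde f,f)}\pi_2:V_1\cup_{\tilde f}V_2\to X_1\cup_fX_2$.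 Pseudo-metrics $g_1,g_2$ on $V_1,V_2$ are compatible with $(\tilde f,f)$ if $g_1(y)(v,w)=g_2(f(y))(\tilde f(v),\tilde f(w))$ for all $y\in Y$, $v,w\in\pi_1^{-1}(y)$. If $f$ is a diffeomorphism with its image, $\tilde f^*:(\pi_2^* )^{-1}(f(Y))\to V_1^*$ is $\tilde f^*(\xi)=\xi\circ\tilde f|_{\pi_1^{-1}(y)}$ for $\xi\in(\pi_2^{-1}(f(y)))^*$; it is a lift of $f^{-1}:f(Y)\to X_1$ and gives the gluing $V_2^*\cup_{\tilde f^*}V_1^*\to X_2\cup_{f^{-1}}X_1$. The compatibility of $g_2^*$ and $g_1^*$ with $(\tilde f^*,f^{-1})$ means $g_2^*(y')(\xi,\eta)=g_1^*(f^{-1}(y'))(\tilde f^*\xi,\tilde f^*\eta)$ for all $y'\in f(Y)$, $\xi,\eta\in(\pi_2^{-1}(y'))^*$. Gluing-dual commutativity condition. The switch map $\varphi_{X_1\leftrightarrow X_2}:X_1\cup_fX_2\to X_2\cup_{f^{-1}}X_1$ is the natural identification: $i_1^{X_1}(x)\mapsto i_2^{X_1}(x)$ for $x\in X_1\setminus Y$, $i_2^{X_2}(f(x))\mapsto i_2^{X_1}(x)$ for $x\in Y$, $i_2^{X_2}(x)\mapsto i_1^{X_2}(x)$ for $x\in X_2\setminus f(Y)$. The condition says that the map $\Phi_{\cup,*}:(V_1\cup_{\tilde f}V_2)^*\to V_2^*\cup_{\tilde f^*}V_1^*$, covering the switch map and given by $j_2^{V_1^*}\circ(j_1^{V_1})^*$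 over $i_1^{X_1}(X_1\setminus Y)$, by $j_2^{V_1^*}\circ\tilde f^*\circ(j_2^{V_2})^*$ over $i_2^{X_2}(f(Y))$, and by $j_1^{V_2^*}\circ(j_2^{V_2})^*$ over $i_2^{X_2}(X_2\setminus f(Y))$, is a diffeomorphism. Here $(j_i^{V_i})^*$ is fibrewise pre-composition with $j_i^{V_i}$.
   Formalization: In the diffeology of the dual pseudo-bundle, a plot q of V^* is additionally required to have smooth projection π^*∘q; with the evaluation criterion alone π^* is not smooth and the claim fails (two one-point bases, Y empty, fibres R). *)

theory Defs
  imports
    "HOL-Analysis.Analysis"
    "HOL-Library.Poly_Mapping"
    "Jordan_Normal_Form.VS_Connect"
begin

section \<open>Smooth maps between Euclidean domains\<close>

text \<open>
  Diffeologies quantify over the dimension, so points of n-dimensional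
  space are the sequences in the topological space \<^term>\<open>Euclidean_space n\<close>, that is, those vanishing from index
  \<^term>\<open>n\<close> on. The following predicate is meant for \<^term>\<open>U\<close> open in \<^term>\<open>Euclidean_space n\<close>: all iterated partial derivatives of order at most \<^term>\<open>k\<close> exist and are continuous on \<^term>\<open>U\<close>.
\<close>

fun C_k :: "nat \<Rightarrow> nat \<Rightarrow> (nat \<Rightarrow> real) set \<Rightarrow> ((nat \<Rightarrow> real) \<Rightarrow> real) \<Rightarrow> bool" where
  "C_k n 0 U F \<longleftrightarrow> continuous_on U F"
| "C_k n (Suc k) U F \<longleftrightarrow> continuous_on U F \<and>
     (\<forall>i<n. \<exists>G. (\<forall>x\<in>U. ((\<lambda>t. F (x(i := t))) has_real_derivative G x) (at (x i))) \<and> C_k n k U G)"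

definition C_infinity :: "nat \<Rightarrow> (nat \<Rightarrow> real) set \<Rightarrow> ((nat \<Rightarrow> real) \<Rightarrow> real) \<Rightarrow> bool" where
  "C_infinity n U F \<longleftrightarrow> (\<forall>k. C_k n k U F)"


section \<open>Diffeological spaces\<close>

text \<open>
  \<^term>\<open>plot X n U p\<close> says that \<^term>\<open>p\<close>, restricted to the open set \<^term>\<open>U\<close> of n-dimensional
  space, is a plot of \<^term>\<open>X\<close>. Values of \<^term>\<open>p\<close> outside \<^term>\<open>U\<close> are irrelevant; the locality axiom
  below implies this.
\<close>

record 'a dspace =
  pts :: "'a set"
  plot :: "nat \<Rightarrow> (nat \<Rightarrow> real) set \<Rightarrow> ((nat \<Rightarrow> real) \<Rightarrow> 'a) \<Rightarrow> bool"

definition euclid :: "nat \<Rightarrow> (nat \<Rightarrow> real) dspace" where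
  "euclid m = \<lparr> pts = topspace (Euclidean_space m),
     plot = (\<lambda>n U F. openin (Euclidean_space n) U \<and> F ` U \<subseteq> topspace (Euclidean_space m) \<and>
                     (\<forall>i<m. C_infinity n U (\<lambda>x. F x i))) \<rparr>"

definition real_space :: "real dspace" where
  "real_space = \<lparr> pts = UNIV,
     plot = (\<lambda>n U F. openin (Euclidean_space n) U \<and> C_infinity n U F) \<rparr>"

definition diffeological_space :: "'a dspace \<Rightarrow> bool" where
  "diffeological_space X \<longleftrightarrow>
     (\<forall>n U p. plot X n U p \<longrightarrow> openin (Euclidean_space n) U \<and> p ` U \<subseteq> pts X) \<and>
     (\<forall>n U x. openin (Euclidean_space n) U \<and> x \<in> pts X \<longrightarrow> plot X n U (\<lambda>_. x)) \<and>
     (\<forall>n U p. openin (Euclidean_space n) U \<and>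
        (\<forall>u\<in>U. \<exists>W q. u \<in> W \<and> W \<subseteq> U \<and> plot X n W q \<and> (\<forall>w\<in>W. p w = q w))
        \<longrightarrow> plot X n U p) \<and>
     (\<forall>n U p m W F. plot X n U p \<and> plot (euclid n) m W F \<and> F ` W \<subseteq> U
        \<longrightarrow> plot X m W (p \<circ> F))"

definition smooth_map :: "'a dspace \<Rightarrow> 'b dspace \<Rightarrow> ('a \<Rightarrow> 'b) \<Rightarrow> bool" where
  "smooth_map X Y f \<longleftrightarrow> f ` pts X \<subseteq> pts Y \<and>
     (\<forall>n U p. plot X n U p \<longrightarrow> plot Y n U (f \<circ> p))"

definition diffeomorphism :: "'a dspace \<Rightarrow> 'b dspace \<Rightarrow> ('a \<Rightarrow> 'b) \<Rightarrow> bool" where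
  "diffeomorphism X Y f \<longleftrightarrow> bij_betw f (pts X) (pts Y) \<and> smooth_map X Y f \<and>
     smooth_map Y X (inv_into (pts X) f)"

definition D_open :: "'a dspace \<Rightarrow> 'a set \<Rightarrow> bool" where
  "D_open X A \<longleftrightarrow> A \<subseteq> pts X \<and>
     (\<forall>n U p. plot X n U p \<longrightarrow> openin (Euclidean_space n) {u \<in> U. p u \<in> A})"

definition subset_space :: "'a dspace \<Rightarrow> 'a set \<Rightarrow> 'a dspace" where
  "subset_space X A = \<lparr> pts = pts X \<inter> A, plot = (\<lambda>n U p. plot X n U p \<and> p ` U \<subseteq> A) \<rparr>"

definition prod_space :: "'a dspace \<Rightarrow> 'b dspace \<Rightarrow> ('a \<times> 'b) dspace" where
  "prod_space X Y = \<lparr> pts = pts X \<times> pts Y,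
     plot = (\<lambda>n U p. plot X n U (fst \<circ> p) \<and> plot Y n U (snd \<circ> p)) \<rparr>"

definition sum_space :: "'a dspace \<Rightarrow> 'b dspace \<Rightarrow> ('a + 'b) dspace" where
  "sum_space X Y = \<lparr> pts = pts X <+> pts Y,
     plot = (\<lambda>n U p. openin (Euclidean_space n) U \<and>
       (\<forall>u\<in>U. \<exists>W. u \<in> W \<and> W \<subseteq> U \<and>
          ((\<exists>q. plot X n W q \<and> (\<forall>w\<in>W. p w = Inl (q w))) \<or>
           (\<exists>q. plot Y n W q \<and> (\<forall>w\<in>W. p w = Inr (q w)))))) \<rparr>"

definition quotient_space :: "'a dspace \<Rightarrow> ('a \<times> 'a) set \<Rightarrow> 'a set dspace" where
  "quotient_space X r = \<lparr> pts = pts X // r,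
     plot = (\<lambda>n U p. openin (Euclidean_space n) U \<and>
       (\<forall>u\<in>U. \<exists>W q. u \<in> W \<and> W \<subseteq> U \<and> plot X n W q \<and> (\<forall>w\<in>W. p w = r `` {q w}))) \<rparr>"


section \<open>Vector pseudo-bundles\<close>

text \<open>
  Real vector spaces are \<^const>\<open>vectorspace\<close>s over the ring of reals \<^term>\<open>class_ring :: real ring\<close>;
  the fields \<open>mult\<close> and \<open>one\<close> which the record type inherits from rings carry no meaning.
\<close>

definition real_vs :: "(real, real) module" where
  "real_vs = \<lparr> carrier = UNIV, mult = (*), one = 1, zero = 0, add = (+), smult = (*) \<rparr>"

definition transport_vs :: "('a \<Rightarrow> 'b) \<Rightarrow> (real, 'a) module \<Rightarrow> (real, 'b) module" where
  "transport_vs j E = (let k = the_inv_into (carrier E) j in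
     \<lparr> carrier = j ` carrier E, mult = undefined, one = undefined, zero = j \<zero>\<^bsub>E\<^esub>,
       add = (\<lambda>a b. j (k a \<oplus>\<^bsub>E\<^esub> k b)), smult = (\<lambda>r a. j (r \<odot>\<^bsub>E\<^esub> k a)) \<rparr>)"

record ('x, 'v) fibred_space =
  Base :: "'x dspace"
  Total :: "'v dspace"
  Proj :: "'v \<Rightarrow> 'x"
  Fib :: "'x \<Rightarrow> (real, 'v) module"

definition vector_pseudo_bundle :: "('x, 'v) fibred_space \<Rightarrow> bool" where
  "vector_pseudo_bundle V \<longleftrightarrow>
     diffeological_space (Base V) \<and> diffeological_space (Total V) \<and>
     smooth_map (Total V) (Base V) (Proj V) \<and> Proj V ` pts (Total V) = pts (Base V) \<and>
     (\<forall>x\<in>pts (Base V). vectorspace class_ring (Fib V x) \<and>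
        carrier (Fib V x) = {v \<in> pts (Total V). Proj V v = x}) \<and>
     smooth_map (subset_space (prod_space (Total V) (Total V)) {(v, w). Proj V v = Proj V w})
       (Total V) (\<lambda>(v, w). v \<oplus>\<^bsub>Fib V (Proj V v)\<^esub> w) \<and>
     smooth_map (prod_space real_space (Total V))
       (Total V) (\<lambda>(r, v). r \<odot>\<^bsub>Fib V (Proj V v)\<^esub> v) \<and>
     smooth_map (Base V) (Total V) (\<lambda>x. \<zero>\<^bsub>Fib V x\<^esub>)"

definition fibre_space :: "('x, 'v) fibred_space \<Rightarrow> 'x \<Rightarrow> 'v dspace" where
  "fibre_space V x = subset_space (Total V) (carrier (Fib V x))"

definition finite_dim_fibres :: "('x, 'v) fibred_space \<Rightarrow> bool" where
  "finite_dim_fibres V \<longleftrightarrow> (\<forall>x\<in>pts (Base V). vectorspace.fin_dim class_ring (Fib V x))"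

definition locally_trivial :: "('x, 'v) fibred_space \<Rightarrow> bool" where
  "locally_trivial V \<longleftrightarrow> (\<forall>x\<in>pts (Base V). \<exists>A. D_open (Base V) A \<and> x \<in> A \<and>
     (\<exists>\<phi>. diffeomorphism (prod_space (subset_space (Base V) A) (fibre_space V x))
             (subset_space (Total V) {v. Proj V v \<in> A}) \<phi> \<and>
           (\<forall>a\<in>A. (\<forall>v\<in>carrier (Fib V x). Proj V (\<phi> (a, v)) = a) \<and>
                  (\<lambda>v. \<phi> (a, v)) \<in> module_hom class_ring (Fib V x) (Fib V a))))"


section \<open>Dual pseudo-bundles\<close>

text \<open>
  Smooth linear functionals on a vector space \<^term>\<open>E\<close> with diffeology \<^term>\<open>D\<close>, as extensional
  functions on \<^term>\<open>carrier E\<close> with the pointwise operations.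
\<close>

definition smooth_dual :: "'v dspace \<Rightarrow> (real, 'v) module \<Rightarrow> (real, 'v \<Rightarrow> real) module" where
  "smooth_dual D E = (ring.func_space class_ring (carrier E))
     \<lparr> carrier := {\<xi> \<in> extensional (carrier E). \<xi> \<in> module_hom class_ring E real_vs \<and>
                                               smooth_map D real_space \<xi>} \<rparr>"

text \<open>
  Elements of the dual are tagged with their base point. In the diffeology, the evaluation
  condition alone does not make the projection smooth (every set-theoretic map into the base,
  followed by the zero section, satisfies it), so smoothness of the projection of a plot, which
  belongs to being a pseudo-bundle, is a separate conjunct.
\<close>

definition dual_bundle ::
  "('x, 'v) fibred_space \<Rightarrow> ('x, 'x \<times> ('v \<Rightarrow> real)) fibred_space" where
  "dual_bundle V =
     (let S = (SIGMA x:pts (Base V). carrier (smooth_dual (fibre_space V x) (Fib V x))) in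
     \<lparr> Base = Base V,
       Total = \<lparr> pts = S,
         plot = (\<lambda>n U q. openin (Euclidean_space n) U \<and> q ` U \<subseteq> S \<and>
           plot (Base V) n U (fst \<circ> q) \<and>
           (\<forall>m W p. plot (Total V) m W p \<longrightarrow>
              smooth_map
                (subset_space
                   (prod_space (subset_space (euclid n) U) (subset_space (euclid m) W))
                   {(u', u). fst (q u') = Proj V (p u)})
                real_space (\<lambda>(u', u). snd (q u') (p u)))) \<rparr>,
       Proj = fst,
       Fib = (\<lambda>x. transport_vs (Pair x) (smooth_dual (fibre_space V x) (Fib V x))) \<rparr>)"


section \<open>Tensor products\<close>

text \<open>
  The tensor product of two vector spaces is the quotient of the free vector space on
  \<^term>\<open>carrier E \<times> carrier F\<close> by the subspace \<open>tensor_null\<close> spanned by the bilinearity relations;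
  its elements are cosets.
\<close>

definition tensor_null ::
  "(real, 'v) module \<Rightarrow> (real, 'w) module \<Rightarrow> ('v \<times> 'w \<Rightarrow>\<^sub>0 real) set" where
  "tensor_null E F = Modules.module.span (\<lambda>r. Poly_Mapping.map ((*) r))
    ({Poly_Mapping.single (v \<oplus>\<^bsub>E\<^esub> v', w) 1 - Poly_Mapping.single (v, w) 1 - Poly_Mapping.single (v', w) 1
        | v v' w. v \<in> carrier E \<and> v' \<in> carrier E \<and> w \<in> carrier F} \<union>
     {Poly_Mapping.single (v, w \<oplus>\<^bsub>F\<^esub> w') 1 - Poly_Mapping.single (v, w) 1 - Poly_Mapping.single (v, w') 1
        | v w w'. v \<in> carrier E \<and> w \<in> carrier F \<and> w' \<in> carrier F} \<union>
     {Poly_Mapping.single (r \<odot>\<^bsub>E\<^esub> v, w) 1 - Poly_Mapping.single (v, w) r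
        | r v w. v \<in> carrier E \<and> w \<in> carrier F} \<union>
     {Poly_Mapping.single (v, r \<odot>\<^bsub>F\<^esub> w) 1 - Poly_Mapping.single (v, w) r
        | r v w. v \<in> carrier E \<and> w \<in> carrier F})"

definition tensor_class ::
  "(real, 'v) module \<Rightarrow> (real, 'w) module \<Rightarrow> ('v \<times> 'w \<Rightarrow>\<^sub>0 real) \<Rightarrow> ('v \<times> 'w \<Rightarrow>\<^sub>0 real) set" where
  "tensor_class E F c = {c'. c' - c \<in> tensor_null E F}"

definition tensor_vs ::
  "(real, 'v) module \<Rightarrow> (real, 'w) module \<Rightarrow> (real, ('v \<times> 'w \<Rightarrow>\<^sub>0 real) set) module" where
  "tensor_vs E F =
     \<lparr> carrier = tensor_class E F ` {c. Poly_Mapping.keys c \<subseteq> carrier E \<times> carrier F},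
       mult = undefined, one = undefined,
       zero = tensor_class E F 0,
       add = (\<lambda>A B. {a + b | a b. a \<in> A \<and> b \<in> B}),
       smult = (\<lambda>r A. \<Union>a\<in>A. tensor_class E F (Poly_Mapping.map ((*) r) a)) \<rparr>"

text \<open>
  The finest pseudo-bundle diffeology with the required property is the intersection of all of
  them: pseudo-bundle diffeologies on a fixed fibrewise vector space are closed under
  intersection, and the pullback of the diffeology of the base along the projection is one.
\<close>

definition tensor_bundle ::
  "('x, 'v) fibred_space \<Rightarrow> ('x, 'w) fibred_space \<Rightarrow> ('x, 'x \<times> ('v \<times> 'w \<Rightarrow>\<^sub>0 real) set) fibred_space"
where
  "tensor_bundle V V' =
     (let S = (SIGMA x:pts (Base V). carrier (tensor_vs (Fib V x) (Fib V' x)));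
          F = (\<lambda>x. transport_vs (Pair x) (tensor_vs (Fib V x) (Fib V' x)));
          good = (\<lambda>D. pts D = S \<and>
            vector_pseudo_bundle \<lparr> Base = Base V, Total = D, Proj = fst, Fib = F \<rparr> \<and>
            smooth_map
              (subset_space (prod_space (Total V) (Total V')) {(v, w). Proj V v = Proj V' w}) D
              (\<lambda>(v, w). (Proj V v, tensor_class (Fib V (Proj V v)) (Fib V' (Proj V v))
                                    (Poly_Mapping.single (v, w) 1))))
      in \<lparr> Base = Base V,
           Total = \<lparr> pts = S, plot = (\<lambda>n U p. \<forall>D. good D \<longrightarrow> plot D n U p) \<rparr>,
           Proj = fst, Fib = F \<rparr>)"


section \<open>Pseudo-metrics\<close>

definition bilinear_form :: "(real, 'v) module \<Rightarrow> ('v \<Rightarrow> 'v \<Rightarrow> real) \<Rightarrow> bool" where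
  "bilinear_form E b \<longleftrightarrow>
     (\<forall>v\<in>carrier E. b v \<in> module_hom class_ring E real_vs) \<and>
     (\<forall>w\<in>carrier E. (\<lambda>v. b v w) \<in> module_hom class_ring E real_vs)"

text \<open>The rank of a bilinear form is the dimension of the image of \<open>v \<mapsto> b(v, \<cdot>)\<close>.\<close>

definition form_rank :: "(real, 'v) module \<Rightarrow> ('v \<Rightarrow> 'v \<Rightarrow> real) \<Rightarrow> nat" where
  "form_rank E b = vectorspace.dim class_ring
     ((ring.func_space class_ring (carrier E))
        \<lparr> carrier := (\<lambda>v. \<lambda>w\<in>carrier E. b v w) ` carrier E \<rparr>)"

definition pseudo_metric_on ::
  "'v dspace \<Rightarrow> (real, 'v) module \<Rightarrow> ('v \<Rightarrow> 'v \<Rightarrow> real) \<Rightarrow> bool" where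
  "pseudo_metric_on D E b \<longleftrightarrow>
     bilinear_form E b \<and>
     smooth_map (prod_space D D) real_space (\<lambda>(v, w). b v w) \<and>
     (\<forall>v\<in>carrier E. \<forall>w\<in>carrier E. b v w = b w v) \<and>
     (\<forall>v\<in>carrier E. b v v \<ge> 0) \<and>
     form_rank E b = vectorspace.dim class_ring (smooth_dual D E)"

text \<open>
  The bilinear form on a fibre given by an element of the tensor square of its dual:
  a combination of pure tensors \<open>\<xi> \<otimes> \<eta>\<close> evaluates to the same combination of the products
  \<open>\<xi>(v) \<eta>(w)\<close>, independently of the representative.
\<close>

definition tensor_form ::
  "'x \<times> (('x \<times> ('v \<Rightarrow> real)) \<times> ('x \<times> ('v \<Rightarrow> real)) \<Rightarrow>\<^sub>0 real) set \<Rightarrow> 'v \<Rightarrow> 'v \<Rightarrow> real" where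
  "tensor_form t v w = (THE r. \<exists>c\<in>snd t.
     r = (\<Sum>k\<in>Poly_Mapping.keys c. Poly_Mapping.lookup c k * snd (fst k) v * snd (snd k) w))"

definition pseudo_metric ::
  "('x, 'v) fibred_space \<Rightarrow>
   ('x \<Rightarrow> 'x \<times> (('x \<times> ('v \<Rightarrow> real)) \<times> ('x \<times> ('v \<Rightarrow> real)) \<Rightarrow>\<^sub>0 real) set) \<Rightarrow> bool" where
  "pseudo_metric V g \<longleftrightarrow>
     smooth_map (Base V) (Total (tensor_bundle (dual_bundle V) (dual_bundle V))) g \<and>
     (\<forall>x\<in>pts (Base V). Proj (tensor_bundle (dual_bundle V) (dual_bundle V)) (g x) = x \<and>
        pseudo_metric_on (fibre_space V x) (Fib V x) (tensor_form (g x)))"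

definition metric_pairing ::
  "('x, 'v) fibred_space \<Rightarrow>
   ('x \<Rightarrow> 'x \<times> (('x \<times> ('v \<Rightarrow> real)) \<times> ('x \<times> ('v \<Rightarrow> real)) \<Rightarrow>\<^sub>0 real) set) \<Rightarrow>
   'v \<Rightarrow> 'x \<times> ('v \<Rightarrow> real)" where
  "metric_pairing V g v =
     (Proj V v, \<lambda>w\<in>carrier (Fib V (Proj V v)). tensor_form (g (Proj V v)) v w)"

definition dual_metric ::
  "('x, 'v) fibred_space \<Rightarrow>
   ('x \<Rightarrow> 'x \<times> (('x \<times> ('v \<Rightarrow> real)) \<times> ('x \<times> ('v \<Rightarrow> real)) \<Rightarrow>\<^sub>0 real) set) \<Rightarrow>
   'x \<Rightarrow> 'x \<times> ('v \<Rightarrow> real) \<Rightarrow> 'x \<times> ('v \<Rightarrow> real) \<Rightarrow> real" where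
  "dual_metric V g x \<xi> \<eta> = (THE r. \<exists>v\<in>carrier (Fib V x). \<exists>w\<in>carrier (Fib V x).
     metric_pairing V g v = \<xi> \<and> metric_pairing V g w = \<eta> \<and> r = tensor_form (g x) v w)"


section \<open>Gluing\<close>

definition glue_rel ::
  "'a dspace \<Rightarrow> 'b dspace \<Rightarrow> 'a set \<Rightarrow> ('a \<Rightarrow> 'b) \<Rightarrow> (('a + 'b) \<times> ('a + 'b)) set" where
  "glue_rel Z1 Z2 Y h =
     (let R = {(Inl z, Inr (h z)) | z. z \<in> Y}; C = pts Z1 <+> pts Z2 in (R \<union> R\<inverse>)\<^sup>* \<inter> C \<times> C)"

definition glue_space ::
  "'a dspace \<Rightarrow> 'b dspace \<Rightarrow> 'a set \<Rightarrow> ('a \<Rightarrow> 'b) \<Rightarrow> ('a + 'b) set dspace" where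
  "glue_space Z1 Z2 Y h = quotient_space (sum_space Z1 Z2) (glue_rel Z1 Z2 Y h)"

definition glue_in1 ::
  "'a dspace \<Rightarrow> 'b dspace \<Rightarrow> 'a set \<Rightarrow> ('a \<Rightarrow> 'b) \<Rightarrow> 'a \<Rightarrow> ('a + 'b) set" where
  "glue_in1 Z1 Z2 Y h z = glue_rel Z1 Z2 Y h `` {Inl z}"

definition glue_in2 ::
  "'a dspace \<Rightarrow> 'b dspace \<Rightarrow> 'a set \<Rightarrow> ('a \<Rightarrow> 'b) \<Rightarrow> 'b \<Rightarrow> ('a + 'b) set" where
  "glue_in2 Z1 Z2 Y h z = glue_rel Z1 Z2 Y h `` {Inr z}"

text \<open>
  The map on the glued space given by \<^term>\<open>F1\<close> on the image of \<^term>\<open>pts Z1 - Y\<close> and by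
  \<^term>\<open>F2\<close> on the image of \<^term>\<open>pts Z2\<close>.
\<close>

definition glue_case ::
  "'a dspace \<Rightarrow> 'b dspace \<Rightarrow> 'a set \<Rightarrow> ('a \<Rightarrow> 'b) \<Rightarrow> ('a \<Rightarrow> 'c) \<Rightarrow> ('b \<Rightarrow> 'c) \<Rightarrow>
   ('a + 'b) set \<Rightarrow> 'c" where
  "glue_case Z1 Z2 Y h F1 F2 c =
     (if c \<in> glue_in2 Z1 Z2 Y h ` pts Z2
      then F2 (the_inv_into (pts Z2) (glue_in2 Z1 Z2 Y h) c)
      else F1 (the_inv_into (pts Z1 - Y) (glue_in1 Z1 Z2 Y h) c))"

definition over :: "('x, 'v) fibred_space \<Rightarrow> 'x set \<Rightarrow> 'v set" where
  "over V Y = {v \<in> pts (Total V). Proj V v \<in> Y}"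

definition bundle_gluing ::
  "('x1, 'v1) fibred_space \<Rightarrow> ('x2, 'v2) fibred_space \<Rightarrow> 'x1 set \<Rightarrow>
   ('v1 \<Rightarrow> 'v2) \<Rightarrow> ('x1 \<Rightarrow> 'x2) \<Rightarrow> bool" where
  "bundle_gluing V1 V2 Y ft f \<longleftrightarrow>
     Y \<subseteq> pts (Base V1) \<and>
     smooth_map (subset_space (Base V1) Y) (Base V2) f \<and>
     smooth_map (subset_space (Total V1) (over V1 Y)) (Total V2) ft \<and>
     (\<forall>v\<in>over V1 Y. Proj V2 (ft v) = f (Proj V1 v)) \<and>
     (\<forall>y\<in>Y. ft \<in> module_hom class_ring (Fib V1 y) (Fib V2 (f y)))"

abbreviation total_in1 ::
  "('x1, 'v1) fibred_space \<Rightarrow> ('x2, 'v2) fibred_space \<Rightarrow> 'x1 set \<Rightarrow> ('v1 \<Rightarrow> 'v2) \<Rightarrow>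
   'v1 \<Rightarrow> ('v1 + 'v2) set" where
  "total_in1 V1 V2 Y ft \<equiv> glue_in1 (Total V1) (Total V2) (over V1 Y) ft"

abbreviation total_in2 ::
  "('x1, 'v1) fibred_space \<Rightarrow> ('x2, 'v2) fibred_space \<Rightarrow> 'x1 set \<Rightarrow> ('v1 \<Rightarrow> 'v2) \<Rightarrow>
   'v2 \<Rightarrow> ('v1 + 'v2) set" where
  "total_in2 V1 V2 Y ft \<equiv> glue_in2 (Total V1) (Total V2) (over V1 Y) ft"

definition glue_bundle ::
  "('x1, 'v1) fibred_space \<Rightarrow> ('x2, 'v2) fibred_space \<Rightarrow> 'x1 set \<Rightarrow>
   ('v1 \<Rightarrow> 'v2) \<Rightarrow> ('x1 \<Rightarrow> 'x2) \<Rightarrow> (('x1 + 'x2) set, ('v1 + 'v2) set) fibred_space" where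
  "glue_bundle V1 V2 Y ft f =
     \<lparr> Base = glue_space (Base V1) (Base V2) Y f,
       Total = glue_space (Total V1) (Total V2) (over V1 Y) ft,
       Proj = glue_case (Total V1) (Total V2) (over V1 Y) ft
         (\<lambda>v. glue_in1 (Base V1) (Base V2) Y f (Proj V1 v))
         (\<lambda>v. glue_in2 (Base V1) (Base V2) Y f (Proj V2 v)),
       Fib = glue_case (Base V1) (Base V2) Y f
         (\<lambda>x. transport_vs (total_in1 V1 V2 Y ft) (Fib V1 x))
         (\<lambda>x. transport_vs (total_in2 V1 V2 Y ft) (Fib V2 x)) \<rparr>"

definition compatible_forms ::
  "('x1, 'v1) fibred_space \<Rightarrow> 'x1 set \<Rightarrow> ('v1 \<Rightarrow> 'v2) \<Rightarrow> ('x1 \<Rightarrow> 'x2) \<Rightarrow>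
   ('x1 \<Rightarrow> 'v1 \<Rightarrow> 'v1 \<Rightarrow> real) \<Rightarrow> ('x2 \<Rightarrow> 'v2 \<Rightarrow> 'v2 \<Rightarrow> real) \<Rightarrow> bool" where
  "compatible_forms V1 Y ft f b1 b2 \<longleftrightarrow>
     (\<forall>y\<in>Y. \<forall>v\<in>carrier (Fib V1 y). \<forall>w\<in>carrier (Fib V1 y). b1 y v w = b2 (f y) (ft v) (ft w))"


section \<open>The gluing-dual commutativity condition\<close>

definition dual_lift ::
  "('x1, 'v1) fibred_space \<Rightarrow> 'x1 set \<Rightarrow> ('v1 \<Rightarrow> 'v2) \<Rightarrow> ('x1 \<Rightarrow> 'x2) \<Rightarrow>
   'x2 \<times> ('v2 \<Rightarrow> real) \<Rightarrow> 'x1 \<times> ('v1 \<Rightarrow> real)" where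
  "dual_lift V1 Y ft f = (\<lambda>(x', \<xi>).
     let y = inv_into Y f x' in (y, \<lambda>v\<in>carrier (Fib V1 y). \<xi> (ft v)))"

definition switch_map ::
  "('x1, 'v1) fibred_space \<Rightarrow> ('x2, 'v2) fibred_space \<Rightarrow> 'x1 set \<Rightarrow> ('x1 \<Rightarrow> 'x2) \<Rightarrow>
   ('x1 + 'x2) set \<Rightarrow> ('x2 + 'x1) set" where
  "switch_map V1 V2 Y f =
     (let i1 = glue_in1 (Base V2) (Base V1) (f ` Y) (inv_into Y f);
          i2 = glue_in2 (Base V2) (Base V1) (f ` Y) (inv_into Y f)
      in glue_case (Base V1) (Base V2) Y f
           i2 (\<lambda>x'. if x' \<in> f ` Y then i2 (inv_into Y f x') else i1 x'))"

definition gluing_dual_map ::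
  "('x1, 'v1) fibred_space \<Rightarrow> ('x2, 'v2) fibred_space \<Rightarrow> 'x1 set \<Rightarrow>
   ('v1 \<Rightarrow> 'v2) \<Rightarrow> ('x1 \<Rightarrow> 'x2) \<Rightarrow>
   ('x1 + 'x2) set \<times> (('v1 + 'v2) set \<Rightarrow> real) \<Rightarrow>
   (('x2 \<times> ('v2 \<Rightarrow> real)) + ('x1 \<times> ('v1 \<Rightarrow> real))) set" where
  "gluing_dual_map V1 V2 Y ft f = (\<lambda>(c, \<xi>).
     let ft' = dual_lift V1 Y ft f;
         k1 = total_in1 (dual_bundle V2) (dual_bundle V1) (f ` Y) ft';
         k2 = total_in2 (dual_bundle V2) (dual_bundle V1) (f ` Y) ft';
         pull1 = (\<lambda>x. (x, \<lambda>v\<in>carrier (Fib V1 x). \<xi> (total_in1 V1 V2 Y ft v)));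
         pull2 = (\<lambda>x. (x, \<lambda>v\<in>carrier (Fib V2 x). \<xi> (total_in2 V1 V2 Y ft v)))
     in glue_case (Base V1) (Base V2) Y f
          (\<lambda>x. k2 (pull1 x))
          (\<lambda>x. if x \<in> f ` Y then k2 (ft' (pull2 x)) else k1 (pull2 x)) c)"

definition gluing_dual_commutative ::
  "('x1, 'v1) fibred_space \<Rightarrow> ('x2, 'v2) fibred_space \<Rightarrow> 'x1 set \<Rightarrow>
   ('v1 \<Rightarrow> 'v2) \<Rightarrow> ('x1 \<Rightarrow> 'x2) \<Rightarrow> bool" where
  "gluing_dual_commutative V1 V2 Y ft f \<longleftrightarrow>
     (let V = dual_bundle (glue_bundle V1 V2 Y ft f);
          W = glue_bundle (dual_bundle V2) (dual_bundle V1) (f ` Y)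
                (dual_lift V1 Y ft f) (inv_into Y f);
          \<Phi> = gluing_dual_map V1 V2 Y ft f
      in diffeomorphism (Total V) (Total W) \<Phi> \<and>
         (\<forall>a\<in>pts (Total V). Proj W (\<Phi> a) = switch_map V1 V2 Y f (Proj V a)))"

end

theory Submission
  imports Defs
begin

text \<open>
  A map into a glued space is a plot if it locally lifts to one of the two parts. So \<open>(V1 \<union> V2)*\<close> is
  covered, diffeologically, by \<open>V1*\<close> and \<open>V2*\<close>, and the gluing-dual map and its inverse are read off
  these charts, as soon as the maps \<open>V1* \<rightarrow> (V1 \<union> V2)*\<close> and \<open>V2* \<rightarrow> (V1 \<union> V2)*\<close> are known to be
  smooth. For the first one this means that over \<open>Y\<close> the dual lift \<open>ft*\<close> has a smooth inverse.

  Since a pseudo-metric has maximal rank, the pairing \<open>\<Psi>\<close> maps each fibre onto its dual. Compatibility of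
  \<open>g1, g2\<close> says \<open>\<Psi>1 = ft* \<circ> \<Psi>2 \<circ> ft\<close>, whence \<open>ft*\<close> is onto; compatibility of the induced metrics, which
  are definite, makes \<open>ft*\<close> injective. In a locally trivial pseudo-bundle a smooth variant of
  Gram-Schmidt lifts a plot \<open>q\<close> of \<open>V1*\<close> locally to a plot \<open>v\<close> of \<open>V1\<close> with \<open>\<Psi>1 v = q\<close>. The inverse of \<open>ft*\<close>
  then sends \<open>q\<close> to \<open>\<Psi>2 (ft v) = g2(ft v, -)\<close>, which is smooth because \<open>g2\<close> is.
\<close>

section \<open>Calculus of smooth functions\<close>

text \<open>Over \<open>Y\<close> the fibre of the glued bundle is a fibre of \<open>V2\<close>, and
  \<open>Y\<close> need not be open, so a plot of the dual of \<open>V1\<close> may meet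
  \<open>Y\<close> in an arbitrary set. To be a plot of the glued dual it has to be tested against
  every plot of the glued total space, also against those coming from \<open>V2\<close>; these see
  it only over \<open>Y\<close> and only after a reparametrisation. Hence the inverse of the dual
  lift must be smooth along plots, and hence smooth functions must be closed under composition. The
  pseudo-metrics may be degenerate on their fibres. This does no harm because smooth functionals
  cannot tell apart vectors that differ by an isotropic one, so lifts through the pairing are needed
  only up to such vectors. A pseudo-metric is smooth only as a section of a tensor bundle whose
  diffeology is an intersection of all admissible ones. To evaluate it along plots of the bundle,
  one admissible diffeology is exhibited whose plots evaluate smoothly; the finest one is never
  described.\<close>

lemma Euclidean_space_top_of_set: "Euclidean_space n = top_of_set {x. \<forall>i\<ge>n. x i = 0}"
  by (simp add: Euclidean_space_def euclidean_product_topology)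

text \<open>Partial derivatives in \<open>C_k\<close> are two-sided derivatives along
  \<open>x(i := t)\<close>, so they depend on \<open>F\<close> near \<open>x\<close> on this line;
  the lemma keeps that part of the line in \<open>U\<close>. The bound \<open>i < n\<close> matters,
  since changing a later coordinate leaves n-dimensional space.\<close>

lemma eventually_line_in:
  assumes U: "openin (Euclidean_space n) U" and x: "x \<in> U" and i: "i < n"
  shows "\<forall>\<^sub>F t in nhds (x i). x(i := t) \<in> U"
proof -
  obtain T where T: "open T" "U = {x. \<forall>i\<ge>n. x i = 0} \<inter> T"
    using U unfolding Euclidean_space_top_of_set openin_open by blast
  have "continuous_on UNIV (\<lambda>t. x(i := t))"
  proof (rule continuous_on_coordinatewise_then_product)
    show "continuous_on UNIV (\<lambda>t. (x(i := t)) j)" for j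
      by (cases "j = i") (auto intro: continuous_intros)
  qed
  then have "open ((\<lambda>t. x(i := t)) -` T)"
    using T(1) by (simp add: continuous_on_open_vimage)
  moreover have "x i \<in> (\<lambda>t. x(i := t)) -` T" using x T by simp
  ultimately have "\<forall>\<^sub>F t in nhds (x i). t \<in> (\<lambda>t. x(i := t)) -` T"
    by (metis eventually_nhds)
  then show ?thesis
    by eventually_elim (use x T i in auto)
qed

lemma C_k_cong:
  assumes U: "openin (Euclidean_space n) U" and eq: "\<And>x. x \<in> U \<Longrightarrow> F x = G x"
  shows "C_k n k U F \<longleftrightarrow> C_k n k U G"
proof (cases k)
  case 0
  then show ?thesis using eq by (simp cong: continuous_on_cong)
next
  case (Suc k)
  have "((\<lambda>t. F (x(i := t))) has_real_derivative D) (at (x i)) \<longleftrightarrow>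
        ((\<lambda>t. G (x(i := t))) has_real_derivative D) (at (x i))" if "x \<in> U" "i < n" for x i D
  proof (rule DERIV_cong_ev)
    show "\<forall>\<^sub>F t in nhds (x i). F (x(i := t)) = G (x(i := t))"
      using eventually_line_in[OF U that] by eventually_elim (simp add: eq)
  qed simp_all
  moreover have "continuous_on U F \<longleftrightarrow> continuous_on U G"
    using eq by (simp cong: continuous_on_cong)
  ultimately show ?thesis using Suc by simp
qed

lemma C_k_Suc_imp: "C_k n (Suc k) U F \<Longrightarrow> C_k n k U F"
  by (induction k arbitrary: F) (simp, metis C_k.simps(2))

lemma C_k_continuous: "C_k n k U F \<Longrightarrow> continuous_on U F"
  by (cases k) auto

lemma C_k_SucI:
  assumes "continuous_on U F"
    and "\<And>i x. i < n \<Longrightarrow> x \<in> U \<Longrightarrow> ((\<lambda>t. F (x(i := t))) has_real_derivative G i x) (at (x i))"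
    and "\<And>i. i < n \<Longrightarrow> C_k n k U (G i)"
  shows "C_k n (Suc k) U F"
  using assms by auto

lemma C_k_SucE:
  assumes "C_k n (Suc k) U F"
  obtains G where "\<And>i x. i < n \<Longrightarrow> x \<in> U \<Longrightarrow> ((\<lambda>t. F (x(i := t))) has_real_derivative G i x) (at (x i))"
    and "\<And>i. i < n \<Longrightarrow> C_k n k U (G i)"
  using assms by simp metis

lemma C_k_local:
  assumes U: "openin (Euclidean_space n) U"
    and loc: "\<And>x. x \<in> U \<Longrightarrow> \<exists>W. openin (Euclidean_space n) W \<and> x \<in> W \<and> W \<subseteq> U \<and> C_k n k W F"
  shows "C_k n k U F"
  using loc
proof (induction k arbitrary: F)
  case 0
  show ?case
    unfolding C_k.simps
  proof (subst continuous_on_eq_continuous_within, rule ballI)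
    fix x assume "x \<in> U"
    then obtain W where W: "openin (Euclidean_space n) W" "x \<in> W" "W \<subseteq> U" "continuous_on W F"
      using 0 by force
    then obtain T where T: "open T" "W = {x. \<forall>i\<ge>n. x i = 0} \<inter> T"
      unfolding Euclidean_space_top_of_set openin_open by blast
    have "U \<subseteq> {x. \<forall>i\<ge>n. x i = 0}"
      using openin_subset[OF U] by (simp add: topspace_Euclidean_space)
    then have "W = U \<inter> T" using W T by blast
    moreover have "continuous (at x within W) F"
      using W by (simp add: continuous_on_eq_continuous_within)
    moreover have "at x within U \<inter> T = at x within U"
      using T W(2) by (intro at_within_nhd[of x T]) auto
    ultimately show "continuous (at x within U) F"
      by (simp add: continuous_within)

  qed
next
  case (Suc k)
  \<comment> \<open>The partial derivatives obtained on different sets \<open>W\<close> are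
    unrelated existential witnesses; \<open>deriv\<close> picks one function on all of
    \<open>U\<close>, and uniqueness of derivatives matches it with each of them.\<close>
  define G where "G i x = deriv (\<lambda>t. F (x(i := t))) (x i)" for i x
  have cont: "continuous_on U F"
  proof -
    have "C_k n 0 U F" by (rule Suc.IH[of F, THEN C_k_continuous, folded C_k.simps(1)[of n]])
       (meson C_k_Suc_imp Suc.prems)
    then show ?thesis by simp
  qed
  show ?case
  proof (rule C_k_SucI[where G = G])
    fix i x assume "i < n" "x \<in> U"
    then show "((\<lambda>t. F (x(i := t))) has_real_derivative G i x) (at (x i))"
      unfolding G_def using Suc.prems[of x]
      by (metis C_k_SucE DERIV_imp_deriv)
  next
    fix i assume i: "i < n"
    show "C_k n k U (G i)"
    proof (rule Suc.IH)
      fix x assume "x \<in> U"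
      then obtain W H where W: "openin (Euclidean_space n) W" "x \<in> W" "W \<subseteq> U"
        and H: "\<And>y. y \<in> W \<Longrightarrow> ((\<lambda>t. F (y(i := t))) has_real_derivative H y) (at (y i))"
          "C_k n k W H"
        using Suc.prems[of x] i unfolding C_k.simps by blast
      have "C_k n k W (G i)"
        using H(2) by (subst C_k_cong[OF W(1)]) (auto simp: G_def DERIV_imp_deriv[OF H(1)])
      with W show "\<exists>W. openin (Euclidean_space n) W \<and> x \<in> W \<and> W \<subseteq> U \<and> C_k n k W (G i)" by blast
    qed
  qed (fact cont)
qed

lemma C_k_const [simp]: "C_k n k U (\<lambda>_. c)"
  by (induction k arbitrary: c) (auto intro!: exI[of _ "\<lambda>_. 0"])

lemma continuous_on_coordinate [continuous_intros]: "continuous_on U (\<lambda>x::nat \<Rightarrow> real. x j)"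
  by (rule continuous_on_product_coordinates[THEN continuous_on_subset]) auto

lemma C_k_coordinate: "C_k n k U (\<lambda>x. x j)"
proof (cases k)
  case (Suc k)
  show ?thesis
    unfolding Suc
  proof (rule C_k_SucI[where G = "\<lambda>i _. if i = j then 1 else 0"])
    show "((\<lambda>t. (x(i := t)) j) has_real_derivative (if i = j then 1 else 0)) (at (x i))" for i x
      by (cases "i = j") auto
  qed (auto intro: continuous_intros)
qed (auto intro: continuous_intros)

lemma C_k_add: "C_k n k U F \<Longrightarrow> C_k n k U G \<Longrightarrow> C_k n k U (\<lambda>x. F x + G x)"
proof (induction k arbitrary: F G)
  case (Suc k)
  obtain F' where F': "\<And>i x. i < n \<Longrightarrow> x \<in> U \<Longrightarrow> ((\<lambda>t. F (x(i := t))) has_real_derivative F' i x) (at (x i))"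
    "\<And>i. i < n \<Longrightarrow> C_k n k U (F' i)" using C_k_SucE[OF Suc.prems(1)] by metis
  obtain G' where G': "\<And>i x. i < n \<Longrightarrow> x \<in> U \<Longrightarrow> ((\<lambda>t. G (x(i := t))) has_real_derivative G' i x) (at (x i))"
    "\<And>i. i < n \<Longrightarrow> C_k n k U (G' i)" using C_k_SucE[OF Suc.prems(2)] by metis
  show ?case
  proof (rule C_k_SucI[where G = "\<lambda>i x. F' i x + G' i x"])
    show "continuous_on U (\<lambda>x. F x + G x)"
      using Suc.prems by (auto intro!: continuous_intros)
    show "C_k n k U (\<lambda>x. F' i x + G' i x)" if "i < n" for i
      using F'(2)[OF that] G'(2)[OF that] by (rule Suc.IH)
    show "((\<lambda>t. F (x(i := t)) + G (x(i := t))) has_real_derivative F' i x + G' i x) (at (x i))"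
      if "i < n" "x \<in> U" for i x
      using DERIV_add[OF F'(1)[OF that] G'(1)[OF that]] by simp
  qed
qed (auto intro: continuous_intros)

lemma C_k_mult: "C_k n k U F \<Longrightarrow> C_k n k U G \<Longrightarrow> C_k n k U (\<lambda>x. F x * G x)"
proof (induction k arbitrary: F G)
  case (Suc k)
  obtain F' where F': "\<And>i x. i < n \<Longrightarrow> x \<in> U \<Longrightarrow> ((\<lambda>t. F (x(i := t))) has_real_derivative F' i x) (at (x i))"
    "\<And>i. i < n \<Longrightarrow> C_k n k U (F' i)" using C_k_SucE[OF Suc.prems(1)] by metis
  obtain G' where G': "\<And>i x. i < n \<Longrightarrow> x \<in> U \<Longrightarrow> ((\<lambda>t. G (x(i := t))) has_real_derivative G' i x) (at (x i))"
    "\<And>i. i < n \<Longrightarrow> C_k n k U (G' i)" using C_k_SucE[OF Suc.prems(2)] by metis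
  show ?case
  proof (rule C_k_SucI[where G = "\<lambda>i x. F' i x * G x + G' i x * F x"])
    show "continuous_on U (\<lambda>x. F x * G x)"
      using Suc.prems by (auto intro!: continuous_intros)
    fix i assume i: "i < n"
    show "C_k n k U (\<lambda>x. F' i x * G x + G' i x * F x)"
      using Suc.prems[THEN C_k_Suc_imp] F'(2)[OF i] G'(2)[OF i] by (intro C_k_add Suc.IH)
    fix x assume x: "x \<in> U"
    show "((\<lambda>t. F (x(i := t)) * G (x(i := t))) has_real_derivative F' i x * G x + G' i x * F x) (at (x i))"
      using DERIV_mult[OF F'(1)[OF i x] G'(1)[OF i x]] by simp
  qed
qed (auto intro: continuous_intros)

lemma C_k_inverse:
  "C_k n k U F \<Longrightarrow> (\<And>x. x \<in> U \<Longrightarrow> F x \<noteq> 0) \<Longrightarrow> C_k n k U (\<lambda>x. inverse (F x))"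
proof (induction k)
  case (Suc k)
  obtain F' where F': "\<And>i x. i < n \<Longrightarrow> x \<in> U \<Longrightarrow> ((\<lambda>t. F (x(i := t))) has_real_derivative F' i x) (at (x i))"
    "\<And>i. i < n \<Longrightarrow> C_k n k U (F' i)" using C_k_SucE[OF Suc.prems(1)] by metis
  show ?case
  \<comment> \<open>The derivative \<open>-F'/F^2\<close> is written as a product of inverses, so
    that \<open>C_k_mult\<close> and the induction hypothesis at order \<open>k\<close>
    apply.\<close>
  proof (rule C_k_SucI[where G = "\<lambda>i x. (-1) * (inverse (F x) * F' i x * inverse (F x))"])
    show "continuous_on U (\<lambda>x. inverse (F x))"
      using Suc.prems by (auto intro!: continuous_intros)
    have "C_k n k U (\<lambda>x. inverse (F x))"
      using Suc by (metis C_k_Suc_imp)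
    then show "C_k n k U (\<lambda>x. (-1) * (inverse (F x) * F' i x * inverse (F x)))" if "i < n" for i
      using F'(2)[OF that] by (intro C_k_mult C_k_const)
    fix i x assume i: "i < n" and x: "x \<in> U"
    show "((\<lambda>t. inverse (F (x(i := t)))) has_real_derivative (-1) * (inverse (F x) * F' i x * inverse (F x))) (at (x i))"
      using DERIV_inverse'[OF F'(1)[OF i x]] Suc.prems(2)[OF x] by simp
  qed
qed (auto intro: continuous_intros)

lemma C_k_sum:
  "(\<And>j. j \<in> J \<Longrightarrow> C_k n k U (F j)) \<Longrightarrow> C_k n k U (\<lambda>x. \<Sum>j\<in>J. F j x)"
  by (induction J rule: infinite_finite_induct) (auto intro: C_k_add)

section \<open>The chain rule from continuous partial derivatives\<close>

lemma openin_Euclidean_space_box: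
  assumes U: "openin (Euclidean_space n) U" and a: "a \<in> U"
  obtains d where "d > 0"
    "\<And>z. z \<in> topspace (Euclidean_space n) \<Longrightarrow> (\<And>i. i < n \<Longrightarrow> \<bar>z i - a i\<bar> < d) \<Longrightarrow> z \<in> U"
proof -
  obtain T where T: "openin (powertop_real UNIV) T" "U = {x. \<forall>i\<ge>n. x i = 0} \<inter> T"
    using U unfolding Euclidean_space_def openin_subtopology by blast
  obtain X where X: "a \<in> (\<Pi>\<^sub>E i\<in>UNIV. X i)" "\<And>i. open (X i)" "(\<Pi>\<^sub>E i\<in>UNIV. X i) \<subseteq> T"
    using product_topology_open_contains_basis[OF T(1), of a] a T(2) by auto
  have "\<exists>e>0. \<forall>y. \<bar>y - a i\<bar> < e \<longrightarrow> y \<in> X i" for i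
    using X(1,2) by (metis PiE_E UNIV_I dist_real_def open_dist)
  then obtain e where e: "\<And>i. e i > 0" "\<And>i y. \<bar>y - a i\<bar> < e i \<Longrightarrow> y \<in> X i" by metis
  \<comment> \<open>Only the first \<open>n\<close> coordinates need a bound, as both points vanish
    beyond; the extra \<open>1\<close> keeps the set nonempty when \<open>n = 0\<close>.\<close>
  define d where "d = Min (insert 1 (e ` {..<n}))"
  show thesis
  proof
    show "d > 0" using e(1) by (simp add: d_def)
    fix z assume z: "z \<in> topspace (Euclidean_space n)" "\<And>i. i < n \<Longrightarrow> \<bar>z i - a i\<bar> < d"
    have "z i \<in> X i" for i
    proof (cases "i < n")
      case True
      then have "d \<le> e i" by (simp add: d_def)
      then show ?thesis using z(2)[OF True] e(2) by fastforce
    next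
      case False
      then have "z i = a i" using z(1) a T(2) by (simp add: topspace_Euclidean_space)
      then show ?thesis using X(1) by auto
    qed
    then show "z \<in> U" using T(2) X(3) z(1) by (auto simp: topspace_Euclidean_space)
  qed
qed

text \<open>The endpoints may come in either order or coincide, because a coordinate of the curve
  below can lie on either side of its value at the base point.\<close>

lemma mean_value_between:
  fixes f :: "real \<Rightarrow> real"
  assumes "\<And>s. min a b \<le> s \<Longrightarrow> s \<le> max a b \<Longrightarrow> (f has_real_derivative f' s) (at s)"
  obtains s where "min a b \<le> s" "s \<le> max a b" "f b - f a = f' s * (b - a)"
proof (cases a b rule: linorder_cases)
  case less
  with MVT2[of a b f f'] assms obtain s where "a < s" "s < b" "f b - f a = (b - a) * f' s"
    by (metis less_imp_le max.absorb2 min.absorb1)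
  with less show ?thesis by (intro that[of s]) (auto simp: algebra_simps)
next
  case greater
  with MVT2[of b a f f'] assms obtain s where "b < s" "s < a" "f a - f b = (a - b) * f' s"
    by (metis less_imp_le max.absorb1 min.absorb2)
  with greater show ?thesis by (intro that[of s]) (auto simp: algebra_simps)
next
  case equal
  then show ?thesis by (intro that[of a]) auto
qed

text \<open>Existence of partial derivatives alone gives no chain rule; their continuity does. The
  passage from \<open>\<gamma> t0\<close> to \<open>\<gamma> t\<close> is broken into moves of one
  coordinate each, and each move is handled by the one-variable mean value theorem.\<close>

lemma DERIV_along_curve:
  assumes U: "openin (Euclidean_space n) U" and t0: "\<gamma> t0 \<in> U"
    and F: "\<And>j x. j < n \<Longrightarrow> x \<in> U \<Longrightarrow> ((\<lambda>t. F (x(j := t))) has_real_derivative G j x) (at (x j))"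
    and G: "\<And>j. j < n \<Longrightarrow> continuous_on U (G j)"
    and \<gamma>: "\<And>j. j < n \<Longrightarrow> ((\<lambda>t. \<gamma> t j) has_real_derivative c j) (at t0)"
    and \<gamma>U: "\<forall>\<^sub>F t in nhds t0. \<gamma> t \<in> U"
  shows "((\<lambda>t. F (\<gamma> t)) has_real_derivative (\<Sum>j<n. G j (\<gamma> t0) * c j)) (at t0)"
proof -
  define a where "a = \<gamma> t0"
  \<comment> \<open>The point \<open>h j t\<close> has its first \<open>j\<close> coordinates on the
    curve and the others at the base point: \<open>h 0 t\<close> is constant, and
    \<open>h n t\<close> is \<open>\<gamma> t\<close> once this lies in \<open>U\<close>.\<close>
  define h where "h j t = (\<lambda>i. if i < j then \<gamma> t i else a i)" for j t
  have aE: "a i = 0" if "i \<ge> n" for i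
    using openin_subset[OF U] t0 that by (auto simp: a_def topspace_Euclidean_space)
  have near: "\<forall>\<^sub>F t in nhds t0. \<forall>i\<in>{..<n}. \<bar>\<gamma> t i - a i\<bar> < d" if "d > 0" for d
  proof (rule eventually_ball_finite, simp, rule ballI)
    fix i assume "i \<in> {..<n}"
    then have "isCont (\<lambda>t. \<gamma> t i) t0" using \<gamma> by (auto intro: DERIV_isCont)
    then have "((\<lambda>t. \<gamma> t i) \<longlongrightarrow> \<gamma> t0 i) (nhds t0)"
      unfolding isCont_def by (rule tendsto_at_iff_tendsto_nhds[THEN iffD1])
    from tendstoD[OF this \<open>d > 0\<close>] show "\<forall>\<^sub>F t in nhds t0. \<bar>\<gamma> t i - a i\<bar> < d"
      by (simp add: dist_real_def a_def)
  qed
  have "((\<lambda>t. F (h j t)) has_real_derivative (\<Sum>i<j. G i a * c i)) (at t0)" if "j \<le> n" for j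
    using that
  proof (induction j)
    case 0
    then show ?case by (simp add: h_def)
  next
    case (Suc j)
    then have j: "j < n" by simp
    define D where "D t = F (h (Suc j) t) - F (h j t)" for t
    \<comment> \<open>Caratheodory's quotient for the \<open>j\<close>-th move. The value where the
      coordinates coincide is set to the partial derivative, so that
      \<open>D t = p t * (\<gamma> t j - a j)\<close> holds for all \<open>t\<close> and only
      continuity of \<open>p\<close> at \<open>t0\<close> is left.\<close>
    define p where "p t = (if \<gamma> t j = a j then G j a else D t / (\<gamma> t j - a j))" for t
    have h_Suc: "h (Suc j) t = (h j t)(j := \<gamma> t j)" for t
      by (auto simp: h_def less_Suc_eq)
    have h_self: "(h j t)(j := a j) = h j t" for t
      by (auto simp: h_def)
    have "isCont p t0"
      unfolding continuous_at_eps_delta[of t0 p, unfolded dist_real_def] continuous_within tendsto_iff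
    proof (intro allI impI)
      fix e :: real assume e: "e > 0"
      have "openin (top_of_set U) (U \<inter> G j -` ball (G j a) e)"
        using G[OF j] by (rule continuous_openin_preimage_gen) simp
      then have "openin (Euclidean_space n) (U \<inter> G j -` ball (G j a) e)"
        using U unfolding Euclidean_space_top_of_set by (rule openin_trans)
      moreover have "a \<in> U \<inter> G j -` ball (G j a) e" using t0 e by (simp add: a_def)
      ultimately obtain d where d: "d > 0"
        "\<And>z. z \<in> topspace (Euclidean_space n) \<Longrightarrow> (\<And>i. i < n \<Longrightarrow> \<bar>z i - a i\<bar> < d) \<Longrightarrow>
            z \<in> U \<inter> G j -` ball (G j a) e"
        using openin_Euclidean_space_box by metis
      have "\<forall>\<^sub>F t in nhds t0. dist (p t) (p t0) < e"
        using near[OF d(1)]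
      proof eventually_elim
        fix t assume t: "\<forall>i\<in>{..<n}. \<bar>\<gamma> t i - a i\<bar> < d"
        show "dist (p t) (p t0) < e"
        proof (cases "\<gamma> t j = a j")
          case True
          then show ?thesis using e by (simp add: p_def a_def)
        next
          case False
          \<comment> \<open>The whole segment along which the \<open>j\<close>-th coordinate moves
            lies in the box, so the intermediate point does too, and there \<open>G j\<close> is
            within \<open>e\<close> of \<open>G j a\<close>.\<close>
          have seg: "(h j t)(j := s) \<in> U \<inter> G j -` ball (G j a) e"
            if s: "min (a j) (\<gamma> t j) \<le> s" "s \<le> max (a j) (\<gamma> t j)" for s
          proof (rule d(2))
            show "(h j t)(j := s) \<in> topspace (Euclidean_space n)"
              using j aE by (auto simp: topspace_Euclidean_space h_def)
            fix i assume i: "i < n"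
            have "\<bar>s - a j\<bar> \<le> \<bar>\<gamma> t j - a j\<bar>" using s by auto
            also have "\<dots> < d" using t j by simp
            finally show "\<bar>((h j t)(j := s)) i - a i\<bar> < d"
              using t i d(1) by (auto simp: h_def)
          qed
          obtain s where s: "min (a j) (\<gamma> t j) \<le> s" "s \<le> max (a j) (\<gamma> t j)"
            "F ((h j t)(j := \<gamma> t j)) - F ((h j t)(j := a j)) = G j ((h j t)(j := s)) * (\<gamma> t j - a j)"
          proof (rule mean_value_between[of "a j" "\<gamma> t j" "\<lambda>s. F ((h j t)(j := s))" "\<lambda>s. G j ((h j t)(j := s))"])
            fix s assume "min (a j) (\<gamma> t j) \<le> s" "s \<le> max (a j) (\<gamma> t j)"
            with seg have "(h j t)(j := s) \<in> U" by blast
            from F[OF j this]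
            show "((\<lambda>s. F ((h j t)(j := s))) has_real_derivative G j ((h j t)(j := s))) (at s)"
              by simp
          qed (use that in blast)
          then have "p t = G j ((h j t)(j := s))"
            using False by (simp add: p_def D_def h_Suc h_self)
          then show ?thesis using seg[OF s(1,2)] by (simp add: p_def a_def dist_commute)
        qed
      qed
      then show "\<forall>\<^sub>F t in at t0. dist (p t) (p t0) < e"
        unfolding eventually_at_filter by (rule eventually_mono) simp
    qed
    moreover obtain q where q: "\<And>t. \<gamma> t j - \<gamma> t0 j = q t * (t - t0)" "isCont q t0" "q t0 = c j"
      using \<gamma>[OF j] unfolding CARAT_DERIV by metis
    moreover have "D t - D t0 = p t * q t * (t - t0)" for t
    proof -
      have "D t = p t * (\<gamma> t j - a j)"
        using h_Suc[of t] h_self[of t] by (auto simp: p_def D_def)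
      moreover have "D t0 = 0" using h_Suc[of t0] h_self[of t0] by (simp add: D_def a_def)
      ultimately show ?thesis using q(1)[of t] by (simp add: a_def)
    qed
    ultimately have "(D has_real_derivative p t0 * q t0) (at t0)"
      unfolding CARAT_DERIV by (intro exI[of _ "\<lambda>t. p t * q t"]) (auto intro: continuous_intros)
    then have "(D has_real_derivative G j a * c j) (at t0)"
      using q(3) by (simp add: p_def a_def)
    from DERIV_add[OF Suc.IH[OF less_imp_le[OF j]] this] show ?case
      by (simp add: D_def)
  qed
  from this[of n] have "((\<lambda>t. F (h n t)) has_real_derivative (\<Sum>j<n. G j (\<gamma> t0) * c j)) (at t0)"
    by (simp add: a_def)
  moreover have "\<forall>\<^sub>F t in nhds t0. F (h n t) = F (\<gamma> t)"
    using \<gamma>U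
  proof eventually_elim
    fix t assume "\<gamma> t \<in> U"
    then have "h n t = \<gamma> t"
      using openin_subset[OF U] aE by (fastforce simp: h_def topspace_Euclidean_space)
    then show "F (h n t) = F (\<gamma> t)" by simp
  qed
  ultimately show ?thesis by (metis DERIV_cong_ev)
qed

text \<open>The partial derivatives of the composite are sums of products
  \<open>G j (P x) * H j i x\<close>, whose first factors are composites with the same
  \<open>P\<close>. Hence the induction generalises \<open>F\<close> and keeps \<open>P\<close>,
  lowering the order of \<open>P\<close> by \<open>C_k_Suc_imp\<close>.\<close>

lemma C_k_compose:
  assumes U: "openin (Euclidean_space n) U" and W: "openin (Euclidean_space m) W"
    and PU: "P ` W \<subseteq> U"
    and F: "C_k n k U F" and P: "\<And>j. j < n \<Longrightarrow> C_k m k W (\<lambda>x. P x j)"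
  shows "C_k m k W (\<lambda>x. F (P x))"
  using F P
proof (induction k arbitrary: F)
  case 0
  have "continuous_on W P"
  proof (rule continuous_on_coordinatewise_then_product)
    fix j show "continuous_on W (\<lambda>x. P x j)"
    proof (cases "j < n")
      case False
      \<comment> \<open>Coordinates from \<open>n\<close> on are not covered by the hypotheses on
        \<open>P\<close>; they vanish because \<open>P\<close> takes values in
        \<open>U\<close>.\<close>
      then have "P x j = 0" if "x \<in> W" for x
        using PU openin_subset[OF U] that by (force simp: topspace_Euclidean_space)
      then show ?thesis by (simp cong: continuous_on_cong)
    qed (use 0 in simp)
  qed
  then show ?case using 0(1) continuous_on_compose2[OF _ _ PU, of F] unfolding C_k.simps by blast
next
  case (Suc k)
  obtain G where G: "\<And>j x. j < n \<Longrightarrow> x \<in> U \<Longrightarrow> ((\<lambda>t. F (x(j := t))) has_real_derivative G j x) (at (x j))"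
    "\<And>j. j < n \<Longrightarrow> C_k n k U (G j)" using C_k_SucE[OF Suc.prems(1)] by metis
  have "\<exists>H. \<forall>i<m. (\<forall>x\<in>W. ((\<lambda>t. P (x(i := t)) j) has_real_derivative H i x) (at (x i))) \<and> C_k m k W (H i)"
    if "j < n" for j
    using C_k_SucE[OF Suc.prems(2)[OF that]] by metis
  then obtain H where H: "\<And>j i x. j < n \<Longrightarrow> i < m \<Longrightarrow> x \<in> W \<Longrightarrow>
      ((\<lambda>t. P (x(i := t)) j) has_real_derivative H j i x) (at (x i))"
    "\<And>j i. j < n \<Longrightarrow> i < m \<Longrightarrow> C_k m k W (H j i)" by metis
  have P_k: "C_k m k W (\<lambda>x. P x j)" if "j < n" for j
    using Suc.prems(2)[OF that] by (rule C_k_Suc_imp)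
  show ?case
  proof (rule C_k_SucI[where G = "\<lambda>i x. \<Sum>j<n. G j (P x) * H j i x"])
    show "continuous_on W (\<lambda>x. F (P x))"
      by (rule C_k_continuous[OF Suc.IH[OF C_k_Suc_imp[OF Suc.prems(1)] P_k]])
    show "C_k m k W (\<lambda>x. \<Sum>j<n. G j (P x) * H j i x)" if "i < m" for i
      using H(2) that Suc.IH[OF G(2) P_k] by (intro C_k_sum C_k_mult[of m k W "\<lambda>x. G _ (P x)"]) auto
    fix i x assume i: "i < m" and x: "x \<in> W"
    have "((\<lambda>t. F (P (x(i := t)))) has_real_derivative (\<Sum>j<n. G j (P (x(i := x i))) * H j i x)) (at (x i))"
    proof (rule DERIV_along_curve[OF U])
      show "P (x(i := x i)) \<in> U" using x PU by auto
      show "\<forall>\<^sub>F t in nhds (x i). P (x(i := t)) \<in> U"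
        using eventually_line_in[OF W x i] by eventually_elim (use PU in auto)
      show "continuous_on U (G j)" if "j < n" for j
        using G(2)[OF that] by (rule C_k_continuous)
      show "((\<lambda>t. P (x(i := t)) j) has_real_derivative H j i x) (at (x i))" if "j < n" for j
        using that i x by (rule H(1))
    qed (rule G(1))
    then show "((\<lambda>t. F (P (x(i := t)))) has_real_derivative (\<Sum>j<n. G j (P x) * H j i x)) (at (x i))"
      by simp
  qed
qed

section \<open>Smooth functions: locality and closure properties\<close>

lemma C_infinity_cong:
  "openin (Euclidean_space n) U \<Longrightarrow> (\<And>x. x \<in> U \<Longrightarrow> F x = G x) \<Longrightarrow> C_infinity n U F \<longleftrightarrow> C_infinity n U G"
  unfolding C_infinity_def by (intro iff_allI C_k_cong)

lemma C_infinity_transform: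
  "C_infinity n U F \<Longrightarrow> openin (Euclidean_space n) U \<Longrightarrow> (\<And>x. x \<in> U \<Longrightarrow> G x = F x) \<Longrightarrow> C_infinity n U G"
  using C_infinity_cong[of n U G F] by blast

lemma C_infinity_continuous: "C_infinity n U F \<Longrightarrow> continuous_on U F"
  unfolding C_infinity_def by (blast intro: C_k_continuous)

lemma C_infinity_local:
  assumes "openin (Euclidean_space n) U"
    and "\<And>x. x \<in> U \<Longrightarrow> \<exists>W. openin (Euclidean_space n) W \<and> x \<in> W \<and> W \<subseteq> U \<and> C_infinity n W F"
  shows "C_infinity n U F"
  unfolding C_infinity_def
proof
  fix k
  show "C_k n k U F"
  proof (rule C_k_local[OF assms(1)])
    fix x assume "x \<in> U"
    from assms(2)[OF this] obtain W where "openin (Euclidean_space n) W" "x \<in> W" "W \<subseteq> U" "C_infinity n W F"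
      by (elim exE conjE)
    then show "\<exists>W. openin (Euclidean_space n) W \<and> x \<in> W \<and> W \<subseteq> U \<and> C_k n k W F"
      by (intro exI[of _ W]) (simp add: C_infinity_def)
  qed
qed

lemma C_infinity_const [simp]: "C_infinity n U (\<lambda>_. c)"
  by (simp add: C_infinity_def)

lemma C_infinity_coordinate: "C_infinity n U (\<lambda>x. x j)"
  by (simp add: C_infinity_def C_k_coordinate)

lemma C_infinity_add: "C_infinity n U F \<Longrightarrow> C_infinity n U G \<Longrightarrow> C_infinity n U (\<lambda>x. F x + G x)"
  by (simp add: C_infinity_def C_k_add)

lemma C_infinity_mult: "C_infinity n U F \<Longrightarrow> C_infinity n U G \<Longrightarrow> C_infinity n U (\<lambda>x. F x * G x)"
  by (simp add: C_infinity_def C_k_mult)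

lemma C_infinity_sum:
  "(\<And>j. j \<in> J \<Longrightarrow> C_infinity n U (F j)) \<Longrightarrow> C_infinity n U (\<lambda>x. \<Sum>j\<in>J. F j x)"
  by (simp add: C_infinity_def C_k_sum)

lemma C_infinity_divide:
  assumes "C_infinity n U F" "C_infinity n U G" "\<And>x. x \<in> U \<Longrightarrow> G x \<noteq> 0"
  shows "C_infinity n U (\<lambda>x. F x / G x)"
  using assms unfolding divide_inverse by (simp add: C_infinity_def C_k_inverse C_k_mult)

lemma C_infinity_compose:
  assumes "openin (Euclidean_space n) U" "openin (Euclidean_space m) W" "P ` W \<subseteq> U"
    and "C_infinity n U F" and "\<And>j. j < n \<Longrightarrow> C_infinity m W (\<lambda>x. P x j)"
  shows "C_infinity m W (\<lambda>x. F (P x))"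
  unfolding C_infinity_def
proof
  fix k
  show "C_k m k W (\<lambda>x. F (P x))"
    by (rule C_k_compose[OF assms(1-3)]) (use assms(4,5) in \<open>simp_all add: C_infinity_def\<close>)
qed


section \<open>Plots\<close>

lemma
  assumes "diffeological_space X"
  shows plot_openin: "plot X n U p \<Longrightarrow> openin (Euclidean_space n) U"
    and plot_in: "plot X n U p \<Longrightarrow> u \<in> U \<Longrightarrow> p u \<in> pts X"
    and plot_const: "openin (Euclidean_space n) U \<Longrightarrow> x \<in> pts X \<Longrightarrow> plot X n U (\<lambda>_. x)"
    and plot_local: "openin (Euclidean_space n) U \<Longrightarrow>
      (\<And>u. u \<in> U \<Longrightarrow> \<exists>W q. u \<in> W \<and> W \<subseteq> U \<and> plot X n W q \<and> (\<forall>w\<in>W. p w = q w)) \<Longrightarrow> plot X n U p"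
    and plot_compose: "plot X n U p \<Longrightarrow> plot (euclid n) m W F \<Longrightarrow> F ` W \<subseteq> U \<Longrightarrow>
      plot X m W (\<lambda>s. p (F s))"
proof -
  note D = assms[unfolded diffeological_space_def]
  show "plot X n U p \<Longrightarrow> openin (Euclidean_space n) U"
    using D[THEN conjunct1] by blast
  show "plot X n U p \<Longrightarrow> u \<in> U \<Longrightarrow> p u \<in> pts X"
    using D[THEN conjunct1] by blast
  show "openin (Euclidean_space n) U \<Longrightarrow> x \<in> pts X \<Longrightarrow> plot X n U (\<lambda>_. x)"
    using D[THEN conjunct2, THEN conjunct1] by blast
  show "openin (Euclidean_space n) U \<Longrightarrow>
      (\<And>u. u \<in> U \<Longrightarrow> \<exists>W q. u \<in> W \<and> W \<subseteq> U \<and> plot X n W q \<and> (\<forall>w\<in>W. p w = q w)) \<Longrightarrow> plot X n U p"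
    by (rule D[THEN conjunct2, THEN conjunct2, THEN conjunct1, rule_format]) simp
  show "plot X n U p \<Longrightarrow> plot (euclid n) m W F \<Longrightarrow> F ` W \<subseteq> U \<Longrightarrow> plot X m W (\<lambda>s. p (F s))"
    using D[THEN conjunct2, THEN conjunct2, THEN conjunct2, rule_format, of n U p m W F]
    by (simp add: comp_def)
qed

lemma plot_cong:
  "diffeological_space X \<Longrightarrow> plot X n U p \<Longrightarrow> (\<And>u. u \<in> U \<Longrightarrow> q u = p u) \<Longrightarrow> plot X n U q"
  by (rule plot_local[OF _ plot_openin]) auto

lemma euclid_plot_openin: "plot (euclid n) m W F \<Longrightarrow> openin (Euclidean_space m) W"
  by (simp add: euclid_def)

lemma euclid_plot_id: "openin (Euclidean_space n) U \<Longrightarrow> plot (euclid n) n U (\<lambda>x. x)"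
  by (auto simp: euclid_def C_infinity_coordinate dest: openin_subset)

lemma euclid_plot_compose:
  assumes "plot (euclid n) m W F" "plot (euclid m) l S G" "G ` S \<subseteq> W"
  shows "plot (euclid n) l S (\<lambda>s. F (G s))"
proof -
  have F: "F ` W \<subseteq> topspace (Euclidean_space n)" "\<And>i. i < n \<Longrightarrow> C_infinity m W (\<lambda>x. F x i)"
    and W: "openin (Euclidean_space m) W"
    using assms(1) by (simp_all add: euclid_def)
  have S: "openin (Euclidean_space l) S" and G: "\<And>i. i < m \<Longrightarrow> C_infinity l S (\<lambda>x. G x i)"
    using assms(2) by (simp_all add: euclid_def)
  have "C_infinity l S (\<lambda>x. F (G x) i)" if "i < n" for i
    by (rule C_infinity_compose[OF W S assms(3) F(2)[OF that] G])
  moreover have "(\<lambda>s. F (G s)) ` S \<subseteq> topspace (Euclidean_space n)"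
    using F(1) assms(3) by blast
  ultimately show ?thesis
    using S by (simp add: euclid_def)
qed

text \<open>Smooth maps are continuous. This allows local statements about a plot to be pulled back
  along a reparametrisation of its domain.\<close>

lemma euclid_plot_preimage:
  assumes F: "plot (euclid n) m W F" and U: "openin (Euclidean_space n) U"
  shows "openin (Euclidean_space m) {w \<in> W. F w \<in> U}"
proof -
  have W: "openin (Euclidean_space m) W" and FW: "F ` W \<subseteq> topspace (Euclidean_space n)"
    and smooth: "\<forall>j<n. C_infinity m W (\<lambda>w. F w j)"
    using F by (simp_all add: euclid_def)
  have Fj: "F w j = 0" if "w \<in> W" "j \<ge> n" for w j
    using FW that unfolding topspace_Euclidean_space by blast
  have Fs: "continuous_on W (\<lambda>w. F w j)" if "j < n" for j
    using smooth that by (blast intro: C_infinity_continuous)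
  obtain T where T: "open T" "U = {x. \<forall>i\<ge>n. x i = 0} \<inter> T"
    using U unfolding Euclidean_space_top_of_set openin_open by blast
  have "continuous_on W (\<lambda>w. F w j)" for j
  proof (cases "j < n")
    case False
    then have "continuous_on W (\<lambda>w. F w j) \<longleftrightarrow> continuous_on W (\<lambda>_. 0::real)"
      by (intro continuous_on_cong) (auto intro: Fj)
    then show ?thesis by simp
  qed (rule Fs)
  then have "continuous_on W F"
    by (intro continuous_on_coordinatewise_then_product)
  then have "openin (top_of_set W) (W \<inter> F -` T)"
    using T(1) by (rule continuous_openin_preimage_gen)
  moreover have "W \<inter> F -` T = {w \<in> W. F w \<in> U}"
    unfolding T(2) using Fj by blast
  ultimately have "openin (top_of_set W) {w \<in> W. F w \<in> U}" by simp
  from openin_trans[OF this W[unfolded Euclidean_space_top_of_set]] show ?thesis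
    by (simp only: Euclidean_space_top_of_set)
qed

lemma plot_restrict:
  assumes "diffeological_space X" "plot X n U p" "openin (Euclidean_space n) W" "W \<subseteq> U"
  shows "plot X n W p"
  using plot_compose[OF assms(1,2) euclid_plot_id[OF assms(3)]] assms(4) by simp

lemma smooth_mapI:
  assumes "\<And>x. x \<in> pts X \<Longrightarrow> f x \<in> pts Y"
    and "\<And>n U p. plot X n U p \<Longrightarrow> plot Y n U (\<lambda>u. f (p u))"
  shows "smooth_map X Y f"
  using assms by (auto simp: smooth_map_def comp_def)

lemma smooth_mapD: "smooth_map X Y f \<Longrightarrow> plot X n U p \<Longrightarrow> plot Y n U (\<lambda>u. f (p u))"
  by (simp add: smooth_map_def comp_def)

lemma smooth_map_in: "smooth_map X Y f \<Longrightarrow> x \<in> pts X \<Longrightarrow> f x \<in> pts Y"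
  by (auto simp: smooth_map_def)

lemma smooth_realD: "smooth_map X real_space f \<Longrightarrow> plot X n U p \<Longrightarrow> C_infinity n U (\<lambda>u. f (p u))"
  by (auto simp: real_space_def dest: smooth_mapD)

lemma smooth_realI:
  assumes "\<And>n U p. plot X n U p \<Longrightarrow> openin (Euclidean_space n) U"
    and "\<And>n U p. plot X n U p \<Longrightarrow> C_infinity n U (\<lambda>u. f (p u))"
  shows "smooth_map X real_space f"
  using assms by (auto simp: smooth_map_def real_space_def comp_def)

lemma plot_subset_space [simp]: "plot (subset_space X A) n U p \<longleftrightarrow> plot X n U p \<and> p ` U \<subseteq> A"
  by (simp add: subset_space_def)

lemma pts_subset_space [simp]: "pts (subset_space X A) = pts X \<inter> A"
  by (simp add: subset_space_def)

lemma plot_prod_space [simp]: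
  "plot (prod_space X Y) n U p \<longleftrightarrow> plot X n U (\<lambda>u. fst (p u)) \<and> plot Y n U (\<lambda>u. snd (p u))"
  by (simp add: prod_space_def comp_def)

lemma pts_prod_space [simp]: "pts (prod_space X Y) = pts X \<times> pts Y"
  by (simp add: prod_space_def)

lemma diffeological_spaceI:
  assumes "\<And>n U p. plot X n U p \<Longrightarrow> openin (Euclidean_space n) U"
    and "\<And>n U p u. plot X n U p \<Longrightarrow> u \<in> U \<Longrightarrow> p u \<in> pts X"
    and "\<And>n U x. openin (Euclidean_space n) U \<Longrightarrow> x \<in> pts X \<Longrightarrow> plot X n U (\<lambda>_. x)"
    and "\<And>n U p. openin (Euclidean_space n) U \<Longrightarrow>
      (\<And>u. u \<in> U \<Longrightarrow> \<exists>W q. u \<in> W \<and> W \<subseteq> U \<and> plot X n W q \<and> (\<forall>w\<in>W. p w = q w)) \<Longrightarrow> plot X n U p"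
    and "\<And>n U p m W F. plot X n U p \<Longrightarrow> plot (euclid n) m W F \<Longrightarrow> F ` W \<subseteq> U \<Longrightarrow>
      plot X m W (\<lambda>s. p (F s))"
  shows "diffeological_space X"
  unfolding diffeological_space_def
proof (intro conjI allI impI)
  show "plot X n U p" if "openin (Euclidean_space n) U \<and>
    (\<forall>u\<in>U. \<exists>W q. u \<in> W \<and> W \<subseteq> U \<and> plot X n W q \<and> (\<forall>w\<in>W. p w = q w))" for n U p
    by (rule assms(4)) (use that in blast)+
  show "plot X m W (p \<circ> F)" if "plot X n U p \<and> plot (euclid n) m W F \<and> F ` W \<subseteq> U" for n U p m W F
    unfolding comp_def by (rule assms(5)) (use that in blast)+
qed (use assms(1-3) in blast)+

lemma diffeological_subset_space:
  assumes X: "diffeological_space X"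
  shows "diffeological_space (subset_space X A)"
proof (rule diffeological_spaceI)
  fix n U p
  assume U: "openin (Euclidean_space n) U"
    and *: "\<And>u. u \<in> U \<Longrightarrow> \<exists>W q. u \<in> W \<and> W \<subseteq> U \<and> plot (subset_space X A) n W q \<and> (\<forall>w\<in>W. p w = q w)"
  have "plot X n U p"
  proof (rule plot_local[OF X U])
    fix u assume "u \<in> U"
    from *[OF this] show "\<exists>W q. u \<in> W \<and> W \<subseteq> U \<and> plot X n W q \<and> (\<forall>w\<in>W. p w = q w)"
      unfolding plot_subset_space by blast
  qed
  moreover have "p u \<in> A" if "u \<in> U" for u
    using *[OF that] unfolding plot_subset_space by fastforce
  ultimately show "plot (subset_space X A) n U p" by auto
next
  fix n U p m W F
  assume "plot (subset_space X A) n U p" "plot (euclid n) m W F" "F ` W \<subseteq> U"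
  then show "plot (subset_space X A) m W (\<lambda>s. p (F s))"
    unfolding plot_subset_space using plot_compose[OF X, of n U p m W F] by blast
next
  fix n U p assume "plot (subset_space X A) n U p"
  then show "openin (Euclidean_space n) U" "u \<in> U \<Longrightarrow> p u \<in> pts (subset_space X A)" for u
    using plot_openin[OF X, of n U p] plot_in[OF X, of n U p u] by auto
next
  fix n U x assume "openin (Euclidean_space n) U" "x \<in> pts (subset_space X A)"
  then show "plot (subset_space X A) n U (\<lambda>_. x)"
    using plot_const[OF X, of n U x] by auto
qed


section \<open>Pseudo-bundles and their duals\<close>

lemma
  assumes "vector_pseudo_bundle V"
  shows bundle_base: "diffeological_space (Base V)"
    and bundle_total: "diffeological_space (Total V)"
    and bundle_proj: "smooth_map (Total V) (Base V) (Proj V)"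
    and bundle_vs: "x \<in> pts (Base V) \<Longrightarrow> vectorspace class_ring (Fib V x)"
    and bundle_carrier: "x \<in> pts (Base V) \<Longrightarrow> carrier (Fib V x) = {v \<in> pts (Total V). Proj V v = x}"
  using assms by (auto simp: vector_pseudo_bundle_def)

lemma bundle_fibre:
  assumes "vector_pseudo_bundle V" "v \<in> pts (Total V)"
  shows "Proj V v \<in> pts (Base V)" "v \<in> carrier (Fib V (Proj V v))"
  using smooth_map_in[OF bundle_proj[OF assms(1)] assms(2)] assms(2)
  by (simp_all add: bundle_carrier[OF assms(1)])

lemma plot_fibre:
  assumes "vector_pseudo_bundle V" "plot (Total V) n U v" "u \<in> U"
  shows "v u \<in> carrier (Fib V (Proj V (v u)))"
  by (rule bundle_fibre[OF assms(1) plot_in[OF bundle_total[OF assms(1)] assms(2,3)]])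

lemma bundle_plot_add:
  assumes V: "vector_pseudo_bundle V"
    and p: "plot (Total V) n U p" "plot (Total V) n U q"
    and eq: "\<And>u. u \<in> U \<Longrightarrow> Proj V (q u) = Proj V (p u)"
  shows "plot (Total V) n U (\<lambda>u. p u \<oplus>\<^bsub>Fib V (Proj V (p u))\<^esub> q u)"
proof -
  have "smooth_map (subset_space (prod_space (Total V) (Total V)) {(v, w). Proj V v = Proj V w})
       (Total V) (\<lambda>(v, w). v \<oplus>\<^bsub>Fib V (Proj V v)\<^esub> w)"
    using V by (simp add: vector_pseudo_bundle_def)
  from smooth_mapD[OF this, of n U "\<lambda>u. (p u, q u)"] show ?thesis
    using p eq by (auto simp: image_subset_iff)
qed

lemma bundle_plot_smult:
  assumes V: "vector_pseudo_bundle V" and p: "plot (Total V) n U p" and r: "C_infinity n U r"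
  shows "plot (Total V) n U (\<lambda>u. r u \<odot>\<^bsub>Fib V (Proj V (p u))\<^esub> p u)"
proof -
  have "smooth_map (prod_space real_space (Total V))
       (Total V) (\<lambda>(r, v). r \<odot>\<^bsub>Fib V (Proj V v)\<^esub> v)"
    using V by (simp add: vector_pseudo_bundle_def)
  from smooth_mapD[OF this, of n U "\<lambda>u. (r u, p u)"] show ?thesis
    using p r plot_openin[OF bundle_total[OF V] p] by (simp add: real_space_def)
qed

lemma bundle_plot_zero:
  assumes V: "vector_pseudo_bundle V" and p: "plot (Base V) n U p"
  shows "plot (Total V) n U (\<lambda>u. \<zero>\<^bsub>Fib V (p u)\<^esub>)"
proof -
  have "smooth_map (Base V) (Total V) (\<lambda>x. \<zero>\<^bsub>Fib V x\<^esub>)"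
    using V by (simp add: vector_pseudo_bundle_def)
  from smooth_mapD[OF this p] show ?thesis .
qed

definition dual_points :: "('x, 'v) fibred_space \<Rightarrow> ('x \<times> ('v \<Rightarrow> real)) set" where
  "dual_points V = (SIGMA x:pts (Base V). carrier (smooth_dual (fibre_space V x) (Fib V x)))"

lemma Base_dual_bundle [simp]: "Base (dual_bundle V) = Base V"
  and Proj_dual_bundle [simp]: "Proj (dual_bundle V) = fst"
  and pts_Total_dual_bundle [simp]: "pts (Total (dual_bundle V)) = dual_points V"
  and Fib_dual_bundle:
    "Fib (dual_bundle V) x = transport_vs (Pair x) (smooth_dual (fibre_space V x) (Fib V x))"
  by (simp_all add: dual_bundle_def dual_points_def Let_def)

lemma carrier_smooth_dual:
  "\<xi> \<in> carrier (smooth_dual D E) \<longleftrightarrow>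
     \<xi> \<in> extensional (carrier E) \<and> \<xi> \<in> module_hom class_ring E real_vs \<and> smooth_map D real_space \<xi>"
  by (simp add: smooth_dual_def)

lemma module_hom_real_vs:
  "\<xi> \<in> module_hom class_ring E real_vs \<longleftrightarrow>
     (\<forall>v\<in>carrier E. \<forall>w\<in>carrier E. \<xi> (v \<oplus>\<^bsub>E\<^esub> w) = \<xi> v + \<xi> w) \<and>
     (\<forall>r. \<forall>v\<in>carrier E. \<xi> (r \<odot>\<^bsub>E\<^esub> v) = r * \<xi> v)"
  by (auto simp: module_hom_def real_vs_def)

text \<open>The evaluation condition may be tested on the diagonal: it is enough to evaluate at plots
  defined on the same domain as (a smooth reparametrisation of) the plot of the dual.\<close>

lemma dual_plot_iff:
  assumes V: "diffeological_space (Total V)"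
  shows "plot (Total (dual_bundle V)) n U q \<longleftrightarrow>
    openin (Euclidean_space n) U \<and> q ` U \<subseteq> dual_points V \<and> plot (Base V) n U (\<lambda>u. fst (q u)) \<and>
    (\<forall>m W a v. plot (euclid n) m W a \<longrightarrow> a ` W \<subseteq> U \<longrightarrow> plot (Total V) m W v \<longrightarrow>
       (\<forall>s\<in>W. fst (q (a s)) = Proj V (v s)) \<longrightarrow> C_infinity m W (\<lambda>s. snd (q (a s)) (v s)))"
    (is "?L \<longleftrightarrow> ?A \<and> ?B \<and> ?C \<and> ?D")
proof -
  let ?S = "\<lambda>m W p. subset_space
              (prod_space (subset_space (euclid n) U) (subset_space (euclid m) W))
              {(u', u). fst (q u') = Proj V (p u)}"
  have "?L \<longleftrightarrow> ?A \<and> ?B \<and> ?C \<and> (\<forall>m W p. plot (Total V) m W p \<longrightarrow>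
      smooth_map (?S m W p) real_space (\<lambda>(u', u). snd (q u') (p u)))"
    by (simp add: dual_bundle_def dual_points_def comp_def Let_def)
  moreover have "(\<forall>m W p. plot (Total V) m W p \<longrightarrow>
      smooth_map (?S m W p) real_space (\<lambda>(u', u). snd (q u') (p u))) \<longleftrightarrow> ?D"
  proof (intro iffI allI impI)
    fix m W a v
    assume *: "\<forall>m W p. plot (Total V) m W p \<longrightarrow>
        smooth_map (?S m W p) real_space (\<lambda>(u', u). snd (q u') (p u))"
      and a: "plot (euclid n) m W a" "a ` W \<subseteq> U" and v: "plot (Total V) m W v"
      and eq: "\<forall>s\<in>W. fst (q (a s)) = Proj V (v s)"
    \<comment> \<open>With both plots on the common domain \<open>W\<close>, the pair
      \<open>(a s, s)\<close> is a plot of the fibred domain because the base points match.\<close>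
    have "plot (?S m W v) m W (\<lambda>s. (a s, s))"
      using a eq euclid_plot_id[OF euclid_plot_openin[OF a(1)]] by auto
    from smooth_realD[OF *[rule_format, OF v] this]
    show "C_infinity m W (\<lambda>s. snd (q (a s)) (v s))" by simp
  next
    fix m W p
    assume D: ?D and p: "plot (Total V) m W p"
    show "smooth_map (?S m W p) real_space (\<lambda>(u', u). snd (q u') (p u))"
    proof (rule smooth_realI)
      fix l S c assume c: "plot (?S m W p) l S c"
      then show "openin (Euclidean_space l) S" by (auto dest: euclid_plot_openin)
      \<comment> \<open>Conversely, a plot of pairs supplies its own reparametrisation
        \<open>fst (c s)\<close>, and its second component turns \<open>p\<close> into a plot on the
        same domain.\<close>
      have "plot (Total V) l S (\<lambda>s. p (snd (c s)))"
        using c by (intro plot_compose[OF V p]) auto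
      then have "C_infinity l S (\<lambda>s. snd (q (fst (c s))) (p (snd (c s))))"
        using c by (intro D[rule_format, where a = "\<lambda>s. fst (c s)" and v = "\<lambda>s. p (snd (c s))"]) auto
      then show "C_infinity l S (\<lambda>s. case c s of (u', u) \<Rightarrow> snd (q u') (p u))"
        by (simp add: case_prod_beta)
    qed
  qed
  ultimately show ?thesis by blast
qed

lemma dual_plot_eval:
  assumes V: "diffeological_space (Total V)" and q: "plot (Total (dual_bundle V)) n U q"
    and v: "plot (Total V) n U v" and eq: "\<And>u. u \<in> U \<Longrightarrow> fst (q u) = Proj V (v u)"
  shows "C_infinity n U (\<lambda>u. snd (q u) (v u))"
  using q[unfolded dual_plot_iff[OF V]] v eq
    euclid_plot_id[OF plot_openin[OF V v]] by auto

lemma dual_plot_compose: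
  assumes V: "diffeological_space (Base V)" "diffeological_space (Total V)"
    and q: "plot (Total (dual_bundle V)) n U q"
    and F: "plot (euclid n) m W F" "F ` W \<subseteq> U"
  shows "plot (Total (dual_bundle V)) m W (\<lambda>s. q (F s))"
  unfolding dual_plot_iff[OF V(2)]
proof (intro conjI allI impI)
  show "plot (Base V) m W (\<lambda>s. fst (q (F s)))"
    using q F unfolding dual_plot_iff[OF V(2)] by (auto intro: plot_compose[OF V(1)])
  fix l S a v
  assume a: "plot (euclid m) l S a" "a ` S \<subseteq> W" and v: "plot (Total V) l S v"
    "\<forall>s\<in>S. fst (q (F (a s))) = Proj V (v s)"
  have "plot (euclid n) l S (\<lambda>s. F (a s))" "(\<lambda>s. F (a s)) ` S \<subseteq> U"
    using euclid_plot_compose[OF F(1) a] a(2) F(2) by auto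
  then show "C_infinity l S (\<lambda>s. snd (q (F (a s))) (v s))"
    using q v unfolding dual_plot_iff[OF V(2)] by blast
qed (use q F euclid_plot_openin[OF F(1)] in \<open>auto simp: dual_plot_iff[OF V(2)]\<close>)

lemma dual_plot_restrict:
  assumes "diffeological_space (Base V)" "diffeological_space (Total V)"
    and "plot (Total (dual_bundle V)) n U q" "openin (Euclidean_space n) W" "W \<subseteq> U"
  shows "plot (Total (dual_bundle V)) n W q"
  using dual_plot_compose[OF assms(1-3) euclid_plot_id[OF assms(4)]] assms(5) by simp

text \<open>The locality axiom for the dual diffeology, needed to assemble the inverse of the
  gluing-dual map from its two charts. The evaluation condition is itself local, once the domain of
  the reparametrisation is shrunk to the preimage of a piece.\<close>

lemma dual_plot_local:
  assumes V: "diffeological_space (Base V)" "diffeological_space (Total V)"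
    and U: "openin (Euclidean_space n) U"
    and loc: "\<And>u. u \<in> U \<Longrightarrow>
      \<exists>W q. u \<in> W \<and> W \<subseteq> U \<and> plot (Total (dual_bundle V)) n W q \<and> (\<forall>w\<in>W. p w = q w)"
  shows "plot (Total (dual_bundle V)) n U p"
  unfolding dual_plot_iff[OF V(2)]
proof (intro conjI allI impI)
  show "p ` U \<subseteq> dual_points V"
    using loc unfolding dual_plot_iff[OF V(2)] by fastforce
  show "plot (Base V) n U (\<lambda>u. fst (p u))"
  proof (rule plot_local[OF V(1) U])
    fix u assume "u \<in> U"
    with loc obtain W q where "u \<in> W" "W \<subseteq> U" "plot (Total (dual_bundle V)) n W q" "\<forall>w\<in>W. p w = q w"
      by metis
    then show "\<exists>W q. u \<in> W \<and> W \<subseteq> U \<and> plot (Base V) n W q \<and> (\<forall>w\<in>W. fst (p w) = q w)"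
      unfolding dual_plot_iff[OF V(2)] by (intro exI[of _ W] exI[of _ "\<lambda>u. fst (q u)"]) auto
  qed
  fix l S a v
  assume a: "plot (euclid n) l S a" "a ` S \<subseteq> U" and v: "plot (Total V) l S v"
    and eq: "\<forall>s\<in>S. fst (p (a s)) = Proj V (v s)"
  show "C_infinity l S (\<lambda>s. snd (p (a s)) (v s))"
  proof (rule C_infinity_local[OF plot_openin[OF V(2) v]])
    fix s assume s: "s \<in> S"
    with a loc obtain W q where W: "a s \<in> W" "W \<subseteq> U" "plot (Total (dual_bundle V)) n W q"
      "\<forall>w\<in>W. p w = q w" by (metis image_subset_iff)
    let ?S = "{s \<in> S. a s \<in> W}"
    have S: "openin (Euclidean_space l) ?S"
      using W(3) by (intro euclid_plot_preimage[OF a(1)]) (simp add: dual_plot_iff[OF V(2)])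
    have "plot (euclid n) l ?S a"
      using euclid_plot_compose[OF a(1) euclid_plot_id[OF S]] by auto
    from dual_plot_compose[OF V W(3) this]
    have "plot (Total (dual_bundle V)) l ?S (\<lambda>s. q (a s))" by auto
    moreover have "plot (Total V) l ?S v" by (rule plot_restrict[OF V(2) v S]) auto
    ultimately have "C_infinity l ?S (\<lambda>s. snd (q (a s)) (v s))"
      using eq W(4) by (intro dual_plot_eval[OF V(2)]) auto
    moreover have "C_infinity l ?S (\<lambda>s. snd (q (a s)) (v s)) \<longleftrightarrow> C_infinity l ?S (\<lambda>s. snd (p (a s)) (v s))"
      using W(4) by (intro C_infinity_cong[OF S]) auto
    ultimately show "\<exists>W. openin (Euclidean_space l) W \<and> s \<in> W \<and> W \<subseteq> S \<and>
        C_infinity l W (\<lambda>s. snd (p (a s)) (v s))"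
      using S W(1) s by (intro exI[of _ ?S]) auto
  qed
qed (fact U)

section \<open>Vector spaces\<close>

lemma vectorspace_realI:
  fixes E :: "(real, 'v) module"
  assumes "\<zero>\<^bsub>E\<^esub> \<in> carrier E"
    and "\<And>v w. v \<in> carrier E \<Longrightarrow> w \<in> carrier E \<Longrightarrow> v \<oplus>\<^bsub>E\<^esub> w \<in> carrier E"
    and "\<And>r v. v \<in> carrier E \<Longrightarrow> r \<odot>\<^bsub>E\<^esub> v \<in> carrier E"
    and "\<And>v. v \<in> carrier E \<Longrightarrow> v \<oplus>\<^bsub>E\<^esub> ((-1) \<odot>\<^bsub>E\<^esub> v) = \<zero>\<^bsub>E\<^esub>"
    and "\<And>v w. v \<in> carrier E \<Longrightarrow> w \<in> carrier E \<Longrightarrow> v \<oplus>\<^bsub>E\<^esub> w = w \<oplus>\<^bsub>E\<^esub> v"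
    and "\<And>u v w. u \<in> carrier E \<Longrightarrow> v \<in> carrier E \<Longrightarrow> w \<in> carrier E \<Longrightarrow>
      (u \<oplus>\<^bsub>E\<^esub> v) \<oplus>\<^bsub>E\<^esub> w = u \<oplus>\<^bsub>E\<^esub> (v \<oplus>\<^bsub>E\<^esub> w)"
    and "\<And>v. v \<in> carrier E \<Longrightarrow> v \<oplus>\<^bsub>E\<^esub> \<zero>\<^bsub>E\<^esub> = v"
    and "\<And>a b v. v \<in> carrier E \<Longrightarrow> (a * b) \<odot>\<^bsub>E\<^esub> v = a \<odot>\<^bsub>E\<^esub> (b \<odot>\<^bsub>E\<^esub> v)"
    and "\<And>v. v \<in> carrier E \<Longrightarrow> 1 \<odot>\<^bsub>E\<^esub> v = v"
    and "\<And>a b v. v \<in> carrier E \<Longrightarrow> (a + b) \<odot>\<^bsub>E\<^esub> v = (a \<odot>\<^bsub>E\<^esub> v) \<oplus>\<^bsub>E\<^esub> (b \<odot>\<^bsub>E\<^esub> v)"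
    and "\<And>a v w. v \<in> carrier E \<Longrightarrow> w \<in> carrier E \<Longrightarrow>
      a \<odot>\<^bsub>E\<^esub> (v \<oplus>\<^bsub>E\<^esub> w) = (a \<odot>\<^bsub>E\<^esub> v) \<oplus>\<^bsub>E\<^esub> (a \<odot>\<^bsub>E\<^esub> w)"
  shows "vectorspace class_ring E"
proof (rule vectorspace.intro)
  show "module class_ring E"
  proof (rule module_criteria)
    show "\<forall>v\<in>carrier E. \<exists>neg_v\<in>carrier E. v \<oplus>\<^bsub>E\<^esub> neg_v = \<zero>\<^bsub>E\<^esub>"
      using assms(3,4) by blast
  qed (use assms class_cring.is_cring in \<open>simp_all\<close>)
  show "Ring.field (class_ring :: real ring)"
    by (rule class_field.field_axioms)
qed

lemma
  fixes E :: "(real, 'v) module"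
  assumes "vectorspace class_ring E"
  shows vs_zero: "\<zero>\<^bsub>E\<^esub> \<in> carrier E"
    and vs_add: "v \<in> carrier E \<Longrightarrow> w \<in> carrier E \<Longrightarrow> v \<oplus>\<^bsub>E\<^esub> w \<in> carrier E"
    and vs_smult: "v \<in> carrier E \<Longrightarrow> r \<odot>\<^bsub>E\<^esub> v \<in> carrier E"
    and vs_add_comm: "v \<in> carrier E \<Longrightarrow> w \<in> carrier E \<Longrightarrow> v \<oplus>\<^bsub>E\<^esub> w = w \<oplus>\<^bsub>E\<^esub> v"
    and vs_add_assoc: "u \<in> carrier E \<Longrightarrow> v \<in> carrier E \<Longrightarrow> w \<in> carrier E \<Longrightarrow>
      (u \<oplus>\<^bsub>E\<^esub> v) \<oplus>\<^bsub>E\<^esub> w = u \<oplus>\<^bsub>E\<^esub> (v \<oplus>\<^bsub>E\<^esub> w)"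
    and vs_add_zero: "v \<in> carrier E \<Longrightarrow> v \<oplus>\<^bsub>E\<^esub> \<zero>\<^bsub>E\<^esub> = v"
    and vs_smult_smult: "v \<in> carrier E \<Longrightarrow> (a * b) \<odot>\<^bsub>E\<^esub> v = a \<odot>\<^bsub>E\<^esub> (b \<odot>\<^bsub>E\<^esub> v)"
    and vs_one: "v \<in> carrier E \<Longrightarrow> 1 \<odot>\<^bsub>E\<^esub> v = v"
    and vs_smult_add_left: "v \<in> carrier E \<Longrightarrow> (a + b) \<odot>\<^bsub>E\<^esub> v = (a \<odot>\<^bsub>E\<^esub> v) \<oplus>\<^bsub>E\<^esub> (b \<odot>\<^bsub>E\<^esub> v)"
    and vs_smult_add_right: "v \<in> carrier E \<Longrightarrow> w \<in> carrier E \<Longrightarrow>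
      a \<odot>\<^bsub>E\<^esub> (v \<oplus>\<^bsub>E\<^esub> w) = (a \<odot>\<^bsub>E\<^esub> v) \<oplus>\<^bsub>E\<^esub> (a \<odot>\<^bsub>E\<^esub> w)"
    and vs_smult_zero_left: "v \<in> carrier E \<Longrightarrow> 0 \<odot>\<^bsub>E\<^esub> v = \<zero>\<^bsub>E\<^esub>"
    and vs_add_neg: "v \<in> carrier E \<Longrightarrow> v \<oplus>\<^bsub>E\<^esub> ((-1) \<odot>\<^bsub>E\<^esub> v) = \<zero>\<^bsub>E\<^esub>"
proof -
  interpret vectorspace class_ring E by fact
  show "\<zero>\<^bsub>E\<^esub> \<in> carrier E" by simp
  show "v \<in> carrier E \<Longrightarrow> w \<in> carrier E \<Longrightarrow> v \<oplus>\<^bsub>E\<^esub> w \<in> carrier E" by simp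
  show "v \<in> carrier E \<Longrightarrow> r \<odot>\<^bsub>E\<^esub> v \<in> carrier E" using smult_closed[of r v] by simp
  show "v \<in> carrier E \<Longrightarrow> w \<in> carrier E \<Longrightarrow> v \<oplus>\<^bsub>E\<^esub> w = w \<oplus>\<^bsub>E\<^esub> v" by (rule a_comm)
  show "u \<in> carrier E \<Longrightarrow> v \<in> carrier E \<Longrightarrow> w \<in> carrier E \<Longrightarrow>
      (u \<oplus>\<^bsub>E\<^esub> v) \<oplus>\<^bsub>E\<^esub> w = u \<oplus>\<^bsub>E\<^esub> (v \<oplus>\<^bsub>E\<^esub> w)" by (rule a_assoc)
  show "v \<in> carrier E \<Longrightarrow> v \<oplus>\<^bsub>E\<^esub> \<zero>\<^bsub>E\<^esub> = v" by simp
  show "v \<in> carrier E \<Longrightarrow> (a * b) \<odot>\<^bsub>E\<^esub> v = a \<odot>\<^bsub>E\<^esub> (b \<odot>\<^bsub>E\<^esub> v)" using smult_assoc1[of a b v] by simp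
  show "v \<in> carrier E \<Longrightarrow> 1 \<odot>\<^bsub>E\<^esub> v = v" using smult_one[of v] by simp
  show l: "v \<in> carrier E \<Longrightarrow> (a + b) \<odot>\<^bsub>E\<^esub> v = (a \<odot>\<^bsub>E\<^esub> v) \<oplus>\<^bsub>E\<^esub> (b \<odot>\<^bsub>E\<^esub> v)" for a b
    using smult_l_distr[of a b v] by simp
  show "v \<in> carrier E \<Longrightarrow> w \<in> carrier E \<Longrightarrow>
      a \<odot>\<^bsub>E\<^esub> (v \<oplus>\<^bsub>E\<^esub> w) = (a \<odot>\<^bsub>E\<^esub> v) \<oplus>\<^bsub>E\<^esub> (a \<odot>\<^bsub>E\<^esub> w)" using smult_r_distr[of a v w] by simp
  show z: "v \<in> carrier E \<Longrightarrow> 0 \<odot>\<^bsub>E\<^esub> v = \<zero>\<^bsub>E\<^esub>" using lmult_0[of v] by simp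
  assume v: "v \<in> carrier E"
  then have "1 \<odot>\<^bsub>E\<^esub> v = v" using smult_one[of v] by simp
  then show "v \<oplus>\<^bsub>E\<^esub> ((-1) \<odot>\<^bsub>E\<^esub> v) = \<zero>\<^bsub>E\<^esub>"
    using l[OF v, of 1 "-1"] z[OF v] by simp
qed

lemma
  assumes "inj_on j (carrier E)"
  shows carrier_transport_vs: "carrier (transport_vs j E) = j ` carrier E"
    and zero_transport_vs: "\<zero>\<^bsub>transport_vs j E\<^esub> = j \<zero>\<^bsub>E\<^esub>"
    and add_transport_vs: "a \<in> carrier E \<Longrightarrow> b \<in> carrier E \<Longrightarrow> j a \<oplus>\<^bsub>transport_vs j E\<^esub> j b = j (a \<oplus>\<^bsub>E\<^esub> b)"
    and smult_transport_vs: "a \<in> carrier E \<Longrightarrow> r \<odot>\<^bsub>transport_vs j E\<^esub> j a = j (r \<odot>\<^bsub>E\<^esub> a)"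
  using assms by (simp_all add: transport_vs_def Let_def the_inv_into_f_f)

lemma vectorspace_transport_vs:
  assumes j: "inj_on j (carrier E)" and E: "vectorspace class_ring E"
  shows "vectorspace class_ring (transport_vs j E)"
proof -
  note [simp] = carrier_transport_vs[OF j] zero_transport_vs[OF j] add_transport_vs[OF j]
    smult_transport_vs[OF j] vs_zero[OF E] vs_add[OF E] vs_smult[OF E] vs_add_assoc[OF E] vs_add_zero[OF E]
    vs_smult_smult[OF E] vs_one[OF E] vs_smult_add_left[OF E] vs_smult_add_right[OF E] vs_add_neg[OF E]
  show ?thesis
    by (rule vectorspace_realI) (auto intro!: arg_cong[of _ _ j] intro: vs_add_comm[OF E])
qed


section \<open>Tensor products\<close>

abbreviation pm_scale :: "real \<Rightarrow> ('a \<Rightarrow>\<^sub>0 real) \<Rightarrow> 'a \<Rightarrow>\<^sub>0 real" where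
  "pm_scale r \<equiv> Poly_Mapping.map ((*) r)"

lemma lookup_pm_scale [simp]: "Poly_Mapping.lookup (pm_scale r p) k = r * Poly_Mapping.lookup p k"
  by (simp add: Poly_Mapping.map.rep_eq when_def)

text \<open>The span in \<open>tensor_null\<close> is taken with respect to this scaling; the
  interpretation gives access to subspaces and to minimality of spans.\<close>

interpretation pm: Modules.module "pm_scale :: real \<Rightarrow> ('a \<Rightarrow>\<^sub>0 real) \<Rightarrow> _"
  by unfold_locales (auto intro!: poly_mapping_eqI simp: lookup_add algebra_simps)

lemma subspace_tensor_null: "pm.subspace (tensor_null E F)"
  unfolding tensor_null_def by (rule pm.subspace_span)

lemma tensor_class_eq_iff: "tensor_class E F a = tensor_class E F b \<longleftrightarrow> a - b \<in> tensor_null E F"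
proof
  assume "tensor_class E F a = tensor_class E F b"
  moreover have "a \<in> tensor_class E F a"
    using subspace_tensor_null[of E F] by (simp add: tensor_class_def pm.subspace_0)
  ultimately show "a - b \<in> tensor_null E F" by (simp add: tensor_class_def)
next
  assume *: "a - b \<in> tensor_null E F"
  have "c - a \<in> tensor_null E F \<longleftrightarrow> c - b \<in> tensor_null E F" for c
    using pm.subspace_add[OF subspace_tensor_null *, of "c - a"]
      pm.subspace_diff[OF subspace_tensor_null _ *, of "c - b"] by auto
  then show "tensor_class E F a = tensor_class E F b" by (simp add: tensor_class_def)
qed

lemma tensor_class_self: "a \<in> tensor_class E F a"
  using subspace_tensor_null[of E F] by (simp add: tensor_class_def pm.subspace_0)

lemma
  shows carrier_tensor_vs: "carrier (tensor_vs E F) =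
      tensor_class E F ` {c. Poly_Mapping.keys c \<subseteq> carrier E \<times> carrier F}"
    and zero_tensor_vs: "\<zero>\<^bsub>tensor_vs E F\<^esub> = tensor_class E F 0"
    and add_tensor_vs:
      "tensor_class E F a \<oplus>\<^bsub>tensor_vs E F\<^esub> tensor_class E F b = tensor_class E F (a + b)"
    and smult_tensor_vs: "r \<odot>\<^bsub>tensor_vs E F\<^esub> tensor_class E F a = tensor_class E F (pm_scale r a)"
proof -
  let ?N = "tensor_null E F"
  have "{a' + b' |a' b'. a' - a \<in> ?N \<and> b' - b \<in> ?N} = {c. c - (a + b) \<in> ?N}"
  proof (intro equalityI subsetI)
    fix c assume "c \<in> {a' + b' |a' b'. a' - a \<in> ?N \<and> b' - b \<in> ?N}"
    then obtain a' b' where "c = a' + b'" "a' - a \<in> ?N" "b' - b \<in> ?N" by blast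
    then show "c \<in> {c. c - (a + b) \<in> ?N}"
      using pm.subspace_add[OF subspace_tensor_null, of "a' - a" E F "b' - b"]
      by (simp add: algebra_simps)
  next
    fix c assume "c \<in> {c. c - (a + b) \<in> ?N}"
    then have "c = a + (c - a)" "a - a \<in> ?N" "(c - a) - b \<in> ?N"
      using pm.subspace_0[OF subspace_tensor_null, of E F] by (simp_all add: algebra_simps)
    then show "c \<in> {a' + b' |a' b'. a' - a \<in> ?N \<and> b' - b \<in> ?N}" by blast
  qed
  then show "tensor_class E F a \<oplus>\<^bsub>tensor_vs E F\<^esub> tensor_class E F b = tensor_class E F (a + b)"
    by (simp add: tensor_vs_def tensor_class_def)
  \<comment> \<open>The union in the scalar multiplication runs over all representatives; all of
    them give the same coset.\<close>
  have "tensor_class E F (pm_scale r a') = tensor_class E F (pm_scale r a)"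
    if "a' \<in> tensor_class E F a" for a'
    using pm.subspace_scale[OF subspace_tensor_null, of "a' - a" E F r] that
    unfolding tensor_class_eq_iff by (simp add: tensor_class_def pm.scale_right_diff_distrib)
  then have "(\<Union>a'\<in>tensor_class E F a. tensor_class E F (pm_scale r a')) = tensor_class E F (pm_scale r a)"
    by (intro UN_constant_eq[OF tensor_class_self] ballI)
  then show "r \<odot>\<^bsub>tensor_vs E F\<^esub> tensor_class E F a = tensor_class E F (pm_scale r a)"
    by (simp only: tensor_vs_def module.simps)
qed (simp_all add: tensor_vs_def)

lemma vectorspace_tensor_vs: "vectorspace class_ring (tensor_vs E F)"
proof -
  define S where "S = {c :: ('a \<times> 'b) \<Rightarrow>\<^sub>0 real. Poly_Mapping.keys c \<subseteq> carrier E \<times> carrier F}"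
  have S: "carrier (tensor_vs E F) = tensor_class E F ` S"
    by (simp add: carrier_tensor_vs S_def)
  have zero: "0 \<in> S" by (simp add: S_def)
  have add: "a + b \<in> S" if "a \<in> S" "b \<in> S" for a b
    using that Poly_Mapping.keys_add[of a b] by (auto simp: S_def)
  have scale: "pm_scale r a \<in> S" if "a \<in> S" for r a
    using that by (auto simp: in_keys_iff subset_iff S_def)
  have neg: "a + pm_scale (-1) a = 0" for a :: "('a \<times> 'b) \<Rightarrow>\<^sub>0 real"
    by (simp add: pm.scale_minus_left)
  show ?thesis
    by (rule vectorspace_realI)
      (auto simp: S zero_tensor_vs add_tensor_vs smult_tensor_vs zero add scale neg add_ac
        pm.scale_left_distrib pm.scale_right_distrib simp del: pm.scale_minus_left)
qed


subsection \<open>Tensors of functionals as bilinear forms\<close>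

text \<open>The sum inside \<open>tensor_form\<close> for one chosen representative. On the free
  vector space it is linear in \<open>c\<close> for arbitrary functions, so linearity can precede
  well-definedness on cosets.\<close>

definition tensor_eval ::
  "(('x \<times> ('v \<Rightarrow> real)) \<times> ('x \<times> ('v \<Rightarrow> real)) \<Rightarrow>\<^sub>0 real) \<Rightarrow> 'v \<Rightarrow> 'v \<Rightarrow> real" where
  "tensor_eval c v w =
     (\<Sum>k\<in>Poly_Mapping.keys c. Poly_Mapping.lookup c k * snd (fst k) v * snd (snd k) w)"

text \<open>Different representatives have different supports; summing over a common finite superset
  lets their sums be combined term by term.\<close>

lemma tensor_eval_superset:
  assumes "finite A" "Poly_Mapping.keys c \<subseteq> A"
  shows "tensor_eval c v w = (\<Sum>k\<in>A. Poly_Mapping.lookup c k * snd (fst k) v * snd (snd k) w)"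
  unfolding tensor_eval_def
  by (rule sum.mono_neutral_left) (use assms in \<open>auto simp: in_keys_iff\<close>)

lemma tensor_eval_add: "tensor_eval (a + b) v w = tensor_eval a v w + tensor_eval b v w"
proof -
  let ?A = "Poly_Mapping.keys a \<union> Poly_Mapping.keys b"
  have A: "finite ?A" "Poly_Mapping.keys a \<subseteq> ?A" "Poly_Mapping.keys b \<subseteq> ?A"
    "Poly_Mapping.keys (a + b) \<subseteq> ?A"
    using Poly_Mapping.keys_add[of a b] by auto
  show ?thesis
    by (simp only: A(2-4)[THEN tensor_eval_superset[OF A(1)]] lookup_add distrib_right sum.distrib)
qed

lemma tensor_eval_scale: "tensor_eval (pm_scale r a) v w = r * tensor_eval a v w"
proof -
  have "Poly_Mapping.keys (pm_scale r a) \<subseteq> Poly_Mapping.keys a"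
    by (auto simp: in_keys_iff)
  from tensor_eval_superset[OF finite_keys this] show ?thesis
    by (simp add: tensor_eval_def sum_distrib_left mult.assoc)
qed

lemma tensor_eval_zero [simp]: "tensor_eval 0 v w = 0"
  by (simp add: tensor_eval_def)

lemma tensor_eval_single:
  "tensor_eval (Poly_Mapping.single k r) v w = r * snd (fst k) v * snd (snd k) w"
  using tensor_eval_superset[of "{k}" "Poly_Mapping.single k r" v w] by simp

lemma tensor_eval_diff: "tensor_eval (a - b) v w = tensor_eval a v w - tensor_eval b v w"
  using tensor_eval_add[of "a - b" b v w] by simp

lemma inj_Pair: "inj_on (Pair x) A"
  by (auto intro: inj_onI)

lemma carrier_Fib_dual_bundle:
  "carrier (Fib (dual_bundle V) x) = Pair x ` carrier (smooth_dual (fibre_space V x) (Fib V x))"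
  by (simp add: Fib_dual_bundle carrier_transport_vs inj_Pair)

lemma Fib_dual_bundle_add_eval:
  assumes "\<xi> \<in> carrier (Fib (dual_bundle V) x)" "\<eta> \<in> carrier (Fib (dual_bundle V) x)"
    and "v \<in> carrier (Fib V x)"
  shows "snd (\<xi> \<oplus>\<^bsub>Fib (dual_bundle V) x\<^esub> \<eta>) v = snd \<xi> v + snd \<eta> v"
  using assms unfolding carrier_Fib_dual_bundle
  by (auto simp: Fib_dual_bundle add_transport_vs[OF inj_Pair] smooth_dual_def class_ring.func_space_def)

lemma Fib_dual_bundle_smult_eval:
  assumes "\<xi> \<in> carrier (Fib (dual_bundle V) x)" and "v \<in> carrier (Fib V x)"
  shows "snd (r \<odot>\<^bsub>Fib (dual_bundle V) x\<^esub> \<xi>) v = r * snd \<xi> v"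
  using assms unfolding carrier_Fib_dual_bundle
  by (auto simp: Fib_dual_bundle smult_transport_vs[OF inj_Pair] smooth_dual_def class_ring.func_space_def)

text \<open>Well-definedness of the form given by a tensor: evaluation is linear in
  \<open>c\<close>, and it kills all four families of generators because the operations of the dual
  fibre are pointwise on the carrier, to which \<open>v\<close> and \<open>w\<close> belong.\<close>

lemma tensor_eval_null:
  assumes c: "c \<in> tensor_null (Fib (dual_bundle V) x) (Fib (dual_bundle V) x)"
    and v: "v \<in> carrier (Fib V x)" and w: "w \<in> carrier (Fib V x)"
  shows "tensor_eval c v w = 0"
proof -
  have "tensor_null (Fib (dual_bundle V) x) (Fib (dual_bundle V) x) \<subseteq> {c. tensor_eval c v w = 0}"
    unfolding tensor_null_def
  proof (rule pm.span_minimal)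
    show "pm.subspace {c. tensor_eval c v w = 0}"
      by (rule pm.subspaceI) (auto simp: tensor_eval_add tensor_eval_scale)
  qed (auto simp: tensor_eval_diff tensor_eval_single v w Fib_dual_bundle_add_eval
      Fib_dual_bundle_smult_eval distrib_left distrib_right)
  with c show ?thesis by auto
qed

abbreviation dual_tensor ::
  "('x, 'v) fibred_space \<Rightarrow> 'x \<Rightarrow> (('x \<times> ('v \<Rightarrow> real)) \<times> ('x \<times> ('v \<Rightarrow> real)) \<Rightarrow>\<^sub>0 real) \<Rightarrow>
    (('x \<times> ('v \<Rightarrow> real)) \<times> ('x \<times> ('v \<Rightarrow> real)) \<Rightarrow>\<^sub>0 real) set" where
  "dual_tensor V x \<equiv> tensor_class (Fib (dual_bundle V) x) (Fib (dual_bundle V) x)"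

text \<open>Removes the definite description in \<open>tensor_form\<close>, which by
  \<open>tensor_eval_null\<close> has only one candidate value.\<close>

lemma tensor_form_class:
  assumes v: "v \<in> carrier (Fib V x)" and w: "w \<in> carrier (Fib V x)"
  shows "tensor_form (x, dual_tensor V x c) v w
    = tensor_eval c v w"
proof -
  let ?C = "dual_tensor V x c"
  have *: "tensor_eval c' v w = tensor_eval c v w" if "c' \<in> ?C" for c'
    using tensor_eval_null[OF _ v w, of "c' - c"] that by (simp add: tensor_class_def tensor_eval_diff)
  have "(THE r. \<exists>c'\<in>?C. r = tensor_eval c' v w) = tensor_eval c v w"
  proof (rule the_equality)
    show "\<exists>c'\<in>?C. tensor_eval c v w = tensor_eval c' v w"
      by (rule bexI[OF refl tensor_class_self])
    show "r = tensor_eval c v w" if "\<exists>c'\<in>?C. r = tensor_eval c' v w" for r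
      using that * by (elim bexE) simp
  qed
  then show ?thesis by (simp only: tensor_form_def tensor_eval_def snd_conv)
qed

subsection \<open>Smoothness of pseudo-metrics along plots\<close>

abbreviation dual_square :: "('x, 'v) fibred_space \<Rightarrow> 'x \<Rightarrow>
    (real, (('x \<times> ('v \<Rightarrow> real)) \<times> ('x \<times> ('v \<Rightarrow> real)) \<Rightarrow>\<^sub>0 real) set) module" where
  "dual_square V x \<equiv> tensor_vs (Fib (dual_bundle V) x) (Fib (dual_bundle V) x)"

text \<open>This turns out to be a pseudo-bundle diffeology for which the tensor product map is smooth. The
  tensor product diffeology is finer, so its plots evaluate smoothly as well.\<close>

definition evaluation_space ::
  "('x, 'v) fibred_space \<Rightarrow>
   ('x \<times> (('x \<times> ('v \<Rightarrow> real)) \<times> ('x \<times> ('v \<Rightarrow> real)) \<Rightarrow>\<^sub>0 real) set) dspace" where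
  "evaluation_space V =
     \<lparr> pts = (SIGMA x:pts (Base V). carrier (dual_square V x)),
       plot = (\<lambda>n U t. openin (Euclidean_space n) U \<and>
         t ` U \<subseteq> (SIGMA x:pts (Base V). carrier (dual_square V x)) \<and>
         plot (Base V) n U (\<lambda>u. fst (t u)) \<and>
         (\<forall>m W a v w. plot (euclid n) m W a \<longrightarrow> a ` W \<subseteq> U \<longrightarrow>
            plot (Total V) m W v \<longrightarrow> plot (Total V) m W w \<longrightarrow>
            (\<forall>s\<in>W. Proj V (v s) = fst (t (a s)) \<and> Proj V (w s) = fst (t (a s))) \<longrightarrow>
            C_infinity m W (\<lambda>s. tensor_form (t (a s)) (v s) (w s)))) \<rparr>"

lemma pts_evaluation_space:
  "pts (evaluation_space V) = (SIGMA x:pts (Base V). carrier (dual_square V x))"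
  by (simp add: evaluation_space_def)

lemma evaluation_plotI:
  assumes "openin (Euclidean_space n) U"
    and "\<And>u. u \<in> U \<Longrightarrow> t u \<in> pts (evaluation_space V)"
    and "plot (Base V) n U (\<lambda>u. fst (t u))"
    and "\<And>m W a v w. plot (euclid n) m W a \<Longrightarrow> a ` W \<subseteq> U \<Longrightarrow>
      plot (Total V) m W v \<Longrightarrow> plot (Total V) m W w \<Longrightarrow>
      (\<And>s. s \<in> W \<Longrightarrow> Proj V (v s) = fst (t (a s))) \<Longrightarrow>
      (\<And>s. s \<in> W \<Longrightarrow> Proj V (w s) = fst (t (a s))) \<Longrightarrow>
      C_infinity m W (\<lambda>s. tensor_form (t (a s)) (v s) (w s))"
  shows "plot (evaluation_space V) n U t"
  unfolding evaluation_space_def dspace.simps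
  using assms(1,3) assms(2)[unfolded pts_evaluation_space]
  by (intro conjI allI impI assms(4)) blast+

lemma
  assumes "plot (evaluation_space V) n U t"
  shows evaluation_plot_openin: "openin (Euclidean_space n) U"
    and evaluation_plot_in: "u \<in> U \<Longrightarrow> t u \<in> pts (evaluation_space V)"
    and evaluation_plot_base: "plot (Base V) n U (\<lambda>u. fst (t u))"
    and evaluation_plot_eval: "plot (euclid n) m W a \<Longrightarrow> a ` W \<subseteq> U \<Longrightarrow>
      plot (Total V) m W v \<Longrightarrow> plot (Total V) m W w \<Longrightarrow>
      (\<And>s. s \<in> W \<Longrightarrow> Proj V (v s) = fst (t (a s))) \<Longrightarrow>
      (\<And>s. s \<in> W \<Longrightarrow> Proj V (w s) = fst (t (a s))) \<Longrightarrow>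
      C_infinity m W (\<lambda>s. tensor_form (t (a s)) (v s) (w s))"
proof -
  note * = assms[unfolded evaluation_space_def dspace.simps]
  show "openin (Euclidean_space n) U" using * by blast
  show "u \<in> U \<Longrightarrow> t u \<in> pts (evaluation_space V)" using * unfolding pts_evaluation_space by blast
  show "plot (Base V) n U (\<lambda>u. fst (t u))" using * by blast
  show "plot (euclid n) m W a \<Longrightarrow> a ` W \<subseteq> U \<Longrightarrow>
      plot (Total V) m W v \<Longrightarrow> plot (Total V) m W w \<Longrightarrow>
      (\<And>s. s \<in> W \<Longrightarrow> Proj V (v s) = fst (t (a s))) \<Longrightarrow>
      (\<And>s. s \<in> W \<Longrightarrow> Proj V (w s) = fst (t (a s))) \<Longrightarrow>
      C_infinity m W (\<lambda>s. tensor_form (t (a s)) (v s) (w s))"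
    using *[THEN conjunct2, THEN conjunct2, THEN conjunct2, rule_format, of m W a v w] by blast
qed

lemma evaluation_ptsE:
  assumes "t \<in> pts (evaluation_space V)"
  obtains x c where "x \<in> pts (Base V)"
    "Poly_Mapping.keys c \<subseteq> carrier (Fib (dual_bundle V) x) \<times> carrier (Fib (dual_bundle V) x)"
    "t = (x, dual_tensor V x c)"
  using assms unfolding pts_evaluation_space carrier_tensor_vs by blast

abbreviation dual_square_fib :: "('x, 'v) fibred_space \<Rightarrow> 'x \<Rightarrow>
    (real, 'x \<times> (('x \<times> ('v \<Rightarrow> real)) \<times> ('x \<times> ('v \<Rightarrow> real)) \<Rightarrow>\<^sub>0 real) set) module" where
  "dual_square_fib V x \<equiv> transport_vs (Pair x) (dual_square V x)"

lemma vectorspace_dual_square_fib: "vectorspace class_ring (dual_square_fib V x)"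
  by (rule vectorspace_transport_vs[OF inj_Pair vectorspace_tensor_vs])

lemma carrier_dual_square_fib:
  "x \<in> pts (Base V) \<Longrightarrow> carrier (dual_square_fib V x) = {t \<in> pts (evaluation_space V). fst t = x}"
  unfolding carrier_transport_vs[OF inj_Pair] pts_evaluation_space by force

lemma evaluation_fst: "t \<in> pts (evaluation_space V) \<Longrightarrow> fst t \<in> pts (Base V)"
  unfolding pts_evaluation_space by auto

lemma tensor_form_add:
  assumes "t \<in> pts (evaluation_space V)" "t' \<in> pts (evaluation_space V)" "fst t' = fst t"
    and "v \<in> carrier (Fib V (fst t))" "w \<in> carrier (Fib V (fst t))"
  shows "tensor_form (t \<oplus>\<^bsub>dual_square_fib V (fst t)\<^esub> t') v w = tensor_form t v w + tensor_form t' v w"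
proof -
  obtain x c where t: "x \<in> pts (Base V)"
    "Poly_Mapping.keys c \<subseteq> carrier (Fib (dual_bundle V) x) \<times> carrier (Fib (dual_bundle V) x)"
    "t = (x, dual_tensor V x c)"
    using assms(1) by (rule evaluation_ptsE)
  obtain x' c' where t': "x' \<in> pts (Base V)"
    "Poly_Mapping.keys c' \<subseteq> carrier (Fib (dual_bundle V) x') \<times> carrier (Fib (dual_bundle V) x')"
    "t' = (x', dual_tensor V x' c')"
    using assms(2) by (rule evaluation_ptsE)
  have [simp]: "x' = x" using assms(3) t(3) t'(3) by simp
  have "t \<oplus>\<^bsub>dual_square_fib V (fst t)\<^esub> t' =
      (x, dual_tensor V x (c + c'))"
    using t t' by (simp add: add_transport_vs[OF inj_Pair] add_tensor_vs carrier_tensor_vs)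
  then show ?thesis
    using t t' assms(4,5) by (simp add: tensor_form_class tensor_eval_add)
qed

lemma tensor_form_smult:
  assumes "t \<in> pts (evaluation_space V)"
    and "v \<in> carrier (Fib V (fst t))" "w \<in> carrier (Fib V (fst t))"
  shows "tensor_form (r \<odot>\<^bsub>dual_square_fib V (fst t)\<^esub> t) v w = r * tensor_form t v w"
proof -
  obtain x c where t: "x \<in> pts (Base V)"
    "Poly_Mapping.keys c \<subseteq> carrier (Fib (dual_bundle V) x) \<times> carrier (Fib (dual_bundle V) x)"
    "t = (x, dual_tensor V x c)"
    using assms(1) by (rule evaluation_ptsE)
  have "r \<odot>\<^bsub>dual_square_fib V (fst t)\<^esub> t =
      (x, dual_tensor V x (pm_scale r c))"
    using t by (simp add: smult_transport_vs[OF inj_Pair] smult_tensor_vs carrier_tensor_vs)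
  then show ?thesis
    using t assms(2,3) by (simp add: tensor_form_class tensor_eval_scale)
qed

lemma dual_eval_plot:
  assumes V: "vector_pseudo_bundle V" and x: "x \<in> pts (Base V)"
    and \<xi>: "\<xi> \<in> carrier (Fib (dual_bundle V) x)"
    and v: "plot (Total V) n U v" "\<And>u. u \<in> U \<Longrightarrow> Proj V (v u) = x"
  shows "C_infinity n U (\<lambda>u. snd \<xi> (v u))"
proof -
  have "smooth_map (fibre_space V x) real_space (snd \<xi>)"
    using \<xi> by (auto simp: carrier_Fib_dual_bundle carrier_smooth_dual)
  moreover have "plot (fibre_space V x) n U v"
    using v plot_in[OF bundle_total[OF V] v(1)]
    by (auto simp: fibre_space_def bundle_carrier[OF V x])
  ultimately show ?thesis by (rule smooth_realD)
qed

lemma diffeological_evaluation_space: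
  assumes V: "vector_pseudo_bundle V"
  shows "diffeological_space (evaluation_space V)"
proof (rule diffeological_spaceI)
  fix n :: nat and U :: "(nat \<Rightarrow> real) set" and t
  assume U: "openin (Euclidean_space n) U" and T: "t \<in> pts (evaluation_space V)"
  then obtain x c where t: "x \<in> pts (Base V)"
    "Poly_Mapping.keys c \<subseteq> carrier (Fib (dual_bundle V) x) \<times> carrier (Fib (dual_bundle V) x)"
    "t = (x, dual_tensor V x c)"
    by (auto elim: evaluation_ptsE)
  show "plot (evaluation_space V) n U (\<lambda>_. t)"
  proof (rule evaluation_plotI)
    show "plot (Base V) n U (\<lambda>_. fst t)"
      using plot_const[OF bundle_base[OF V] U] t by simp
    fix m W a v w
    assume v: "plot (Total V) m W v" "\<And>s. s \<in> W \<Longrightarrow> Proj V (v s) = fst t"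
      and w: "plot (Total V) m W w" "\<And>s. s \<in> W \<Longrightarrow> Proj V (w s) = fst t"
    \<comment> \<open>For a constant tensor both \<open>v\<close> and \<open>w\<close> stay in the
      fibre over \<open>x\<close>, where every functional occurring in \<open>c\<close> is smooth by
      itself; the evaluation is a finite sum of products of such functions.\<close>
    have "C_infinity m W (\<lambda>s. tensor_eval c (v s) (w s))"
      unfolding tensor_eval_def
    proof (rule C_infinity_sum)
      fix k assume "k \<in> Poly_Mapping.keys c"
      then have k: "fst k \<in> carrier (Fib (dual_bundle V) x)" "snd k \<in> carrier (Fib (dual_bundle V) x)"
        using t(2) by auto
      show "C_infinity m W (\<lambda>s. Poly_Mapping.lookup c k * snd (fst k) (v s) * snd (snd k) (w s))"
        by (rule C_infinity_mult[OF C_infinity_mult[OF C_infinity_const dual_eval_plot[OF V t(1) k(1) v(1)]]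
              dual_eval_plot[OF V t(1) k(2) w(1)]]) (use v w t in auto)
    qed
    then show "C_infinity m W (\<lambda>s. tensor_form t (v s) (w s))"
    proof (rule C_infinity_transform[OF _ plot_openin[OF bundle_total[OF V] v(1)]])
      fix s assume "s \<in> W"
      then show "tensor_form t (v s) (w s) = tensor_eval c (v s) (w s)"
        using v(2) w(2) plot_in[OF bundle_total[OF V] v(1)] plot_in[OF bundle_total[OF V] w(1)] t
        by (simp add: tensor_form_class bundle_carrier[OF V])
    qed
  qed (use U T in simp_all)
next
  fix n U t assume t: "plot (evaluation_space V) n U t"
  show "openin (Euclidean_space n) U" by (rule evaluation_plot_openin[OF t])
  show "t u \<in> pts (evaluation_space V)" if "u \<in> U" for u using t that by (rule evaluation_plot_in)
  fix m W F assume F: "plot (euclid n) m W F" "F ` W \<subseteq> U"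
  show "plot (evaluation_space V) m W (\<lambda>s. t (F s))"
  proof (rule evaluation_plotI)
    show "openin (Euclidean_space m) W" using F(1) by (rule euclid_plot_openin)
    show "t (F s) \<in> pts (evaluation_space V)" if "s \<in> W" for s
      using evaluation_plot_in[OF t] F(2) that by blast
    show "plot (Base V) m W (\<lambda>s. fst (t (F s)))"
      by (rule plot_compose[OF bundle_base[OF V] evaluation_plot_base[OF t] F])
    fix l S a v w assume a: "plot (euclid m) l S a" "a ` S \<subseteq> W"
      and vw: "plot (Total V) l S v" "plot (Total V) l S w"
        "\<And>s. s \<in> S \<Longrightarrow> Proj V (v s) = fst (t (F (a s)))"
        "\<And>s. s \<in> S \<Longrightarrow> Proj V (w s) = fst (t (F (a s)))"
    have "(\<lambda>s. F (a s)) ` S \<subseteq> U" using a(2) F(2) by blast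
    from evaluation_plot_eval[OF t euclid_plot_compose[OF F(1) a] this vw]
    show "C_infinity l S (\<lambda>s. tensor_form (t (F (a s))) (v s) (w s))" .
  qed
next
  fix n U t assume U: "openin (Euclidean_space n) U"
    and loc: "\<And>u. u \<in> U \<Longrightarrow>
      \<exists>W q. u \<in> W \<and> W \<subseteq> U \<and> plot (evaluation_space V) n W q \<and> (\<forall>w\<in>W. t w = q w)"
  show "plot (evaluation_space V) n U t"
  proof (rule evaluation_plotI)
    show "t u \<in> pts (evaluation_space V)" if u: "u \<in> U" for u
    proof -
      from loc[OF u] obtain W q where W: "u \<in> W" "plot (evaluation_space V) n W q" "\<forall>w\<in>W. t w = q w"
        by (elim exE conjE)
      show ?thesis using evaluation_plot_in[OF W(2,1)] W(1,3) by simp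
    qed
    show "plot (Base V) n U (\<lambda>u. fst (t u))"
    proof (rule plot_local[OF bundle_base[OF V] U])
      fix u assume "u \<in> U"
      from loc[OF this] obtain W q where W: "u \<in> W" "W \<subseteq> U" "plot (evaluation_space V) n W q"
        "\<forall>w\<in>W. t w = q w" by (elim exE conjE)
      show "\<exists>W q. u \<in> W \<and> W \<subseteq> U \<and> plot (Base V) n W q \<and> (\<forall>w\<in>W. fst (t w) = q w)"
        by (rule exI[of _ W], rule exI[of _ "\<lambda>w. fst (q w)"])
          (use W evaluation_plot_base[OF W(3)] in simp)
    qed
    fix l S a v w assume a: "plot (euclid n) l S a" "a ` S \<subseteq> U"
      and v: "plot (Total V) l S v" "\<And>s. s \<in> S \<Longrightarrow> Proj V (v s) = fst (t (a s))"
      and w: "plot (Total V) l S w" "\<And>s. s \<in> S \<Longrightarrow> Proj V (w s) = fst (t (a s))"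
    show "C_infinity l S (\<lambda>s. tensor_form (t (a s)) (v s) (w s))"
    proof (rule C_infinity_local[OF euclid_plot_openin[OF a(1)]])
      fix s assume s: "s \<in> S"
      then have "a s \<in> U" using a(2) by blast
      from loc[OF this] obtain W q where W: "a s \<in> W" "W \<subseteq> U" "plot (evaluation_space V) n W q"
        "\<forall>w\<in>W. t w = q w" by (elim exE conjE)
      let ?S = "{s \<in> S. a s \<in> W}"
      have S: "openin (Euclidean_space l) ?S" "?S \<subseteq> S"
        using euclid_plot_preimage[OF a(1) evaluation_plot_openin[OF W(3)]] by auto
      have aS: "plot (euclid n) l ?S a" "a ` ?S \<subseteq> W"
        using euclid_plot_compose[OF a(1) euclid_plot_id[OF S(1)]] by auto
      have "C_infinity l ?S (\<lambda>s. tensor_form (q (a s)) (v s) (w s))"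
        by (rule evaluation_plot_eval[OF W(3) aS plot_restrict[OF bundle_total[OF V] v(1) S]
              plot_restrict[OF bundle_total[OF V] w(1) S]]) (use v(2) w(2) W(4) in auto)
      then have "C_infinity l ?S (\<lambda>s. tensor_form (t (a s)) (v s) (w s))"
        by (rule C_infinity_transform[OF _ S(1)]) (use W(4) in simp)
      then show "\<exists>W. openin (Euclidean_space l) W \<and> s \<in> W \<and> W \<subseteq> S \<and>
          C_infinity l W (\<lambda>s. tensor_form (t (a s)) (v s) (w s))"
        using S s W(1) by (intro exI[of _ ?S]) simp
    qed
  qed (fact U)
qed

lemma dual_points_carrier:
  "\<xi> \<in> dual_points V \<longleftrightarrow> fst \<xi> \<in> pts (Base V) \<and> \<xi> \<in> carrier (Fib (dual_bundle V) (fst \<xi>))"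
  unfolding carrier_Fib_dual_bundle dual_points_def by (cases \<xi>) auto

text \<open>For fixed vectors \<open>tensor_form\<close> is linear in the tensor, so sums and smooth
  multiples of tensors that evaluate smoothly again evaluate smoothly.\<close>

lemma evaluation_bundle:
  assumes V: "vector_pseudo_bundle V"
  shows "vector_pseudo_bundle
    \<lparr> Base = Base V, Total = evaluation_space V, Proj = fst, Fib = dual_square_fib V \<rparr>"
proof -
  note vs = vectorspace_dual_square_fib[where V = V]
  have add_in: "t \<oplus>\<^bsub>dual_square_fib V (fst t)\<^esub> t' \<in> carrier (dual_square_fib V (fst t))"
    if "t \<in> pts (evaluation_space V)" "t' \<in> pts (evaluation_space V)" "fst t' = fst t" for t t'
    by (rule vs_add[OF vs]) (use that in \<open>simp_all add: carrier_dual_square_fib evaluation_fst\<close>)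
  have smult_in: "r \<odot>\<^bsub>dual_square_fib V (fst t)\<^esub> t \<in> carrier (dual_square_fib V (fst t))"
    if "t \<in> pts (evaluation_space V)" for r t
    by (rule vs_smult[OF vs]) (use that in \<open>simp_all add: carrier_dual_square_fib evaluation_fst\<close>)
  have zero_in: "\<zero>\<^bsub>dual_square_fib V x\<^esub> \<in> carrier (dual_square_fib V x)" for x
    by (rule vs_zero[OF vs])
  show ?thesis
    unfolding vector_pseudo_bundle_def fibred_space.simps
  proof (intro conjI ballI)
    show "smooth_map (evaluation_space V) (Base V) fst"
      by (rule smooth_mapI) (simp_all add: evaluation_fst evaluation_plot_base)
    show "fst ` pts (evaluation_space V) = pts (Base V)"
    proof (intro equalityI subsetI)
      fix x assume "x \<in> pts (Base V)"
      then show "x \<in> fst ` pts (evaluation_space V)"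
        using zero_in[of x] unfolding carrier_dual_square_fib[OF \<open>x \<in> pts (Base V)\<close>] by force
    qed (use evaluation_fst in blast)
    show "carrier (dual_square_fib V x) = {v \<in> pts (evaluation_space V). fst v = x}"
      if "x \<in> pts (Base V)" for x
      using that by (rule carrier_dual_square_fib)
    show "smooth_map (subset_space (prod_space (evaluation_space V) (evaluation_space V)) {(v, w). fst v = fst w})
        (evaluation_space V) (\<lambda>(v, w). v \<oplus>\<^bsub>dual_square_fib V (fst v)\<^esub> w)"
    proof (rule smooth_mapI)
      fix n U p
      assume pp: "plot (subset_space (prod_space (evaluation_space V) (evaluation_space V)) {(v, w). fst v = fst w}) n U p"
      have p: "plot (evaluation_space V) n U (\<lambda>u. fst (p u))" "plot (evaluation_space V) n U (\<lambda>u. snd (p u))"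
        and eq: "\<And>u. u \<in> U \<Longrightarrow> fst (snd (p u)) = fst (fst (p u))"
        using pp by (auto simp: image_subset_iff case_prod_beta)
      let ?q = "\<lambda>u. fst (p u) \<oplus>\<^bsub>dual_square_fib V (fst (fst (p u)))\<^esub> snd (p u)"
      have q: "?q u \<in> pts (evaluation_space V)" "fst (?q u) = fst (fst (p u))" if "u \<in> U" for u
        using add_in[OF evaluation_plot_in[OF p(1) that] evaluation_plot_in[OF p(2) that] eq[OF that]]
          evaluation_plot_in[OF p(1) that]
        by (simp_all add: carrier_dual_square_fib evaluation_fst)
      have "plot (evaluation_space V) n U ?q"
      proof (rule evaluation_plotI)
        show "openin (Euclidean_space n) U" by (rule evaluation_plot_openin[OF p(1)])
        show "plot (Base V) n U (\<lambda>u. fst (?q u))"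
          by (rule plot_cong[OF bundle_base[OF V] evaluation_plot_base[OF p(1)]]) (rule q(2))
        fix m W a v w
        assume a: "plot (euclid n) m W a" "a ` W \<subseteq> U"
          and v: "plot (Total V) m W v" "\<And>s. s \<in> W \<Longrightarrow> Proj V (v s) = fst (?q (a s))"
          and w: "plot (Total V) m W w" "\<And>s. s \<in> W \<Longrightarrow> Proj V (w s) = fst (?q (a s))"
        have W: "openin (Euclidean_space m) W" by (rule euclid_plot_openin[OF a(1)])
        have aW: "a s \<in> U" if "s \<in> W" for s using a(2) that by blast
        have v': "Proj V (v s) = fst (fst (p (a s)))" and w': "Proj V (w s) = fst (fst (p (a s)))"
          and v'': "Proj V (v s) = fst (snd (p (a s)))" and w'': "Proj V (w s) = fst (snd (p (a s)))"
          if "s \<in> W" for s using v(2)[OF that] w(2)[OF that] q(2)[OF aW[OF that]] eq[OF aW[OF that]]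
          by simp_all
        have "C_infinity m W (\<lambda>s. tensor_form (fst (p (a s))) (v s) (w s) + tensor_form (snd (p (a s))) (v s) (w s))"
          by (rule C_infinity_add[OF evaluation_plot_eval[OF p(1) a v(1) w(1) v' w']
                evaluation_plot_eval[OF p(2) a v(1) w(1) v'' w'']])
        then show "C_infinity m W (\<lambda>s. tensor_form (?q (a s)) (v s) (w s))"
        proof (rule C_infinity_transform[OF _ W])
          fix s assume s: "s \<in> W"
          show "tensor_form (?q (a s)) (v s) (w s) =
              tensor_form (fst (p (a s))) (v s) (w s) + tensor_form (snd (p (a s))) (v s) (w s)"
            by (rule tensor_form_add[OF evaluation_plot_in[OF p(1) aW[OF s]] evaluation_plot_in[OF p(2) aW[OF s]]
                  eq[OF aW[OF s]]])
              (use plot_fibre[OF V v(1) s] plot_fibre[OF V w(1) s] v'[OF s] w'[OF s] in simp_all)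
        qed
      qed (rule q(1))
      then show "plot (evaluation_space V) n U (\<lambda>u. case p u of (v, w) \<Rightarrow> v \<oplus>\<^bsub>dual_square_fib V (fst v)\<^esub> w)"
        by (simp add: case_prod_beta)
    qed (use add_in in \<open>auto simp: carrier_dual_square_fib evaluation_fst\<close>)
    show "smooth_map (prod_space real_space (evaluation_space V)) (evaluation_space V)
        (\<lambda>(r, v). r \<odot>\<^bsub>dual_square_fib V (fst v)\<^esub> v)"
    proof (rule smooth_mapI)
      fix n U p assume p: "plot (prod_space real_space (evaluation_space V)) n U p"
      then have t: "plot (evaluation_space V) n U (\<lambda>u. snd (p u))"
        and r: "C_infinity n U (\<lambda>u. fst (p u))"
        by (simp_all add: real_space_def)
      let ?q = "\<lambda>u. fst (p u) \<odot>\<^bsub>dual_square_fib V (fst (snd (p u)))\<^esub> snd (p u)"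
      have q: "?q u \<in> pts (evaluation_space V)" "fst (?q u) = fst (snd (p u))" if "u \<in> U" for u
        using smult_in[OF evaluation_plot_in[OF t that], of "fst (p u)"] evaluation_plot_in[OF t that]
        by (simp_all add: carrier_dual_square_fib evaluation_fst)
      have "plot (evaluation_space V) n U ?q"
      proof (rule evaluation_plotI)
        show "openin (Euclidean_space n) U" by (rule evaluation_plot_openin[OF t])
        show "plot (Base V) n U (\<lambda>u. fst (?q u))"
          by (rule plot_cong[OF bundle_base[OF V] evaluation_plot_base[OF t]]) (rule q(2))
        fix m W a v w
        assume a: "plot (euclid n) m W a" "a ` W \<subseteq> U"
          and v: "plot (Total V) m W v" "\<And>s. s \<in> W \<Longrightarrow> Proj V (v s) = fst (?q (a s))"
          and w: "plot (Total V) m W w" "\<And>s. s \<in> W \<Longrightarrow> Proj V (w s) = fst (?q (a s))"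
        have W: "openin (Euclidean_space m) W" by (rule euclid_plot_openin[OF a(1)])
        have aW: "a s \<in> U" if "s \<in> W" for s using a(2) that by blast
        have v': "Proj V (v s) = fst (snd (p (a s)))" and w': "Proj V (w s) = fst (snd (p (a s)))"
          if "s \<in> W" for s using v(2)[OF that] w(2)[OF that] q(2)[OF aW[OF that]] by simp_all
        \<comment> \<open>The scalar varies with the parameter as well, so it has to be
          reparametrised along \<open>a\<close>.\<close>
        have "C_infinity m W (\<lambda>s. fst (p (a s)))"
          by (rule C_infinity_compose[OF evaluation_plot_openin[OF t] W a(2) r])
            (use a(1) in \<open>simp add: euclid_def\<close>)
        then have "C_infinity m W (\<lambda>s. fst (p (a s)) * tensor_form (snd (p (a s))) (v s) (w s))"
          by (rule C_infinity_mult[OF _ evaluation_plot_eval[OF t a v(1) w(1) v' w']])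
        then show "C_infinity m W (\<lambda>s. tensor_form (?q (a s)) (v s) (w s))"
        proof (rule C_infinity_transform[OF _ W])
          fix s assume s: "s \<in> W"
          show "tensor_form (?q (a s)) (v s) (w s) = fst (p (a s)) * tensor_form (snd (p (a s))) (v s) (w s)"
            by (rule tensor_form_smult[OF evaluation_plot_in[OF t aW[OF s]]])
              (use plot_fibre[OF V v(1) s] plot_fibre[OF V w(1) s] v'[OF s] w'[OF s] in simp_all)
        qed
      qed (rule q(1))
      then show "plot (evaluation_space V) n U (\<lambda>u. case p u of (r, v) \<Rightarrow> r \<odot>\<^bsub>dual_square_fib V (fst v)\<^esub> v)"
        by (simp add: case_prod_beta)
    qed (use smult_in in \<open>auto simp: carrier_dual_square_fib evaluation_fst\<close>)
    show "smooth_map (Base V) (evaluation_space V) (\<lambda>x. \<zero>\<^bsub>dual_square_fib V x\<^esub>)"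
    proof (rule smooth_mapI)
      show "\<zero>\<^bsub>dual_square_fib V x\<^esub> \<in> pts (evaluation_space V)" if "x \<in> pts (Base V)" for x
        using zero_in[of x] by (simp add: carrier_dual_square_fib[OF that])
      fix n U y assume y: "plot (Base V) n U y"
      have U: "openin (Euclidean_space n) U" by (rule plot_openin[OF bundle_base[OF V] y])
      have yU: "y u \<in> pts (Base V)" if "u \<in> U" for u by (rule plot_in[OF bundle_base[OF V] y that])
      have zero: "\<zero>\<^bsub>dual_square_fib V x\<^esub> = (x, dual_tensor V x 0)" for x
        by (simp add: zero_transport_vs[OF inj_Pair] zero_tensor_vs)
      show "plot (evaluation_space V) n U (\<lambda>u. \<zero>\<^bsub>dual_square_fib V (y u)\<^esub>)"
      proof (rule evaluation_plotI[OF U])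
        show "\<zero>\<^bsub>dual_square_fib V (y u)\<^esub> \<in> pts (evaluation_space V)" if "u \<in> U" for u
          using zero_in[of "y u"] yU[OF that] by (simp add: carrier_dual_square_fib)
        show "plot (Base V) n U (\<lambda>u. fst \<zero>\<^bsub>dual_square_fib V (y u)\<^esub>)"
          using y by (simp add: zero)
        fix m W a v w
        assume a: "plot (euclid n) m W a" "a ` W \<subseteq> U"
          and v: "plot (Total V) m W v" "\<And>s. s \<in> W \<Longrightarrow> Proj V (v s) = fst \<zero>\<^bsub>dual_square_fib V (y (a s))\<^esub>"
          and w: "plot (Total V) m W w" "\<And>s. s \<in> W \<Longrightarrow> Proj V (w s) = fst \<zero>\<^bsub>dual_square_fib V (y (a s))\<^esub>"
        show "C_infinity m W (\<lambda>s. tensor_form \<zero>\<^bsub>dual_square_fib V (y (a s))\<^esub> (v s) (w s))"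
        proof (rule C_infinity_transform[OF C_infinity_const[of m W 0] euclid_plot_openin[OF a(1)]])
          fix s assume s: "s \<in> W"
          show "tensor_form \<zero>\<^bsub>dual_square_fib V (y (a s))\<^esub> (v s) (w s) = 0"
            using plot_fibre[OF V v(1) s] plot_fibre[OF V w(1) s] v(2)[OF s] w(2)[OF s]
            by (simp add: zero tensor_form_class)
        qed
      qed
    qed
  qed (rule bundle_base[OF V] diffeological_evaluation_space[OF V] vs)+
qed

text \<open>The tensor diffeology is the intersection of all admissible ones, so a single admissible
  instance constrains its plots. What is left of admissibility is smoothness of the tensor product
  map: a pure tensor evaluates to the product of two evaluations along dual plots.\<close>

lemma tensor_plot_evaluation:
  assumes V: "vector_pseudo_bundle V"
    and t: "plot (Total (tensor_bundle (dual_bundle V) (dual_bundle V))) n U t"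
  shows "plot (evaluation_space V) n U t"
proof -
  have "smooth_map
      (subset_space (prod_space (Total (dual_bundle V)) (Total (dual_bundle V))) {(v, w). fst v = fst w})
      (evaluation_space V)
      (\<lambda>(v, w). (fst v, dual_tensor V (fst v)
        (Poly_Mapping.single (v, w) 1)))"
  proof (rule smooth_mapI)
    have *: "(fst \<xi>, dual_tensor V (fst \<xi>)
        (Poly_Mapping.single (\<xi>, \<eta>) 1)) \<in> pts (evaluation_space V)"
      if "\<xi> \<in> dual_points V" "\<eta> \<in> dual_points V" "fst \<xi> = fst \<eta>" for \<xi> \<eta>
      using that unfolding pts_evaluation_space carrier_tensor_vs dual_points_carrier
      by (auto intro!: imageI)
    show "(case p of (v, w) \<Rightarrow> (fst v, dual_tensor V (fst v)
        (Poly_Mapping.single (v, w) 1))) \<in> pts (evaluation_space V)"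
      if "p \<in> pts (subset_space (prod_space (Total (dual_bundle V)) (Total (dual_bundle V))) {(v, w). fst v = fst w})"
      for p
      using that by (cases p) (auto intro!: *)
    fix n U p
    assume pp: "plot (subset_space (prod_space (Total (dual_bundle V)) (Total (dual_bundle V))) {(v, w). fst v = fst w}) n U p"
    then have p: "plot (Total (dual_bundle V)) n U (\<lambda>u. fst (p u))" "plot (Total (dual_bundle V)) n U (\<lambda>u. snd (p u))"
      and eq: "\<And>u. u \<in> U \<Longrightarrow> fst (fst (p u)) = fst (snd (p u))"
      by (auto simp: image_subset_iff case_prod_beta)
    note dp = p[unfolded dual_plot_iff[OF bundle_total[OF V]]]
    let ?q = "\<lambda>u. (fst (fst (p u)), dual_tensor V (fst (fst (p u))) (Poly_Mapping.single (fst (p u), snd (p u)) 1))"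
    have "plot (evaluation_space V) n U ?q"
    proof (rule evaluation_plotI)
      show "openin (Euclidean_space n) U" using dp(1) by blast
      show "plot (Base V) n U (\<lambda>u. fst (?q u))" using dp(1) by simp
      show "?q u \<in> pts (evaluation_space V)" if "u \<in> U" for u
        by (rule *[OF _ _ eq[OF that]]) (use dp that in blast)+
      fix m W a v w
      assume a: "plot (euclid n) m W a" "a ` W \<subseteq> U"
        and v: "plot (Total V) m W v" "\<And>s. s \<in> W \<Longrightarrow> Proj V (v s) = fst (?q (a s))"
        and w: "plot (Total V) m W w" "\<And>s. s \<in> W \<Longrightarrow> Proj V (w s) = fst (?q (a s))"
      have aW: "a s \<in> U" if "s \<in> W" for s using a(2) that by blast
      note pa = p[THEN dual_plot_compose[OF bundle_base[OF V] bundle_total[OF V] _ a]]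
      have "C_infinity m W (\<lambda>s. snd (fst (p (a s))) (v s) * snd (snd (p (a s))) (w s))"
        by (rule C_infinity_mult[OF dual_plot_eval[OF bundle_total[OF V] pa(1) v(1)]
              dual_plot_eval[OF bundle_total[OF V] pa(2) w(1)]])
          (simp_all add: v(2) w(2) eq[OF aW])
      then show "C_infinity m W (\<lambda>s. tensor_form (?q (a s)) (v s) (w s))"
      proof (rule C_infinity_transform[OF _ plot_openin[OF bundle_total[OF V] v(1)]])
        fix s assume s: "s \<in> W"
        have "v s \<in> carrier (Fib V (fst (fst (p (a s)))))" "w s \<in> carrier (Fib V (fst (fst (p (a s)))))"
          using plot_fibre[OF V v(1) s] plot_fibre[OF V w(1) s] v(2)[OF s] w(2)[OF s] by simp_all
        then show "tensor_form (?q (a s)) (v s) (w s) = snd (fst (p (a s))) (v s) * snd (snd (p (a s))) (w s)"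
          by (simp add: tensor_form_class tensor_eval_single)
      qed
    qed
    then show "plot (evaluation_space V) n U (\<lambda>u. case p u of (v, w) \<Rightarrow>
        (fst v, dual_tensor V (fst v)
          (Poly_Mapping.single (v, w) 1)))"
      by (simp add: case_prod_beta)
  qed
  with evaluation_bundle[OF V] t show ?thesis
    by (simp add: tensor_bundle_def Let_def pts_evaluation_space)
qed

text \<open>Smoothness of the section \<open>g\<close> in usable form: along the base points of
  \<open>v\<close> it is a plot of the tensor bundle, which is then evaluated with the identity as
  reparametrisation.\<close>

lemma pseudo_metric_smooth:
  assumes V: "vector_pseudo_bundle V" and g: "pseudo_metric V g"
    and v: "plot (Total V) n U v" and w: "plot (Total V) n U w"
    and eq: "\<And>u. u \<in> U \<Longrightarrow> Proj V (w u) = Proj V (v u)"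
  shows "C_infinity n U (\<lambda>u. tensor_form (g (Proj V (v u))) (v u) (w u))"
proof -
  have y: "plot (Base V) n U (\<lambda>u. Proj V (v u))"
    by (rule smooth_mapD[OF bundle_proj[OF V] v])
  have "plot (evaluation_space V) n U (\<lambda>u. g (Proj V (v u)))"
    by (rule tensor_plot_evaluation[OF V smooth_mapD[OF _ y]]) (use g in \<open>simp add: pseudo_metric_def\<close>)
  moreover have "fst (g (Proj V (v u))) = Proj V (v u)" if "u \<in> U" for u
    using g plot_in[OF bundle_base[OF V] y that]
    by (simp add: pseudo_metric_def tensor_bundle_def Let_def)
  moreover have "openin (Euclidean_space n) U" by (rule plot_openin[OF bundle_total[OF V] v])
  ultimately show ?thesis
    using evaluation_plot_eval[OF _ euclid_plot_id _ v w] eq by simp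
qed

section \<open>Linear functionals\<close>

lemma linear_functional_add:
  "\<xi> \<in> module_hom class_ring E real_vs \<Longrightarrow> v \<in> carrier E \<Longrightarrow> w \<in> carrier E \<Longrightarrow> \<xi> (v \<oplus>\<^bsub>E\<^esub> w) = \<xi> v + \<xi> w"
  by (simp add: module_hom_real_vs)

lemma linear_functional_smult:
  "\<xi> \<in> module_hom class_ring E real_vs \<Longrightarrow> v \<in> carrier E \<Longrightarrow> \<xi> (r \<odot>\<^bsub>E\<^esub> v) = r * \<xi> v"
  by (simp add: module_hom_real_vs)

lemma linear_functional_zero:
  fixes E :: "(real, 'v) module"
  shows "vectorspace class_ring E \<Longrightarrow> \<xi> \<in> module_hom class_ring E real_vs \<Longrightarrow> \<xi> \<zero>\<^bsub>E\<^esub> = 0"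
  using linear_functional_smult[of \<xi> E "\<zero>\<^bsub>E\<^esub>" 0] vs_zero[of E] vs_smult_zero_left[of E "\<zero>\<^bsub>E\<^esub>"] by simp

lemma linear_functionals_eq_on_span:
  fixes E :: "(real, 'v) module"
  assumes E: "vectorspace class_ring E" and B: "B \<subseteq> carrier E" "module.span class_ring E B = carrier E"
    and \<xi>: "\<xi> \<in> module_hom class_ring E real_vs" and \<zeta>: "\<zeta> \<in> module_hom class_ring E real_vs"
    and eq: "\<And>e. e \<in> B \<Longrightarrow> \<xi> e = \<zeta> e" and v: "v \<in> carrier E"
  shows "\<xi> v = \<zeta> v"
proof -
  interpret vectorspace class_ring E by fact
  have "submodule class_ring {v \<in> carrier E. \<xi> v = \<zeta> v} E"
  proof (rule submodule.intro)
    show "Module.module class_ring E" by (rule module_axioms)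
  qed (use \<xi> \<zeta> in \<open>auto simp: linear_functional_zero[OF E] linear_functional_add linear_functional_smult
        vs_add[OF E] vs_smult[OF E]\<close>)
  then have "span B \<subseteq> {v \<in> carrier E. \<xi> v = \<zeta> v}"
    using B(1) eq by (intro span_is_subset) auto
  then show ?thesis using B(2) v by auto
qed

lemma vectorspace_function_space:
  assumes A: "A \<subseteq> extensional X" and zero: "(\<lambda>x\<in>X. 0) \<in> A"
    and add: "\<And>\<xi> \<eta>. \<xi> \<in> A \<Longrightarrow> \<eta> \<in> A \<Longrightarrow> (\<lambda>x\<in>X. \<xi> x + \<eta> x) \<in> A"
    and smult: "\<And>r \<xi>. \<xi> \<in> A \<Longrightarrow> (\<lambda>x\<in>X. r * \<xi> x) \<in> A"
  shows "vectorspace class_ring ((class_ring.func_space X)\<lparr>carrier := A :: ('v \<Rightarrow> real) set\<rparr>)"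
proof (rule vectorspace_realI)
  fix \<xi> assume "\<xi> \<in> carrier ((class_ring.func_space X)\<lparr>carrier := A\<rparr>)"
  then have "restrict \<xi> X = \<xi>" using A by (auto simp: extensional_restrict)
  then show "\<xi> \<oplus>\<^bsub>(class_ring.func_space X)\<lparr>carrier := A\<rparr>\<^esub> \<zero>\<^bsub>(class_ring.func_space X)\<lparr>carrier := A\<rparr>\<^esub> = \<xi>"
    "1 \<odot>\<^bsub>(class_ring.func_space X)\<lparr>carrier := A\<rparr>\<^esub> \<xi> = \<xi>"
    by (simp_all add: class_ring.func_space_def cong: restrict_cong)
qed (auto simp: class_ring.func_space_def zero add smult algebra_simps cong: restrict_cong)

text \<open>A functional is determined by its values on a finite generating set of \<open>E\<close>.
  A finite \<open>C\<close> is grown along that set, each vector contributing at most one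
  functional. Finite dimension has to be known before equality of dimensions can force equality of
  spaces.\<close>

lemma fin_dim_functionals:
  fixes E :: "(real, 'v) module"
  assumes E: "vectorspace class_ring E" "vectorspace.fin_dim class_ring E"
    and A: "A \<subseteq> extensional (carrier E)" "A \<subseteq> module_hom class_ring E real_vs"
    and zero: "(\<lambda>v\<in>carrier E. 0) \<in> A"
    and add: "\<And>\<xi> \<eta>. \<xi> \<in> A \<Longrightarrow> \<eta> \<in> A \<Longrightarrow> (\<lambda>v\<in>carrier E. \<xi> v + \<eta> v) \<in> A"
    and smult: "\<And>r \<xi>. \<xi> \<in> A \<Longrightarrow> (\<lambda>v\<in>carrier E. r * \<xi> v) \<in> A"
  shows "vectorspace.fin_dim class_ring ((class_ring.func_space (carrier E))\<lparr>carrier := A\<rparr>)"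
proof -
  let ?F = "(class_ring.func_space (carrier E))\<lparr>carrier := A\<rparr>"
  interpret F: vectorspace class_ring ?F
    by (rule vectorspace_function_space[OF A(1) zero add smult])
  obtain B where B: "finite B" "B \<subseteq> carrier E" "module.span class_ring E B = carrier E"
    using E(2) unfolding vectorspace.fin_dim_def[OF E(1)] by blast
  have F_simps: "\<xi> \<oplus>\<^bsub>?F\<^esub> \<eta> = (\<lambda>v\<in>carrier E. \<xi> v + \<eta> v)" "r \<odot>\<^bsub>?F\<^esub> \<xi> = (\<lambda>v\<in>carrier E. r * \<xi> v)"
    "carrier ?F = A" for \<xi> \<eta> r
    by (simp_all add: class_ring.func_space_def)
  have span: "submodule class_ring (F.span C) ?F" "F.span C \<subseteq> A" "C \<subseteq> F.span C" if "C \<subseteq> A" for C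
    using F.span_is_submodule[of C] F.span_is_subset2[of C] F.in_own_span[of C] that
    by (simp_all add: F_simps)
  have "\<exists>C. finite C \<and> C \<subseteq> A \<and> (\<forall>\<xi>\<in>A. \<exists>\<zeta>\<in>F.span C. \<forall>e\<in>B'. \<xi> e = \<zeta> e)" if "finite B'" "B' \<subseteq> carrier E" for B'
    using that
  proof (induction B' rule: finite_induct)
    case empty
    have "\<exists>\<zeta>. \<zeta> \<in> F.span {}"
      using submodule.zero_closed[OF span(1)[of "{}"]] by blast
    then show ?case by (intro exI[of _ "{}"]) auto
  next
    case (insert b B')
    then obtain C where C: "finite C" "C \<subseteq> A" "\<forall>\<xi>\<in>A. \<exists>\<zeta>\<in>F.span C. \<forall>e\<in>B'. \<xi> e = \<zeta> e" by auto
    show ?case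
    \<comment> \<open>The new vector \<open>b\<close> adds information only if some functional in
      \<open>A\<close> vanishes on \<open>B'\<close> but not at \<open>b\<close>.\<close>
    proof (cases "\<exists>\<zeta>\<in>A. (\<forall>e\<in>B'. \<zeta> e = 0) \<and> \<zeta> b \<noteq> 0")
      case True
      then obtain \<zeta>0 where \<zeta>0: "\<zeta>0 \<in> A" "\<forall>e\<in>B'. \<zeta>0 e = 0" "\<zeta>0 b \<noteq> 0" by blast
      have C': "insert \<zeta>0 C \<subseteq> A" using C(2) \<zeta>0(1) by blast
      have "\<exists>\<zeta>\<in>F.span (insert \<zeta>0 C). \<forall>e\<in>insert b B'. \<xi> e = \<zeta> e" if \<xi>: "\<xi> \<in> A" for \<xi>
      proof -
        obtain \<zeta> where \<zeta>: "\<zeta> \<in> F.span C" "\<forall>e\<in>B'. \<xi> e = \<zeta> e" using C(3) \<xi> by blast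
        have "\<zeta> \<in> F.span (insert \<zeta>0 C)"
          using F.span_is_monotone[of C "insert \<zeta>0 C"] \<zeta>(1) by blast
        \<comment> \<open>This multiple of \<open>\<zeta>0\<close> corrects the value at
          \<open>b\<close> and changes nothing on \<open>B'\<close>, where \<open>\<zeta>0\<close>
          vanishes.\<close>
        moreover have "((\<xi> b - \<zeta> b) / \<zeta>0 b) \<odot>\<^bsub>?F\<^esub> \<zeta>0 \<in> F.span (insert \<zeta>0 C)"
          using span(3)[OF C'] by (intro submodule.smult_closed[OF span(1)[OF C']]) auto
        ultimately have "\<zeta> \<oplus>\<^bsub>?F\<^esub> (((\<xi> b - \<zeta> b) / \<zeta>0 b) \<odot>\<^bsub>?F\<^esub> \<zeta>0) \<in> F.span (insert \<zeta>0 C)"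
          by (rule submodule.m_closed[OF span(1)[OF C']])
        moreover have "\<forall>e\<in>insert b B'. \<xi> e = (\<zeta> \<oplus>\<^bsub>?F\<^esub> (((\<xi> b - \<zeta> b) / \<zeta>0 b) \<odot>\<^bsub>?F\<^esub> \<zeta>0)) e"
          using \<zeta>(2) \<zeta>0(2,3) insert.prems by (auto simp: class_ring.func_space_def)
        ultimately show ?thesis by blast
      qed
      then show ?thesis using C(1) C' by (intro exI[of _ "insert \<zeta>0 C"]) simp
    next
      case False
      have "\<exists>\<zeta>\<in>F.span C. \<forall>e\<in>insert b B'. \<xi> e = \<zeta> e" if \<xi>: "\<xi> \<in> A" for \<xi>
      proof -
        obtain \<zeta> where \<zeta>: "\<zeta> \<in> F.span C" "\<forall>e\<in>B'. \<xi> e = \<zeta> e" using C(3) \<xi> by blast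
        have "\<zeta> \<in> A" using \<zeta>(1) span(2)[OF C(2)] by blast
        \<comment> \<open>The difference \<open>\<xi> - \<zeta>\<close> lies in \<open>A\<close> and
          vanishes on \<open>B'\<close>, so by the case assumption it vanishes at
          \<open>b\<close>.\<close>
        from add[OF \<xi> smult[OF this, of "-1"]] False
        have "\<xi> b = \<zeta> b" using \<zeta>(2) insert.prems by fastforce
        then show ?thesis using \<zeta> by blast
      qed
      then show ?thesis using C(1,2) by blast
    qed
  qed
  from this[OF B(1,2)] obtain C where
    C: "finite C" "C \<subseteq> A" "\<forall>\<xi>\<in>A. \<exists>\<zeta>\<in>F.span C. \<forall>e\<in>B. \<xi> e = \<zeta> e" by blast
  have "A \<subseteq> F.span C"
  proof
    fix \<xi> assume \<xi>: "\<xi> \<in> A"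
    then obtain \<zeta> where \<zeta>: "\<zeta> \<in> F.span C" "\<forall>e\<in>B. \<xi> e = \<zeta> e" using C(3) by blast
    have "\<zeta> \<in> A" using \<zeta>(1) span(2)[OF C(2)] by blast
    have "\<xi> = \<zeta>"
    proof (rule extensionalityI[of \<xi> "carrier E"])
      show "\<xi> v = \<zeta> v" if "v \<in> carrier E" for v
        by (rule linear_functionals_eq_on_span[OF E(1) B(2,3) _ _ _ that])
          (use \<xi> \<open>\<zeta> \<in> A\<close> A(2) \<zeta>(2) in blast)+
    qed (use \<xi> \<open>\<zeta> \<in> A\<close> A(1) in blast)+
    then show "\<xi> \<in> F.span C" using \<zeta>(1) by simp
  qed
  then show ?thesis
    unfolding F.fin_dim_def F_simps using C(1,2) span(2)[OF C(2)] by blast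
qed

text \<open>A basis of \<open>S\<close> stays independent in \<open>T\<close> and has as many
  elements as the dimension of \<open>T\<close>, so it spans \<open>T\<close>; its span is the same
  computed in \<open>S\<close> or in \<open>T\<close>.\<close>

lemma subspace_dim_eqI:
  assumes T: "vectorspace K T" "vectorspace.fin_dim K T"
    and S: "submodule K S T" "vectorspace.fin_dim K (T\<lparr>carrier := S\<rparr>)"
    and dim: "vectorspace.dim K (T\<lparr>carrier := S\<rparr>) = vectorspace.dim K T"
  shows "S = carrier T"
proof -
  interpret T: vectorspace K T by fact
  have "subspace K S T" using S(1) T(1) by (simp add: subspace_def)
  then interpret S: vectorspace K "T\<lparr>carrier := S\<rparr>" by (rule T.subspace_is_vs)
  obtain \<beta> where \<beta>: "finite \<beta>" "S.basis \<beta>" using S.finite_basis_exists[OF S(2)] by blast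
  have \<beta>S: "\<beta> \<subseteq> S" using \<beta>(2) by (simp add: S.basis_def)
  note nd = T.span_li_not_depend[OF \<beta>S S(1)]
  have "T.basis \<beta>"
  proof (rule T.dim_li_is_basis[OF T(2) \<beta>(1)])
    show "\<beta> \<subseteq> carrier T" using \<beta>S submodule.subset[OF S(1)] by blast
    show "T.lin_indpt \<beta>" using \<beta>(2) nd(2) by (simp add: S.basis_def)
    show "T.dim \<le> card \<beta>" using S.dim_basis[OF \<beta>] dim by simp
  qed
  then have "carrier T = T.span \<beta>" by (simp add: T.basis_def)
  also have "\<dots> = S" using \<beta>(2) nd(1) by (simp add: S.basis_def)
  finally show ?thesis by simp
qed


section \<open>The pairing of a pseudo-metric\<close>

lemma
  assumes "pseudo_metric_on D E b"
  shows form_linear: "v \<in> carrier E \<Longrightarrow> b v \<in> module_hom class_ring E real_vs"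
    and form_linear_left: "w \<in> carrier E \<Longrightarrow> (\<lambda>v. b v w) \<in> module_hom class_ring E real_vs"
    and form_smooth: "smooth_map (prod_space D D) real_space (\<lambda>(v, w). b v w)"
    and form_sym: "v \<in> carrier E \<Longrightarrow> w \<in> carrier E \<Longrightarrow> b v w = b w v"
    and form_nonneg: "v \<in> carrier E \<Longrightarrow> 0 \<le> b v v"
    and form_rank_eq: "form_rank E b = vectorspace.dim class_ring (smooth_dual D E)"
  using assms by (auto simp: pseudo_metric_on_def bilinear_form_def)

text \<open>The degenerate case of the Cauchy-Schwarz inequality: the square of
  \<open>r v + w\<close> is affine in \<open>r\<close> with slope \<open>2 * b v w\<close>, and
  nonnegativity forbids a nonzero slope.\<close>

lemma form_isotropic:
  assumes E: "vectorspace class_ring E" and b: "pseudo_metric_on D E b"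
    and v: "v \<in> carrier E" "b v v = 0" and w: "w \<in> carrier E"
  shows "b v w = 0"
proof (rule ccontr)
  assume nz: "b v w \<noteq> 0"
  \<comment> \<open>Chosen so that \<open>2 * r * b v w + b w w = -1\<close>.\<close>
  define r where "r = - (b w w + 1) / (2 * b v w)"
  have rv: "r \<odot>\<^bsub>E\<^esub> v \<in> carrier E" by (rule vs_smult[OF E v(1)])
  have sum: "(r \<odot>\<^bsub>E\<^esub> v) \<oplus>\<^bsub>E\<^esub> w \<in> carrier E" by (rule vs_add[OF E rv w])
  have "b ((r \<odot>\<^bsub>E\<^esub> v) \<oplus>\<^bsub>E\<^esub> w) u = r * b v u + b w u" if "u \<in> carrier E" for u
    using linear_functional_add[OF form_linear_left[OF b that] rv w]
      linear_functional_smult[OF form_linear_left[OF b that] v(1)] by simp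
  moreover have "b u ((r \<odot>\<^bsub>E\<^esub> v) \<oplus>\<^bsub>E\<^esub> w) = r * b u v + b u w" if "u \<in> carrier E" for u
    using linear_functional_add[OF form_linear[OF b that] rv w]
      linear_functional_smult[OF form_linear[OF b that] v(1)] by simp
  ultimately have "b ((r \<odot>\<^bsub>E\<^esub> v) \<oplus>\<^bsub>E\<^esub> w) ((r \<odot>\<^bsub>E\<^esub> v) \<oplus>\<^bsub>E\<^esub> w) = r * (r * b v v + b v w) + (r * b w v + b w w)"
    using sum v(1) w by (simp add: algebra_simps)
  also have "\<dots> = 2 * r * b v w + b w w" using v(2) form_sym[OF b v(1) w] by simp
  also have "\<dots> = -1" using nz by (simp add: r_def field_simps)
  finally show False using form_nonneg[OF b sum] by simp
qed

lemma pairing_smooth_dual: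
  assumes E: "vectorspace class_ring E" and D: "diffeological_space D" "pts D = carrier E"
    and b: "pseudo_metric_on D E b" and v: "v \<in> carrier E"
  shows "(\<lambda>w\<in>carrier E. b v w) \<in> carrier (smooth_dual D E)"
  unfolding carrier_smooth_dual
proof (intro conjI)
  show "(\<lambda>w\<in>carrier E. b v w) \<in> module_hom class_ring E real_vs"
    using form_linear[OF b v] vs_add[OF E] vs_smult[OF E] by (simp add: module_hom_real_vs)
  show "smooth_map D real_space (\<lambda>w\<in>carrier E. b v w)"
  proof (rule smooth_realI)
    fix n U p assume p: "plot D n U p"
    show U: "openin (Euclidean_space n) U" by (rule plot_openin[OF D(1) p])
    have "plot (prod_space D D) n U (\<lambda>u. (v, p u))"
      using p plot_const[OF D(1) U] v D(2) by simp
    from smooth_realD[OF form_smooth[OF b] this] have "C_infinity n U (\<lambda>u. b v (p u))" by simp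
    then show "C_infinity n U (\<lambda>u. (\<lambda>w\<in>carrier E. b v w) (p u))"
      by (rule C_infinity_transform[OF _ U]) (use plot_in[OF D(1) p] D(2) in simp)
  qed
qed simp

text \<open>One combined rule: \<open>r = 1\<close> gives sums, the zero functional for
  \<open>\<xi>\<close> gives multiples, and \<open>r = -1\<close> gives differences.\<close>

lemma smooth_dual_add:
  assumes E: "vectorspace class_ring E" and D: "diffeological_space D" "pts D = carrier E"
    and \<xi>: "\<xi> \<in> carrier (smooth_dual D E)" and \<eta>: "\<eta> \<in> carrier (smooth_dual D E)"
  shows "(\<lambda>v\<in>carrier E. \<xi> v + r * \<eta> v) \<in> carrier (smooth_dual D E)"
  unfolding carrier_smooth_dual
proof (intro conjI)
  show "(\<lambda>v\<in>carrier E. \<xi> v + r * \<eta> v) \<in> module_hom class_ring E real_vs"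
    using \<xi> \<eta> vs_add[OF E] vs_smult[OF E] by (simp add: carrier_smooth_dual module_hom_real_vs algebra_simps)
  show "smooth_map D real_space (\<lambda>v\<in>carrier E. \<xi> v + r * \<eta> v)"
  proof (rule smooth_realI)
    fix n U p assume p: "plot D n U p"
    show U: "openin (Euclidean_space n) U" by (rule plot_openin[OF D(1) p])
    have "C_infinity n U (\<lambda>u. \<xi> (p u) + r * \<eta> (p u))"
      using \<xi> \<eta> smooth_realD[OF _ p]
      by (intro C_infinity_add C_infinity_mult[OF C_infinity_const]) (auto simp: carrier_smooth_dual)
    then show "C_infinity n U (\<lambda>u. (\<lambda>v\<in>carrier E. \<xi> v + r * \<eta> v) (p u))"
      by (rule C_infinity_transform[OF _ U]) (use plot_in[OF D(1) p] D(2) in simp)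
  qed
qed simp

lemma smooth_dual_zero:
  assumes E: "vectorspace class_ring E" and D: "diffeological_space D" "pts D = carrier E"
  shows "(\<lambda>v\<in>carrier E. 0) \<in> carrier (smooth_dual D E)"
  unfolding carrier_smooth_dual
proof (intro conjI)
  show "smooth_map D real_space (\<lambda>v\<in>carrier E. 0)"
  proof (rule smooth_realI)
    fix n U p assume p: "plot D n U p"
    show U: "openin (Euclidean_space n) U" by (rule plot_openin[OF D(1) p])
    show "C_infinity n U (\<lambda>u. (\<lambda>v\<in>carrier E. 0) (p u))"
      by (rule C_infinity_transform[OF C_infinity_const U]) (use plot_in[OF D(1) p] D(2) in simp)
  qed
  show "(\<lambda>v\<in>carrier E. 0) \<in> module_hom class_ring E real_vs"
    using vs_add[OF E] vs_smult[OF E] by (simp add: module_hom_real_vs)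
qed simp

text \<open>This is where the maximality of the rank of a pseudo-metric enters.\<close>

lemma pairing_surj:
  assumes E: "vectorspace class_ring E" "vectorspace.fin_dim class_ring E"
    and D: "diffeological_space D" "pts D = carrier E"
    and b: "pseudo_metric_on D E b" and \<xi>: "\<xi> \<in> carrier (smooth_dual D E)"
  shows "\<exists>v\<in>carrier E. \<xi> = (\<lambda>w\<in>carrier E. b v w)"
proof -
  let ?T = "smooth_dual D E"
  define S where "S = (\<lambda>v. \<lambda>w\<in>carrier E. b v w) ` carrier E"
  have T: "?T = (class_ring.func_space (carrier E))\<lparr>carrier := carrier ?T\<rparr>"
    by (simp add: smooth_dual_def)
  have T_ext: "carrier ?T \<subseteq> extensional (carrier E)" and T_hom: "carrier ?T \<subseteq> module_hom class_ring E real_vs"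
    by (auto simp: carrier_smooth_dual)
  note T_zero = smooth_dual_zero[OF E(1) D]
  have T_smult: "(\<lambda>v\<in>carrier E. r * \<eta> v) \<in> carrier ?T" if "\<eta> \<in> carrier ?T" for r \<eta>
    using smooth_dual_add[OF E(1) D T_zero that, of r] by (simp cong: restrict_cong)
  have T_add: "(\<lambda>v\<in>carrier E. \<eta> v + \<zeta> v) \<in> carrier ?T" if "\<eta> \<in> carrier ?T" "\<zeta> \<in> carrier ?T" for \<eta> \<zeta>
    using smooth_dual_add[OF E(1) D that, of 1] by simp
  have S_T: "S \<subseteq> carrier ?T"
    using pairing_smooth_dual[OF E(1) D b] by (auto simp: S_def)
  have S_zero: "(\<lambda>v\<in>carrier E. 0) \<in> S"
    unfolding S_def
    by (rule image_eqI[OF _ vs_zero[OF E(1)]])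
      (use linear_functional_zero[OF E(1) form_linear_left[OF b]] in \<open>auto cong: restrict_cong\<close>)
  have S_smult: "(\<lambda>v\<in>carrier E. r * \<eta> v) \<in> S" if "\<eta> \<in> S" for r \<eta>
  proof -
    from that obtain v where v: "v \<in> carrier E" "\<eta> = (\<lambda>w\<in>carrier E. b v w)" by (auto simp: S_def)
    show ?thesis
      unfolding S_def
      by (rule image_eqI[OF _ vs_smult[OF E(1) v(1), of r]])
        (use linear_functional_smult[OF form_linear_left[OF b] v(1)] v(2) in \<open>auto cong: restrict_cong\<close>)
  qed
  have S_add: "(\<lambda>v\<in>carrier E. \<eta> v + \<zeta> v) \<in> S" if "\<eta> \<in> S" "\<zeta> \<in> S" for \<eta> \<zeta>
  proof -
    from that obtain v w where v: "v \<in> carrier E" "\<eta> = (\<lambda>w\<in>carrier E. b v w)"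
      and w: "w \<in> carrier E" "\<zeta> = (\<lambda>u\<in>carrier E. b w u)" by (auto simp: S_def)
    show ?thesis
      unfolding S_def
      by (rule image_eqI[OF _ vs_add[OF E(1) v(1) w(1)]])
        (use linear_functional_add[OF form_linear_left[OF b] v(1) w(1)] v(2) w(2) in \<open>auto cong: restrict_cong\<close>)
  qed
  have T_vs: "vectorspace class_ring ?T"
    by (subst T, rule vectorspace_function_space[OF T_ext T_zero T_add T_smult])
  have T_carrier: "?T\<lparr>carrier := S\<rparr> = (class_ring.func_space (carrier E))\<lparr>carrier := S\<rparr>"
    by (simp add: smooth_dual_def)
  \<comment> \<open>By definition \<open>form_rank\<close> is the dimension of \<open>S\<close>, the
    image of the pairing; it equals the dimension of the dual, so \<open>S\<close> is the whole
    dual.\<close>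
  have "S = carrier ?T"
  proof (rule subspace_dim_eqI[OF T_vs])
    show "vectorspace.fin_dim class_ring ?T"
      by (subst T, rule fin_dim_functionals[OF E T_ext T_hom T_zero T_add T_smult])
    show "vectorspace.fin_dim class_ring (?T\<lparr>carrier := S\<rparr>)"
      unfolding T_carrier
      by (rule fin_dim_functionals[OF E order.trans[OF S_T T_ext] order.trans[OF S_T T_hom] S_zero S_add S_smult])
    show "submodule class_ring S ?T"
    proof (rule submodule.intro)
      show "Module.module class_ring ?T" using T_vs by (simp add: vectorspace_def)
    qed (use S_T S_zero S_add S_smult in \<open>auto simp: smooth_dual_def class_ring.func_space_def\<close>)
    show "vectorspace.dim class_ring (?T\<lparr>carrier := S\<rparr>) = vectorspace.dim class_ring ?T"
      using form_rank_eq[OF b] unfolding form_rank_def T_carrier by (simp add: S_def)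
  qed
  then show ?thesis using \<xi> by (auto simp: S_def)
qed

section \<open>Locally trivial pseudo-bundles with a pseudo-metric\<close>

lemma diffeological_fibre_space:
  "vector_pseudo_bundle V \<Longrightarrow> diffeological_space (fibre_space V x)"
  unfolding fibre_space_def by (rule diffeological_subset_space[OF bundle_total])

lemma pts_fibre_space:
  "vector_pseudo_bundle V \<Longrightarrow> x \<in> pts (Base V) \<Longrightarrow> pts (fibre_space V x) = carrier (Fib V x)"
  by (auto simp: fibre_space_def bundle_carrier)

lemma plot_fibre_space:
  "plot (fibre_space V x) n U p \<longleftrightarrow> plot (Total V) n U p \<and> p ` U \<subseteq> carrier (Fib V x)"
  by (simp add: fibre_space_def)

abbreviation fibre_dual :: "('x, 'v) fibred_space \<Rightarrow> 'x \<Rightarrow> ('v \<Rightarrow> real) set" where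
  "fibre_dual V x \<equiv> carrier (smooth_dual (fibre_space V x) (Fib V x))"

text \<open>A trivialisation need not restrict to the identity on the central fibre; precomposing
  with the inverse of \<open>\<phi> (x0, -)\<close> makes it so. Vectors of the central fibre then
  extend to sections over \<open>A\<close>, and functionals on nearby fibres can be compared with
  functionals at the centre on the same vectors.\<close>

lemma normalised_trivialisation:
  assumes V: "vector_pseudo_bundle V" "locally_trivial V" and x0: "x0 \<in> pts (Base V)"
  obtains A \<Phi> where "D_open (Base V) A" "x0 \<in> A"
    "\<And>n U y e. plot (Base V) n U y \<Longrightarrow> y ` U \<subseteq> A \<Longrightarrow> e \<in> carrier (Fib V x0) \<Longrightarrow>
      plot (Total V) n U (\<lambda>u. \<Phi> (y u) e)"
    "\<And>a. a \<in> A \<Longrightarrow> \<Phi> a ` carrier (Fib V x0) = carrier (Fib V a)"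
    "\<And>e. e \<in> carrier (Fib V x0) \<Longrightarrow> \<Phi> x0 e = e"
    "\<And>a \<eta>. a \<in> A \<Longrightarrow> \<eta> \<in> fibre_dual V a \<Longrightarrow>
      (\<lambda>e\<in>carrier (Fib V x0). \<eta> (\<Phi> a e)) \<in> fibre_dual V x0"
proof -
  let ?E = "Fib V x0"
  obtain A \<phi> where A: "D_open (Base V) A" "x0 \<in> A"
    and \<phi>: "diffeomorphism (prod_space (subset_space (Base V) A) (fibre_space V x0))
             (subset_space (Total V) {v. Proj V v \<in> A}) \<phi>"
    and \<phi>_fib: "\<And>a. a \<in> A \<Longrightarrow> (\<forall>v\<in>carrier ?E. Proj V (\<phi> (a, v)) = a) \<and>
                  (\<lambda>v. \<phi> (a, v)) \<in> module_hom class_ring ?E (Fib V a)"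
    using V(2) x0 unfolding locally_trivial_def by meson
  let ?P = "prod_space (subset_space (Base V) A) (fibre_space V x0)"
  let ?T = "subset_space (Total V) {v. Proj V v \<in> A}"
  have AB: "A \<subseteq> pts (Base V)" using A(1) by (simp add: D_open_def)
  have E: "vectorspace class_ring ?E" by (rule bundle_vs[OF V(1) x0])
  have P: "pts ?P = A \<times> carrier ?E"
    using AB by (auto simp: pts_fibre_space[OF V(1) x0])
  define \<psi> where "\<psi> = inv_into (pts ?P) \<phi>"
  have bij: "bij_betw \<phi> (pts ?P) (pts ?T)" and smooth: "smooth_map ?P ?T \<phi>" "smooth_map ?T ?P \<psi>"
    using \<phi> by (simp_all add: diffeomorphism_def \<psi>_def)
  \<comment> \<open>On the central fibre \<open>\<psi> e = (x0, \<kappa> e)\<close>, so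
    \<open>\<kappa>\<close> inverts \<open>\<phi> (x0, -)\<close>. Being a component of
    \<open>\<psi>\<close> it is smooth there, which the pullback of smooth functionals
    requires.\<close>
  define \<kappa> where "\<kappa> e = snd (\<psi> e)" for e
  have in_fibre: "\<phi> (a, e) \<in> carrier (Fib V a)" if "a \<in> A" "e \<in> carrier ?E" for a e
    using \<phi>_fib[OF that(1)] that(2) by (auto simp: module_hom_def)
  have fibre_T: "e \<in> pts ?T" "Proj V e = a" if "a \<in> A" "e \<in> carrier (Fib V a)" for a e
    using that AB bundle_carrier[OF V(1), of a] by auto
  have onto: "\<exists>e'\<in>carrier ?E. e = \<phi> (a, e')" if a: "a \<in> A" and e: "e \<in> carrier (Fib V a)" for a e
  proof -
    have "e \<in> \<phi> ` (A \<times> carrier ?E)"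
      using bij fibre_T(1)[OF a e] unfolding bij_betw_def P by blast
    then obtain a' e' where *: "a' \<in> A" "e' \<in> carrier ?E" "e = \<phi> (a', e')" by auto
    then have "a' = a" using \<phi>_fib[OF *(1)] fibre_T(2)[OF a e] by simp
    with * show ?thesis by blast
  qed
  have \<psi>: "\<psi> (\<phi> (a, e)) = (a, e)" if "a \<in> A" "e \<in> carrier ?E" for a e
    unfolding \<psi>_def using bij that unfolding bij_betw_def P by (intro inv_into_f_f) auto
  have \<kappa>: "\<kappa> e \<in> carrier ?E" "\<phi> (x0, \<kappa> e) = e" if "e \<in> carrier ?E" for e
    using onto[OF A(2) that] \<psi>[OF A(2)] by (auto simp: \<kappa>_def)
  have \<kappa>_eq: "\<kappa> e = e'" if "e' \<in> carrier ?E" "\<phi> (x0, e') = e" for e e'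
    using \<psi>[OF A(2) that(1)] that(2) by (simp add: \<kappa>_def)
  have hom: "\<phi> (a, v \<oplus>\<^bsub>?E\<^esub> w) = \<phi> (a, v) \<oplus>\<^bsub>Fib V a\<^esub> \<phi> (a, w)"
    "\<phi> (a, r \<odot>\<^bsub>?E\<^esub> v) = r \<odot>\<^bsub>Fib V a\<^esub> \<phi> (a, v)"
    if "a \<in> A" "v \<in> carrier ?E" "w \<in> carrier ?E" for a v w r
    using \<phi>_fib[OF that(1)] that(2,3) by (auto simp: module_hom_def)
  have \<kappa>_add: "\<kappa> (v \<oplus>\<^bsub>?E\<^esub> w) = \<kappa> v \<oplus>\<^bsub>?E\<^esub> \<kappa> w" if "v \<in> carrier ?E" "w \<in> carrier ?E" for v w
    by (rule \<kappa>_eq) (use \<kappa>[OF that(1)] \<kappa>[OF that(2)] hom(1)[OF A(2)] vs_add[OF E] in simp_all)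
  have \<kappa>_smult: "\<kappa> (r \<odot>\<^bsub>?E\<^esub> v) = r \<odot>\<^bsub>?E\<^esub> \<kappa> v" if "v \<in> carrier ?E" for v r
    by (rule \<kappa>_eq) (use \<kappa>[OF that] hom(2)[OF A(2)] vs_smult[OF E] in simp_all)
  show thesis
  proof (rule that[of A "\<lambda>a e. \<phi> (a, \<kappa> e)"])
    show "D_open (Base V) A" "x0 \<in> A" by (fact A)+
    show "\<phi> (x0, \<kappa> e) = e" if "e \<in> carrier ?E" for e using \<kappa>(2)[OF that] .
    show "plot (Total V) n U (\<lambda>u. \<phi> (y u, \<kappa> e))"
      if y: "plot (Base V) n U y" "y ` U \<subseteq> A" and e: "e \<in> carrier ?E" for n U y e
    proof -
      have "plot (fibre_space V x0) n U (\<lambda>_. \<kappa> e)"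
        by (rule plot_const[OF diffeological_fibre_space[OF V(1)] plot_openin[OF bundle_base[OF V(1)] y(1)]])
          (simp add: pts_fibre_space[OF V(1) x0] \<kappa>(1)[OF e])
      then have "plot ?P n U (\<lambda>u. (y u, \<kappa> e))" using y by simp
      from smooth_mapD[OF smooth(1) this] show ?thesis by simp
    qed
    show "(\<lambda>e. \<phi> (a, \<kappa> e)) ` carrier ?E = carrier (Fib V a)" if a: "a \<in> A" for a
    proof (intro equalityI subsetI)
      fix w assume "w \<in> carrier (Fib V a)"
      then obtain e' where e': "e' \<in> carrier ?E" "w = \<phi> (a, e')" using onto[OF a] by blast
      then have "w = \<phi> (a, \<kappa> (\<phi> (x0, e')))" using \<kappa>_eq[OF e'(1) refl] by simp
      then show "w \<in> (\<lambda>e. \<phi> (a, \<kappa> e)) ` carrier ?E" using in_fibre[OF A(2) e'(1)] by blast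
    qed (use in_fibre[OF a] \<kappa>(1) in auto)
    show "(\<lambda>e\<in>carrier ?E. \<eta> (\<phi> (a, \<kappa> e))) \<in> fibre_dual V x0"
      if a: "a \<in> A" and \<eta>: "\<eta> \<in> fibre_dual V a" for a \<eta>
      unfolding carrier_smooth_dual
    proof (intro conjI)
      have \<eta>_lin: "\<eta> \<in> module_hom class_ring (Fib V a) real_vs"
        and \<eta>_smooth: "smooth_map (fibre_space V a) real_space \<eta>"
        using \<eta> by (simp_all add: carrier_smooth_dual)
      show "(\<lambda>e\<in>carrier ?E. \<eta> (\<phi> (a, \<kappa> e))) \<in> module_hom class_ring ?E real_vs"
        using vs_add[OF E] vs_smult[OF E] \<kappa>(1) in_fibre[OF a]
        by (simp add: module_hom_real_vs \<kappa>_add \<kappa>_smult hom[OF a]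
            linear_functional_add[OF \<eta>_lin] linear_functional_smult[OF \<eta>_lin])
      show "smooth_map (fibre_space V x0) real_space (\<lambda>e\<in>carrier ?E. \<eta> (\<phi> (a, \<kappa> e)))"
      proof (rule smooth_realI)
        fix n U p assume p: "plot (fibre_space V x0) n U p"
        show U: "openin (Euclidean_space n) U"
          by (rule plot_openin[OF diffeological_fibre_space[OF V(1)] p])
        have pE: "p u \<in> carrier ?E" if "u \<in> U" for u
          using p that by (auto simp: plot_fibre_space)
        have "plot ?T n U p"
          using p fibre_T(2)[OF A(2) pE] A(2) by (auto simp: plot_fibre_space)
        from smooth_mapD[OF smooth(2) this] have "plot (fibre_space V x0) n U (\<lambda>u. \<kappa> (p u))"
          by (simp add: \<kappa>_def)
        then have "plot ?P n U (\<lambda>u. (a, \<kappa> (p u)))"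
          using plot_const[OF bundle_base[OF V(1)] U, of a] a AB by auto
        from smooth_mapD[OF smooth(1) this] have "plot (fibre_space V a) n U (\<lambda>u. \<phi> (a, \<kappa> (p u)))"
          using in_fibre[OF a \<kappa>(1)[OF pE]] by (auto simp: plot_fibre_space)
        from smooth_realD[OF \<eta>_smooth this]
        show "C_infinity n U (\<lambda>u. (\<lambda>e\<in>carrier ?E. \<eta> (\<phi> (a, \<kappa> e))) (p u))"
          by (rule C_infinity_transform[OF _ U]) (use pE in simp)
      qed
    qed simp
  qed
qed

section \<open>Smooth lifts through the pairing of a pseudo-metric\<close>

locale metric_bundle =
  fixes V :: "('x, 'v) fibred_space"
    and g :: "'x \<Rightarrow> 'x \<times> (('x \<times> ('v \<Rightarrow> real)) \<times> ('x \<times> ('v \<Rightarrow> real)) \<Rightarrow>\<^sub>0 real) set"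
  assumes V: "vector_pseudo_bundle V" and triv: "locally_trivial V" and fin: "finite_dim_fibres V"
    and g: "pseudo_metric V g"
begin

abbreviation G :: "'x \<Rightarrow> 'v \<Rightarrow> 'v \<Rightarrow> real" where
  "G x \<equiv> tensor_form (g x)"

lemma fibre_metric: "x \<in> pts (Base V) \<Longrightarrow> pseudo_metric_on (fibre_space V x) (Fib V x) (G x)"
  using g by (simp add: pseudo_metric_def)

lemma fibre_pairing_surj:
  assumes "x \<in> pts (Base V)" "\<xi> \<in> fibre_dual V x"
  shows "\<exists>v\<in>carrier (Fib V x). \<xi> = (\<lambda>w\<in>carrier (Fib V x). G x v w)"
  using pairing_surj[OF bundle_vs[OF V assms(1)] _ diffeological_fibre_space[OF V]
      pts_fibre_space[OF V assms(1)] fibre_metric[OF assms(1)] assms(2)] fin assms(1)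
  by (simp add: finite_dim_fibres_def)

lemma G_smooth:
  assumes "plot (Total V) n U v" "plot (Total V) n U w"
    and "\<And>u. u \<in> U \<Longrightarrow> Proj V (v u) = y u" "\<And>u. u \<in> U \<Longrightarrow> Proj V (w u) = y u"
  shows "C_infinity n U (\<lambda>u. G (y u) (v u) (w u))"
  by (rule C_infinity_transform[OF pseudo_metric_smooth[OF V g assms(1,2)]
        plot_openin[OF bundle_total[OF V] assms(1)]]) (simp_all add: assms(3,4))

text \<open>The plot stands for \<open>v + (\<Sum>i<k. c i * b i)\<close>. Describing its values
  only through linear functionals avoids finite sums in a vector space that varies with the base
  point, and suffices for orthogonality and for evaluating the pairing.\<close>

lemma plot_lincomb:
  fixes k :: nat
  assumes v: "plot (Total V) n U v" "\<And>u. u \<in> U \<Longrightarrow> Proj V (v u) = y u"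
    and b: "\<And>i. i < k \<Longrightarrow> plot (Total V) n U (b i)" "\<And>i u. i < k \<Longrightarrow> u \<in> U \<Longrightarrow> Proj V (b i u) = y u"
    and c: "\<And>i. i < k \<Longrightarrow> C_infinity n U (c i)"
  shows "\<exists>p. plot (Total V) n U p \<and> (\<forall>u\<in>U. Proj V (p u) = y u \<and>
    (\<forall>\<eta>\<in>module_hom class_ring (Fib V (y u)) real_vs. \<eta> (p u) = \<eta> (v u) + (\<Sum>i<k. c i u * \<eta> (b i u))))"
  using b c
proof (induction k)
  case 0
  then show ?case using v by (intro exI[of _ v]) simp
next
  case (Suc k)
  then obtain p where p: "plot (Total V) n U p" "\<And>u. u \<in> U \<Longrightarrow> Proj V (p u) = y u"
    "\<And>u \<eta>. u \<in> U \<Longrightarrow> \<eta> \<in> module_hom class_ring (Fib V (y u)) real_vs \<Longrightarrow>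
        \<eta> (p u) = \<eta> (v u) + (\<Sum>i<k. c i u * \<eta> (b i u))" by force
  have bk: "plot (Total V) n U (b k)" "\<And>u. u \<in> U \<Longrightarrow> Proj V (b k u) = y u"
    using Suc.prems by simp_all
  let ?m = "\<lambda>u. c k u \<odot>\<^bsub>Fib V (Proj V (b k u))\<^esub> b k u"
  let ?q = "\<lambda>u. p u \<oplus>\<^bsub>Fib V (Proj V (p u))\<^esub> ?m u"
  have m: "plot (Total V) n U ?m" by (rule bundle_plot_smult[OF V bk(1) Suc.prems(3)]) simp
  have yB: "y u \<in> pts (Base V)" if "u \<in> U" for u
    using bundle_fibre(1)[OF V plot_in[OF bundle_total[OF V] bk(1) that]] bk(2)[OF that] by simp
  have in_fib: "p u \<in> carrier (Fib V (y u))" "b k u \<in> carrier (Fib V (y u))" if "u \<in> U" for u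
    using plot_fibre[OF V p(1) that] plot_fibre[OF V bk(1) that] p(2)[OF that] bk(2)[OF that] by simp_all
  have m_fib: "?m u \<in> carrier (Fib V (y u))" if "u \<in> U" for u
    using vs_smult[OF bundle_vs[OF V yB[OF that]] in_fib(2)[OF that]] bk(2)[OF that] by simp
  have q_fib: "?q u \<in> carrier (Fib V (y u))" if "u \<in> U" for u
    using vs_add[OF bundle_vs[OF V yB[OF that]] in_fib(1)[OF that] m_fib[OF that]] p(2)[OF that] by simp
  have m_proj: "Proj V (?m u) = Proj V (p u)" and q_proj: "Proj V (?q u) = y u" if "u \<in> U" for u
    using m_fib[OF that] q_fib[OF that] p(2)[OF that] by (simp_all add: bundle_carrier[OF V yB[OF that]])
  have "plot (Total V) n U ?q"
    by (rule bundle_plot_add[OF V p(1) m m_proj])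
  moreover have "\<eta> (?q u) = \<eta> (v u) + (\<Sum>i<Suc k. c i u * \<eta> (b i u))"
    if "u \<in> U" "\<eta> \<in> module_hom class_ring (Fib V (y u)) real_vs" for u \<eta>
    using p(2,3)[OF that(1)] that bk(2)[OF that(1)] in_fib[OF that(1)] m_fib[OF that(1)]
    by (simp add: linear_functional_add linear_functional_smult)
  ultimately show ?case using q_proj by (intro exI[of _ ?q]) blast
qed

text \<open>Gram-Schmidt without normalisation. Vectors whose residual is isotropic at the centre are
  dropped; smooth functionals cannot see them there, because they are all represented by the
  pseudo-metric. The invariant lets functionals be tested on the retained vectors only.\<close>

definition test_frame ::
  "nat \<Rightarrow> ((nat \<Rightarrow> real) \<Rightarrow> 'x) \<Rightarrow> ('x \<Rightarrow> 'v \<Rightarrow> 'v) \<Rightarrow> (nat \<Rightarrow> real) \<Rightarrow> 'v set \<Rightarrow>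
    (nat \<Rightarrow> real) set \<Rightarrow> nat \<Rightarrow> (nat \<Rightarrow> (nat \<Rightarrow> real) \<Rightarrow> 'v) \<Rightarrow> 'v set \<Rightarrow> bool" where
  "test_frame n y \<Phi> s0 B W k b K \<longleftrightarrow>
    openin (Euclidean_space n) W \<and> s0 \<in> W \<and> K \<subseteq> B \<and>
    (\<forall>i<k. plot (Total V) n W (b i)) \<and>
    (\<forall>i<k. \<forall>s\<in>W. Proj V (b i s) = y s \<and> G (y s) (b i s) (b i s) \<noteq> 0) \<and>
    (\<forall>i<k. \<forall>j<k. \<forall>s\<in>W. i \<noteq> j \<longrightarrow> G (y s) (b i s) (b j s) = 0) \<and>
    (\<forall>s\<in>W. \<forall>\<eta>\<in>fibre_dual V (y s). (\<forall>i<k. \<eta> (b i s) = 0) \<longrightarrow> (\<forall>e\<in>K. \<eta> (\<Phi> (y s) e) = 0)) \<and>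
    (\<forall>\<zeta>\<in>fibre_dual V (y s0). (\<forall>e\<in>K. \<zeta> e = 0) \<longrightarrow> (\<forall>e\<in>B. \<zeta> e = 0) \<and> (\<forall>i<k. \<zeta> (b i s0) = 0))"

lemma test_frameI:
  assumes "openin (Euclidean_space n) W" "s0 \<in> W" "K \<subseteq> B"
    and "\<And>i. i < k \<Longrightarrow> plot (Total V) n W (b i)"
    and "\<And>i s. i < k \<Longrightarrow> s \<in> W \<Longrightarrow> Proj V (b i s) = y s"
    and "\<And>i s. i < k \<Longrightarrow> s \<in> W \<Longrightarrow> G (y s) (b i s) (b i s) \<noteq> 0"
    and "\<And>i j s. i < k \<Longrightarrow> j < k \<Longrightarrow> s \<in> W \<Longrightarrow> i \<noteq> j \<Longrightarrow> G (y s) (b i s) (b j s) = 0"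
    and "\<And>s \<eta> e. s \<in> W \<Longrightarrow> \<eta> \<in> fibre_dual V (y s) \<Longrightarrow> (\<And>i. i < k \<Longrightarrow> \<eta> (b i s) = 0) \<Longrightarrow> e \<in> K \<Longrightarrow>
      \<eta> (\<Phi> (y s) e) = 0"
    and "\<And>\<zeta> e. \<zeta> \<in> fibre_dual V (y s0) \<Longrightarrow> (\<And>e. e \<in> K \<Longrightarrow> \<zeta> e = 0) \<Longrightarrow> e \<in> B \<Longrightarrow> \<zeta> e = 0"
    and "\<And>\<zeta> i. \<zeta> \<in> fibre_dual V (y s0) \<Longrightarrow> (\<And>e. e \<in> K \<Longrightarrow> \<zeta> e = 0) \<Longrightarrow> i < k \<Longrightarrow> \<zeta> (b i s0) = 0"
  shows "test_frame n y \<Phi> s0 B W k b K"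
  unfolding test_frame_def
proof (intro conjI ballI allI impI)
  show "\<eta> (\<Phi> (y s) e) = 0" if "s \<in> W" "\<eta> \<in> fibre_dual V (y s)" "\<forall>i<k. \<eta> (b i s) = 0" "e \<in> K" for s \<eta> e
    by (rule assms(8)) (use that in simp_all)
  show "\<zeta> e = 0" if "\<zeta> \<in> fibre_dual V (y s0)" "\<forall>e\<in>K. \<zeta> e = 0" "e \<in> B" for \<zeta> e
    by (rule assms(9)) (use that in simp_all)
  show "\<zeta> (b i s0) = 0" if "\<zeta> \<in> fibre_dual V (y s0)" "\<forall>e\<in>K. \<zeta> e = 0" "i < k" for \<zeta> i
    by (rule assms(10)) (use that in simp_all)
qed (fact assms(1-7))+

lemma
  assumes "test_frame n y \<Phi> s0 B W k b K"
  shows test_frame_open: "openin (Euclidean_space n) W" "s0 \<in> W"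
    and test_frame_subset: "K \<subseteq> B"
    and test_frame_plot: "i < k \<Longrightarrow> plot (Total V) n W (b i)"
    and test_frame_proj: "i < k \<Longrightarrow> s \<in> W \<Longrightarrow> Proj V (b i s) = y s"
    and test_frame_nonzero: "i < k \<Longrightarrow> s \<in> W \<Longrightarrow> G (y s) (b i s) (b i s) \<noteq> 0"
    and test_frame_orth: "i < k \<Longrightarrow> j < k \<Longrightarrow> s \<in> W \<Longrightarrow> i \<noteq> j \<Longrightarrow> G (y s) (b i s) (b j s) = 0"
    and test_frame_test: "s \<in> W \<Longrightarrow> \<eta> \<in> fibre_dual V (y s) \<Longrightarrow> (\<And>i. i < k \<Longrightarrow> \<eta> (b i s) = 0) \<Longrightarrow> e \<in> K \<Longrightarrow>
      \<eta> (\<Phi> (y s) e) = 0"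
    and test_frame_dropped: "\<zeta> \<in> fibre_dual V (y s0) \<Longrightarrow> (\<And>e. e \<in> K \<Longrightarrow> \<zeta> e = 0) \<Longrightarrow> e \<in> B \<Longrightarrow> \<zeta> e = 0"
    and test_frame_centre: "\<zeta> \<in> fibre_dual V (y s0) \<Longrightarrow> (\<And>e. e \<in> K \<Longrightarrow> \<zeta> e = 0) \<Longrightarrow> i < k \<Longrightarrow> \<zeta> (b i s0) = 0"
proof -
  note F = assms[unfolded test_frame_def]
  show "openin (Euclidean_space n) W" "s0 \<in> W" "K \<subseteq> B" using F by simp_all
  note F = F[THEN conjunct2, THEN conjunct2, THEN conjunct2]
  show "i < k \<Longrightarrow> plot (Total V) n W (b i)" using F[THEN conjunct1] by simp
  note F = F[THEN conjunct2]
  show "i < k \<Longrightarrow> s \<in> W \<Longrightarrow> Proj V (b i s) = y s" "i < k \<Longrightarrow> s \<in> W \<Longrightarrow> G (y s) (b i s) (b i s) \<noteq> 0"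
    using F[THEN conjunct1] by simp_all
  note F = F[THEN conjunct2]
  show "i < k \<Longrightarrow> j < k \<Longrightarrow> s \<in> W \<Longrightarrow> i \<noteq> j \<Longrightarrow> G (y s) (b i s) (b j s) = 0"
    using F[THEN conjunct1] by simp
  note F = F[THEN conjunct2]
  show "s \<in> W \<Longrightarrow> \<eta> \<in> fibre_dual V (y s) \<Longrightarrow> (\<And>i. i < k \<Longrightarrow> \<eta> (b i s) = 0) \<Longrightarrow> e \<in> K \<Longrightarrow>
      \<eta> (\<Phi> (y s) e) = 0"
    by (rule F[THEN conjunct1, rule_format])
  note F = F[THEN conjunct2]
  show "\<zeta> \<in> fibre_dual V (y s0) \<Longrightarrow> (\<And>e. e \<in> K \<Longrightarrow> \<zeta> e = 0) \<Longrightarrow> e \<in> B \<Longrightarrow> \<zeta> e = 0"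
    by (rule F[rule_format, THEN conjunct1, rule_format])
  show "\<zeta> \<in> fibre_dual V (y s0) \<Longrightarrow> (\<And>e. e \<in> K \<Longrightarrow> \<zeta> e = 0) \<Longrightarrow> i < k \<Longrightarrow> \<zeta> (b i s0) = 0"
    by (rule F[rule_format, THEN conjunct2, rule_format])
qed

text \<open>Isotropy of the residual is tested at \<open>s0\<close> only. If it holds there, the
  frame is kept and \<open>e\<close> stays outside \<open>K\<close>, so nothing is claimed about
  \<open>e\<close> at other points. Otherwise the residual stays non-isotropic on a smaller
  neighbourhood and joins the frame.\<close>

lemma orthogonal_frame:
  assumes y: "plot (Base V) n U y" and s0: "s0 \<in> U" and B: "finite B" "B \<subseteq> carrier (Fib V (y s0))"
    and \<Phi>_plot: "\<And>e. e \<in> carrier (Fib V (y s0)) \<Longrightarrow> plot (Total V) n U (\<lambda>u. \<Phi> (y u) e)"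
    and \<Phi>_fib: "\<And>u e. u \<in> U \<Longrightarrow> e \<in> carrier (Fib V (y s0)) \<Longrightarrow> \<Phi> (y u) e \<in> carrier (Fib V (y u))"
    and \<Phi>_id: "\<And>e. e \<in> carrier (Fib V (y s0)) \<Longrightarrow> \<Phi> (y s0) e = e"
  shows "\<exists>W k b K. W \<subseteq> U \<and> test_frame n y \<Phi> s0 B W k b K"
  using B
proof (induction B rule: finite_induct)
  case empty
  have "openin (Euclidean_space n) U" by (rule plot_openin[OF bundle_base[OF V] y])
  \<comment> \<open>A frame of length \<open>0\<close> is never evaluated, so it may be
    \<open>undefined\<close>.\<close>
  then have "test_frame n y \<Phi> s0 {} U 0 undefined {}"
    using s0 by (intro test_frameI) simp_all
  then show ?case by blast
next
  case (insert e B)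
  have e: "e \<in> carrier (Fib V (y s0))" using insert.prems by simp
  from insert.IH insert.prems obtain W k b K where W: "W \<subseteq> U" and F: "test_frame n y \<Phi> s0 B W k b K"
    by auto
  note W = test_frame_open[OF F] W and K = test_frame_subset[OF F]
    and b = test_frame_plot[OF F] test_frame_proj[OF F] test_frame_nonzero[OF F]
    and orth = test_frame_orth[OF F] and test = test_frame_test[OF F]
    and K_B = test_frame_dropped[OF F] and K_b = test_frame_centre[OF F]
  have dual_lin: "\<eta> \<in> module_hom class_ring (Fib V x) real_vs" if "\<eta> \<in> fibre_dual V x" for \<eta> x
    using that by (simp add: carrier_smooth_dual)
  have yB: "y s \<in> pts (Base V)" if "s \<in> W" for s
    using plot_in[OF bundle_base[OF V] y] W(3) that by blast
  have b_fib: "b i s \<in> carrier (Fib V (y s))" if "i < k" "s \<in> W" for i s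
    using plot_fibre[OF V b(1)[OF that(1)] that(2)] b(2)[OF that] by simp
  have \<Phi>e: "plot (Total V) n W (\<lambda>s. \<Phi> (y s) e)"
    by (rule plot_restrict[OF bundle_total[OF V] \<Phi>_plot[OF e] W(1,3)])
  have \<Phi>e_fib: "\<Phi> (y s) e \<in> carrier (Fib V (y s))" if "s \<in> W" for s
    using \<Phi>_fib[OF _ e] W(3) that by blast
  have \<Phi>e_proj: "Proj V (\<Phi> (y s) e) = y s" if "s \<in> W" for s
    using \<Phi>e_fib[OF that] by (simp add: bundle_carrier[OF V yB[OF that]])
  \<comment> \<open>Gram-Schmidt coefficients; the frame keeps the squares in the denominators
    nonzero on all of \<open>W\<close>, so they are smooth.\<close>
  define c where "c i s = - (G (y s) (\<Phi> (y s) e) (b i s) / G (y s) (b i s) (b i s))" for i s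
  have c: "C_infinity n W (c i)" if "i < k" for i
  proof -
    have "C_infinity n W (\<lambda>s. (-1) * (G (y s) (\<Phi> (y s) e) (b i s) / G (y s) (b i s) (b i s)))"
      by (intro C_infinity_mult[OF C_infinity_const] C_infinity_divide G_smooth)
        (simp_all add: \<Phi>e \<Phi>e_proj b that)
    then show ?thesis by (simp add: c_def[abs_def])
  qed
  obtain r where r: "plot (Total V) n W r" "\<And>s. s \<in> W \<Longrightarrow> Proj V (r s) = y s"
    and r_eval: "\<And>s \<eta>. s \<in> W \<Longrightarrow> \<eta> \<in> module_hom class_ring (Fib V (y s)) real_vs \<Longrightarrow>
      \<eta> (r s) = \<eta> (\<Phi> (y s) e) + (\<Sum>i<k. c i s * \<eta> (b i s))"
    using plot_lincomb[where k = k and b = b and c = c, OF \<Phi>e \<Phi>e_proj b(1,2) c] by auto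
  have r_fib: "r s \<in> carrier (Fib V (y s))" if "s \<in> W" for s
    using plot_fibre[OF V r(1) that] r(2)[OF that] by simp
  have r_orth: "G (y s) (r s) (b j s) = 0" if j: "j < k" and s: "s \<in> W" for j s
  proof -
    have "(\<Sum>i<k. c i s * G (y s) (b i s) (b j s)) = (\<Sum>i<k. if i = j then c j s * G (y s) (b j s) (b j s) else 0)"
      using orth j s by (intro sum.cong) auto
    also have "\<dots> = - G (y s) (\<Phi> (y s) e) (b j s)"
      using j b(3)[OF j s] by (simp add: c_def)
    finally show ?thesis
      using r_eval[OF s form_linear_left[OF fibre_metric[OF yB[OF s]] b_fib[OF j s]]] by simp
  qed
  have orth_r: "G (y s) (b j s) (r s) = 0" if "j < k" "s \<in> W" for j s
    using r_orth[OF that] form_sym[OF fibre_metric[OF yB[OF that(2)]] b_fib[OF that] r_fib[OF that(2)]] by simp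
  have r_dual: "\<eta> (\<Phi> (y s) e) = \<eta> (r s)"
    if "s \<in> W" "\<eta> \<in> fibre_dual V (y s)" "\<And>i. i < k \<Longrightarrow> \<eta> (b i s) = 0" for \<eta> s
    using r_eval[OF that(1) dual_lin[OF that(2)]] that(3) by simp
  show ?case
  proof (cases "G (y s0) (r s0) (r s0) = 0")
    case True
    have "\<zeta> e' = 0" if \<zeta>: "\<zeta> \<in> fibre_dual V (y s0)" "\<And>e. e \<in> K \<Longrightarrow> \<zeta> e = 0" and e': "e' \<in> insert e B" for \<zeta> e'
    proof (cases "e' = e")
      case e_new: True
      \<comment> \<open>A smooth functional at the centre is pairing with some \<open>w\<close>, and
        an isotropic vector is orthogonal to every \<open>w\<close>. So \<open>\<zeta>\<close> kills
        the residual, and as it also kills the frame there, it kills \<open>e\<close>.\<close>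
      obtain w where w: "w \<in> carrier (Fib V (y s0))" "\<zeta> = (\<lambda>u\<in>carrier (Fib V (y s0)). G (y s0) w u)"
        using fibre_pairing_surj[OF yB[OF W(2)] \<zeta>(1)] by blast
      have "\<zeta> e = \<zeta> (r s0)"
        using r_dual[OF W(2) \<zeta>(1) K_b[OF \<zeta>]] \<Phi>_id[OF e] by simp
      also have "\<dots> = G (y s0) (r s0) w"
        using w r_fib[OF W(2)] form_sym[OF fibre_metric[OF yB[OF W(2)]] w(1) r_fib[OF W(2)]] by simp
      also have "\<dots> = 0"
        by (rule form_isotropic[OF bundle_vs[OF V yB[OF W(2)]] fibre_metric[OF yB[OF W(2)]] r_fib[OF W(2)] True w(1)])
      finally show ?thesis using e_new by simp
    qed (use K_B[OF \<zeta>] e' in blast)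
    note dropped = this
    have "test_frame n y \<Phi> s0 (insert e B) W k b K"
    proof (rule test_frameI)
      show "K \<subseteq> insert e B" using K by blast
    qed (fact W(1,2) b orth test dropped K_b)+
    then show ?thesis using W(3) by blast
  next
    case False
    \<comment> \<open>By continuity the square of the residual stays nonzero near \<open>s0\<close>,
      so this smaller domain is open.\<close>
    define W' where "W' = {s \<in> W. G (y s) (r s) (r s) \<noteq> 0}"
    define b' where "b' i = (if i < k then b i else r)" for i
    have "continuous_on W (\<lambda>s. G (y s) (r s) (r s))"
      by (rule C_infinity_continuous[OF G_smooth[OF r(1) r(1)]]) (simp_all add: r(2))
    then have "openin (top_of_set W) (W \<inter> (\<lambda>s. G (y s) (r s) (r s)) -` (- {0}))"
      by (rule continuous_openin_preimage_gen) (rule open_Compl[OF closed_singleton])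
    moreover have "W \<inter> (\<lambda>s. G (y s) (r s) (r s)) -` (- {0}) = W'" by (auto simp: W'_def)
    ultimately have W': "openin (Euclidean_space n) W'"
      using openin_trans[OF _ W(1)[unfolded Euclidean_space_top_of_set], of W']
      by (simp add: Euclidean_space_top_of_set)
    have W'_W: "W' \<subseteq> W" by (auto simp: W'_def)
    have b'_plot: "plot (Total V) n W' (b' i)" if "i < Suc k" for i
      using plot_restrict[OF bundle_total[OF V] _ W' W'_W] b(1) r(1) that by (simp add: b'_def)
    have b'_metric: "Proj V (b' i s) = y s" "G (y s) (b' i s) (b' i s) \<noteq> 0" if "i < Suc k" "s \<in> W'" for i s
      using that b(2,3) r(2) by (auto simp: b'_def W'_def)
    have b'_orth: "G (y s) (b' i s) (b' j s) = 0" if "i < Suc k" "j < Suc k" "s \<in> W'" "i \<noteq> j" for i j s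
      using that orth r_orth orth_r by (auto simp: b'_def W'_def)
    have b'_test: "\<eta> (\<Phi> (y s) e') = 0"
      if s: "s \<in> W'" and \<eta>: "\<eta> \<in> fibre_dual V (y s)" "\<And>i. i < Suc k \<Longrightarrow> \<eta> (b' i s) = 0"
        and e': "e' \<in> insert e K" for s \<eta> e'
    proof -
      have sW: "s \<in> W" using s W'_W by blast
      have \<eta>b: "\<eta> (b i s) = 0" if "i < k" for i using \<eta>(2)[of i] that by (simp add: b'_def)
      show ?thesis
        using e' test[OF sW \<eta>(1) \<eta>b] r_dual[OF sW \<eta>(1) \<eta>b] \<eta>(2)[of k] by (auto simp: b'_def)
    qed
    have K_B': "\<zeta> e' = 0"
      if "\<zeta> \<in> fibre_dual V (y s0)" "\<And>e'. e' \<in> insert e K \<Longrightarrow> \<zeta> e' = 0" "e' \<in> insert e B" for \<zeta> e'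
      using that K_B[OF that(1)] by auto
    have K_b': "\<zeta> (b' i s0) = 0"
      if \<zeta>: "\<zeta> \<in> fibre_dual V (y s0)" "\<And>e'. e' \<in> insert e K \<Longrightarrow> \<zeta> e' = 0" and i: "i < Suc k" for \<zeta> i
    proof (cases "i < k")
      case False
      \<comment> \<open>The residual at the centre is \<open>e\<close> plus a combination of earlier
        frame vectors, all of which \<open>\<zeta>\<close> kills.\<close>
      have "\<zeta> (b j s0) = 0" if "j < k" for j using K_b[OF \<zeta>(1) _ that] \<zeta>(2) by blast
      from r_dual[OF W(2) \<zeta>(1) this] show ?thesis
        using False \<Phi>_id[OF e] \<zeta>(2)[of e] by (simp add: b'_def)
    qed (use K_b[OF \<zeta>(1)] \<zeta>(2) in \<open>auto simp: b'_def\<close>)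
    have "test_frame n y \<Phi> s0 (insert e B) W' (Suc k) b' (insert e K)"
    proof (rule test_frameI)
      show "s0 \<in> W'" using W(2) False by (simp add: W'_def)
      show "insert e K \<subseteq> insert e B" using K by blast
    qed (fact W' b'_plot b'_metric b'_orth b'_test K_B' K_b')+
    then show ?thesis using W'_W W(3) by blast
  qed
qed

text \<open>The lift is the orthogonal expansion of \<open>q\<close> in the frame. Its pairing
  agrees with \<open>q\<close> on the frame, and a smooth functional that vanishes on the frame at a
  point of \<open>W\<close> vanishes on the whole fibre.\<close>

lemma metric_pairing_local_lift:
  assumes q: "plot (Total (dual_bundle V)) n U q" and s0: "s0 \<in> U"
  shows "\<exists>W v. openin (Euclidean_space n) W \<and> s0 \<in> W \<and> W \<subseteq> U \<and> plot (Total V) n W v \<and>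
    (\<forall>s\<in>W. metric_pairing V g (v s) = q s)"
proof -
  note BT = bundle_base[OF V] bundle_total[OF V]
  define y where "y s = fst (q s)" for s
  note q_iff = q[unfolded dual_plot_iff[OF BT(2)], folded y_def]
  have y: "plot (Base V) n U y" using q_iff by blast
  have U: "openin (Euclidean_space n) U" by (rule plot_openin[OF BT(1) y])
  have qd: "y s \<in> pts (Base V)" "snd (q s) \<in> fibre_dual V (y s)" if "s \<in> U" for s
    using q_iff that by (auto simp: dual_points_def y_def image_subset_iff)
  let ?E = "Fib V (y s0)"
  obtain A \<Phi> where A: "D_open (Base V) A" "y s0 \<in> A"
    and \<Phi>_plot: "\<And>n U y' e. plot (Base V) n U y' \<Longrightarrow> y' ` U \<subseteq> A \<Longrightarrow> e \<in> carrier ?E \<Longrightarrow>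
      plot (Total V) n U (\<lambda>u. \<Phi> (y' u) e)"
    and \<Phi>_surj: "\<And>a. a \<in> A \<Longrightarrow> \<Phi> a ` carrier ?E = carrier (Fib V a)"
    and \<Phi>_id: "\<And>e. e \<in> carrier ?E \<Longrightarrow> \<Phi> (y s0) e = e"
    and \<Phi>_pull: "\<And>a \<eta>. a \<in> A \<Longrightarrow> \<eta> \<in> fibre_dual V a \<Longrightarrow> (\<lambda>e\<in>carrier ?E. \<eta> (\<Phi> a e)) \<in> fibre_dual V (y s0)"
  proof (rule normalised_trivialisation[OF V triv qd(1)[OF s0]])
    fix A \<Phi>
    assume "D_open (Base V) A" "y s0 \<in> A"
      "\<And>n U y' e. plot (Base V) n U y' \<Longrightarrow> y' ` U \<subseteq> A \<Longrightarrow> e \<in> carrier ?E \<Longrightarrow>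
        plot (Total V) n U (\<lambda>u. \<Phi> (y' u) e)"
      "\<And>a. a \<in> A \<Longrightarrow> \<Phi> a ` carrier ?E = carrier (Fib V a)"
      "\<And>e. e \<in> carrier ?E \<Longrightarrow> \<Phi> (y s0) e = e"
      "\<And>a \<eta>. a \<in> A \<Longrightarrow> \<eta> \<in> fibre_dual V a \<Longrightarrow> (\<lambda>e\<in>carrier ?E. \<eta> (\<Phi> a e)) \<in> fibre_dual V (y s0)"
    then show thesis by (rule that)
  qed
  \<comment> \<open>D-openness of the trivialising set makes its preimage under the plot of base
    points open.\<close>
  define U' where "U' = {s \<in> U. y s \<in> A}"
  have U': "openin (Euclidean_space n) U'" "U' \<subseteq> U" "s0 \<in> U'" "y ` U' \<subseteq> A"
    using A y s0 unfolding D_open_def U'_def by auto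
  have y': "plot (Base V) n U' y" by (rule plot_restrict[OF BT(1) y U'(1,2)])
  have "vectorspace.fin_dim class_ring ?E"
    using fin qd(1)[OF s0] by (simp add: finite_dim_fibres_def)
  then obtain B where B: "finite B" "B \<subseteq> carrier ?E" "module.span class_ring ?E B = carrier ?E"
    unfolding vectorspace.fin_dim_def[OF bundle_vs[OF V qd(1)[OF s0]]] by blast
  have \<Phi>_in: "\<Phi> (y u) e \<in> carrier (Fib V (y u))" if "u \<in> U'" "e \<in> carrier ?E" for u e
    using \<Phi>_surj[of "y u"] U'(4) that by blast
  obtain W k b K where W: "W \<subseteq> U'" and F: "test_frame n y \<Phi> s0 B W k b K"
    using orthogonal_frame[OF y' U'(3) B(1,2) \<Phi>_plot[OF y' U'(4)] \<Phi>_in \<Phi>_id] by blast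
  note W = test_frame_open[OF F] W and K = test_frame_subset[OF F]
    and b = test_frame_plot[OF F] test_frame_proj[OF F] test_frame_nonzero[OF F]
    and orth = test_frame_orth[OF F] and test = test_frame_test[OF F] and K_B = test_frame_dropped[OF F]
  have WU: "W \<subseteq> U" using W(3) U'(2) by blast
  \<comment> \<open>The functional is pulled back to the central fibre. There it vanishes on
    \<open>K\<close>, hence on the dropped vectors too, hence on everything spanned by
    \<open>B\<close>; surjectivity of \<open>\<Phi> (y s)\<close> carries this back to the fibre
    over \<open>y s\<close>.\<close>
  have vanish: "\<eta> w = 0"
    if s: "s \<in> W" and \<eta>: "\<eta> \<in> fibre_dual V (y s)" "\<And>i. i < k \<Longrightarrow> \<eta> (b i s) = 0"
      and w: "w \<in> carrier (Fib V (y s))" for s \<eta> w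
  proof -
    have ys: "y s \<in> A" using s W(3) U'(4) by blast
    define \<zeta> where "\<zeta> = (\<lambda>e\<in>carrier ?E. \<eta> (\<Phi> (y s) e))"
    have \<zeta>: "\<zeta> \<in> fibre_dual V (y s0)" unfolding \<zeta>_def by (rule \<Phi>_pull[OF ys \<eta>(1)])
    have \<zeta>K: "\<zeta> e = 0" if "e \<in> K" for e
      using test[OF s \<eta> that] that K B(2) by (auto simp: \<zeta>_def)
    have zero: "(\<lambda>_. 0) \<in> module_hom class_ring ?E real_vs" by (simp add: module_hom_real_vs)
    have \<zeta>0: "\<zeta> e = 0" if "e \<in> carrier ?E" for e
      by (rule linear_functionals_eq_on_span[OF bundle_vs[OF V qd(1)[OF s0]] B(2,3) _ zero K_B[OF \<zeta> \<zeta>K] that])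
        (use \<zeta> in \<open>simp_all add: carrier_smooth_dual\<close>)
    obtain e where "e \<in> carrier ?E" "w = \<Phi> (y s) e" using w \<Phi>_surj[OF ys] by blast
    then show ?thesis using \<zeta>0[of e] by (simp add: \<zeta>_def)
  qed
  \<comment> \<open>The coefficients of the orthogonal expansion: pairing the combination with
    \<open>b j\<close> must return the value of \<open>q s\<close> at \<open>b j s\<close>.\<close>
  define c where "c i s = snd (q s) (b i s) / G (y s) (b i s) (b i s)" for i s
  have c: "C_infinity n W (c i)" if i: "i < k" for i
    unfolding c_def
    by (intro C_infinity_divide G_smooth[OF b(1)[OF i] b(1)[OF i]]
        dual_plot_eval[OF BT(2) dual_plot_restrict[OF BT q W(1) WU] b(1)[OF i]])
      (use b i in \<open>simp_all add: y_def\<close>)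
  \<comment> \<open>The combination starts from the zero section; for an empty frame this section is
    itself the lift, up to what functionals can see.\<close>
  have z: "plot (Total V) n W (\<lambda>s. \<zero>\<^bsub>Fib V (y s)\<^esub>)"
    by (rule bundle_plot_zero[OF V plot_restrict[OF BT(1) y W(1) WU]])
  have z_proj: "Proj V \<zero>\<^bsub>Fib V (y s)\<^esub> = y s" if "s \<in> W" for s
    using vs_zero[OF bundle_vs[OF V qd(1)]] bundle_carrier[OF V qd(1)] WU that by blast
  obtain v where v: "plot (Total V) n W v" "\<And>s. s \<in> W \<Longrightarrow> Proj V (v s) = y s"
    and v_eval: "\<And>s \<eta>. s \<in> W \<Longrightarrow> \<eta> \<in> module_hom class_ring (Fib V (y s)) real_vs \<Longrightarrow>
      \<eta> (v s) = \<eta> \<zero>\<^bsub>Fib V (y s)\<^esub> + (\<Sum>i<k. c i s * \<eta> (b i s))"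
    using plot_lincomb[where k = k and b = b and c = c, OF z z_proj b(1,2) c] by auto
  have "metric_pairing V g (v s) = q s" if s: "s \<in> W" for s
  proof -
    have ys: "y s \<in> pts (Base V)" and qs: "snd (q s) \<in> fibre_dual V (y s)" using qd WU s by blast+
    have vs: "v s \<in> carrier (Fib V (y s))" using plot_fibre[OF V v(1) s] v(2)[OF s] by simp
    have b_fib: "b i s \<in> carrier (Fib V (y s))" if "i < k" for i
      using plot_fibre[OF V b(1)[OF that] s] b(2)[OF that s] by simp
    note E = bundle_vs[OF V ys] and D = diffeological_fibre_space[OF V, of "y s"] pts_fibre_space[OF V ys]
    \<comment> \<open>The defect \<open>q s - \<Psi> (v s)\<close> is itself a smooth functional, so
      \<open>vanish\<close> applies once it is zero on the frame.\<close>
    define \<eta> where "\<eta> = (\<lambda>w\<in>carrier (Fib V (y s)). snd (q s) w + (-1) * (\<lambda>w\<in>carrier (Fib V (y s)). G (y s) (v s) w) w)"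
    have \<eta>: "\<eta> \<in> fibre_dual V (y s)"
      unfolding \<eta>_def by (rule smooth_dual_add[OF E D qs pairing_smooth_dual[OF E D fibre_metric[OF ys] vs]])
    have "\<eta> (b j s) = 0" if j: "j < k" for j
    proof -
      have lin: "(\<lambda>u. G (y s) u (b j s)) \<in> module_hom class_ring (Fib V (y s)) real_vs"
        by (rule form_linear_left[OF fibre_metric[OF ys] b_fib[OF j]])
      have "G (y s) (v s) (b j s) = (\<Sum>i<k. c i s * G (y s) (b i s) (b j s))"
        using v_eval[OF s lin] linear_functional_zero[OF E lin] by simp
      also have "\<dots> = (\<Sum>i<k. if i = j then c j s * G (y s) (b j s) (b j s) else 0)"
        using orth j s by (intro sum.cong) auto
      also have "\<dots> = snd (q s) (b j s)" using j b(3)[OF j s] by (simp add: c_def)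
      finally show ?thesis using b_fib[OF j] by (simp add: \<eta>_def)
    qed
    from vanish[OF s \<eta> this] have eq: "snd (q s) w = G (y s) (v s) w" if "w \<in> carrier (Fib V (y s))" for w
      using that by (simp add: \<eta>_def)
    have "snd (q s) = (\<lambda>w\<in>carrier (Fib V (y s)). G (y s) (v s) w)"
      by (rule extensionalityI[of _ "carrier (Fib V (y s))"]) (use qs eq in \<open>simp_all add: carrier_smooth_dual\<close>)
    then show ?thesis
      unfolding metric_pairing_def v(2)[OF s] by (simp add: y_def prod_eq_iff)
  qed
  then show ?thesis using W(1,2) WU v(1) by blast
qed

end

section \<open>The pairing and the induced metric on the dual\<close>

context metric_bundle
begin

lemma metric_pairing_eq:
  assumes "x \<in> pts (Base V)" "v \<in> carrier (Fib V x)"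
  shows "metric_pairing V g v = (x, \<lambda>w\<in>carrier (Fib V x). G x v w)"
  using assms by (simp add: metric_pairing_def bundle_carrier[OF V])

lemma metric_pairing_onto:
  assumes "\<xi> \<in> dual_points V"
  obtains v where "v \<in> carrier (Fib V (fst \<xi>))" "metric_pairing V g v = \<xi>"
proof -
  have x: "fst \<xi> \<in> pts (Base V)" "snd \<xi> \<in> fibre_dual V (fst \<xi>)"
    using assms by (auto simp: dual_points_def)
  obtain v where v: "v \<in> carrier (Fib V (fst \<xi>))" "snd \<xi> = (\<lambda>w\<in>carrier (Fib V (fst \<xi>)). G (fst \<xi>) v w)"
    using fibre_pairing_surj[OF x] by blast
  show thesis
    by (rule that[OF v(1)]) (simp add: metric_pairing_eq[OF x(1) v(1)] prod_eq_iff flip: v(2))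
qed

lemma metric_pairing_in:
  assumes "x \<in> pts (Base V)" "v \<in> carrier (Fib V x)"
  shows "metric_pairing V g v \<in> dual_points V"
  using pairing_smooth_dual[OF bundle_vs[OF V assms(1)] diffeological_fibre_space[OF V]
      pts_fibre_space[OF V assms(1)] fibre_metric[OF assms(1)] assms(2)] assms
  by (simp add: metric_pairing_eq[OF assms] dual_points_def)

lemma metric_pairing_eqD:
  assumes "x \<in> pts (Base V)" "v \<in> carrier (Fib V x)" "v' \<in> carrier (Fib V x)" "w \<in> carrier (Fib V x)"
    and "metric_pairing V g v = metric_pairing V g v'"
  shows "G x v w = G x v' w"
  using assms(5,4) unfolding metric_pairing_eq[OF assms(1,2)] metric_pairing_eq[OF assms(1,3)]
  by (metis prod.inject restrict_apply')

text \<open>Removes the definite description in \<open>dual_metric\<close>. The form depends on each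
  argument only through its pairing: the first argument is exchanged directly, the second after an
  application of symmetry.\<close>

lemma dual_metric_pairing:
  assumes x: "x \<in> pts (Base V)" and v: "v \<in> carrier (Fib V x)" and w: "w \<in> carrier (Fib V x)"
  shows "dual_metric V g x (metric_pairing V g v) (metric_pairing V g w) = G x v w"
  unfolding dual_metric_def
proof (rule the_equality)
  show "\<exists>v'\<in>carrier (Fib V x). \<exists>w'\<in>carrier (Fib V x). metric_pairing V g v' = metric_pairing V g v \<and>
      metric_pairing V g w' = metric_pairing V g w \<and> G x v w = G x v' w'"
    using v w by blast
  fix r
  assume "\<exists>v'\<in>carrier (Fib V x). \<exists>w'\<in>carrier (Fib V x). metric_pairing V g v' = metric_pairing V g v \<and>
      metric_pairing V g w' = metric_pairing V g w \<and> r = G x v' w'"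
  then obtain v' w' where v': "v' \<in> carrier (Fib V x)" "metric_pairing V g v' = metric_pairing V g v"
    and w': "w' \<in> carrier (Fib V x)" "metric_pairing V g w' = metric_pairing V g w" and r: "r = G x v' w'"
    by blast
  note sym = form_sym[OF fibre_metric[OF x]]
  have "G x v' w' = G x v w'" by (rule metric_pairing_eqD[OF x v'(1) v w'(1) v'(2)])
  also have "\<dots> = G x w' v" by (rule sym[OF v w'(1)])
  also have "\<dots> = G x w v" by (rule metric_pairing_eqD[OF x w'(1) w v w'(2)])
  also have "\<dots> = G x v w" by (rule sym[OF w v])
  finally show "r = G x v w" using r by simp
qed

end


section \<open>Gluing\<close>

text \<open>Separated from the diffeological part because the gluing of the duals is handled with
  the point-set facts and the description of plots alone.\<close>

locale glue_data =
  fixes Z1 :: "'a dspace" and Z2 :: "'b dspace" and Y :: "'a set" and h :: "'a \<Rightarrow> 'b"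
  assumes Y_pts: "Y \<subseteq> pts Z1" and h_pts: "\<And>z. z \<in> Y \<Longrightarrow> h z \<in> pts Z2"
begin

abbreviation in1 :: "'a \<Rightarrow> ('a + 'b) set" where "in1 \<equiv> glue_in1 Z1 Z2 Y h"
abbreviation in2 :: "'b \<Rightarrow> ('a + 'b) set" where "in2 \<equiv> glue_in2 Z1 Z2 Y h"
abbreviation glued :: "('a + 'b) set dspace" where "glued \<equiv> glue_space Z1 Z2 Y h"

text \<open>A canonical representative. One application of \<open>h\<close> suffices, since its
  values lie in the second part, which is left untouched. It turns the equivalence closure in
  \<open>glue_rel\<close> into an equality test, also when \<open>h\<close> is not
  injective.\<close>

definition normal_form :: "'a + 'b \<Rightarrow> 'a + 'b" where
  "normal_form c = (case c of Inl z \<Rightarrow> if z \<in> Y then Inr (h z) else Inl z | Inr w \<Rightarrow> Inr w)"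

lemma normal_form_simps [simp]:
  "normal_form (Inl z) = (if z \<in> Y then Inr (h z) else Inl z)"
  "normal_form (Inr w) = Inr w"
  by (simp_all add: normal_form_def)

lemma glue_rel_normal_form:
  "glue_rel Z1 Z2 Y h = {(a, b). a \<in> pts Z1 <+> pts Z2 \<and> b \<in> pts Z1 <+> pts Z2 \<and> normal_form a = normal_form b}"
proof -
  define R :: "(('a + 'b) \<times> ('a + 'b)) set" where "R = {(Inl z, Inr (h z)) | z. z \<in> Y}"
  have "normal_form a = normal_form b" if "(a, b) \<in> (R \<union> R\<inverse>)\<^sup>*" for a b
    using that by induction (auto simp: R_def)
  moreover have nf: "(a, normal_form a) \<in> (R \<union> R\<inverse>)\<^sup>*" for a
    by (cases a) (auto simp: R_def intro!: r_into_rtrancl)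
  moreover have "(a, b) \<in> (R \<union> R\<inverse>)\<^sup>*" if "normal_form a = normal_form b" for a b
  proof -
    have "sym ((R \<union> R\<inverse>)\<^sup>*)" by (intro sym_rtrancl sym_Un_converse)
    then have "(normal_form b, b) \<in> (R \<union> R\<inverse>)\<^sup>*" using nf[of b] by (rule symD)
    then show ?thesis using nf[of a] that by (metis rtrancl_trans)
  qed
  ultimately show ?thesis
    unfolding glue_rel_def Let_def R_def[symmetric] by blast
qed

lemma glue_class_eq_iff:
  assumes "a \<in> pts Z1 <+> pts Z2" "b \<in> pts Z1 <+> pts Z2"
  shows "glue_rel Z1 Z2 Y h `` {a} = glue_rel Z1 Z2 Y h `` {b} \<longleftrightarrow> normal_form a = normal_form b"
proof
  assume "glue_rel Z1 Z2 Y h `` {a} = glue_rel Z1 Z2 Y h `` {b}"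
  moreover have "b \<in> glue_rel Z1 Z2 Y h `` {b}" using assms(2) by (simp add: glue_rel_normal_form)
  ultimately have "b \<in> glue_rel Z1 Z2 Y h `` {a}" by simp
  then show "normal_form a = normal_form b" by (simp add: glue_rel_normal_form)
next
  assume "normal_form a = normal_form b"
  then show "glue_rel Z1 Z2 Y h `` {a} = glue_rel Z1 Z2 Y h `` {b}"
    using assms by (auto simp: glue_rel_normal_form)
qed

lemma in1_eq_in1_iff:
  "z \<in> pts Z1 \<Longrightarrow> z' \<in> pts Z1 \<Longrightarrow> in1 z = in1 z' \<longleftrightarrow> z = z' \<or> z \<in> Y \<and> z' \<in> Y \<and> h z = h z'"
  unfolding glue_in1_def by (subst glue_class_eq_iff) auto

lemma in2_eq_in2_iff: "w \<in> pts Z2 \<Longrightarrow> w' \<in> pts Z2 \<Longrightarrow> in2 w = in2 w' \<longleftrightarrow> w = w'"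
  unfolding glue_in2_def by (subst glue_class_eq_iff) auto

lemma in1_eq_in2_iff: "z \<in> pts Z1 \<Longrightarrow> w \<in> pts Z2 \<Longrightarrow> in1 z = in2 w \<longleftrightarrow> z \<in> Y \<and> h z = w"
  unfolding glue_in1_def glue_in2_def by (subst glue_class_eq_iff) auto

lemma in1_in2: "z \<in> Y \<Longrightarrow> in1 z = in2 (h z)"
  using in1_eq_in2_iff[of z "h z"] Y_pts h_pts by blast

lemma pts_glued: "pts glued = in1 ` (pts Z1 - Y) \<union> in2 ` pts Z2"
proof -
  have "pts glued = in1 ` pts Z1 \<union> in2 ` pts Z2"
    by (auto simp: glue_space_def quotient_space_def sum_space_def quotient_def glue_in1_def glue_in2_def)
  also have "\<dots> = in1 ` (pts Z1 - Y) \<union> in2 ` pts Z2"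
    using in1_in2 h_pts by blast
  finally show ?thesis .
qed

lemma in1_pts: "z \<in> pts Z1 \<Longrightarrow> in1 z \<in> pts glued"
  unfolding pts_glued using in1_in2 h_pts by blast

lemma in2_pts: "w \<in> pts Z2 \<Longrightarrow> in2 w \<in> pts glued"
  unfolding pts_glued by blast

lemma glue_case_in2: "w \<in> pts Z2 \<Longrightarrow> glue_case Z1 Z2 Y h F1 F2 (in2 w) = F2 w"
  unfolding glue_case_def by (simp add: the_inv_into_f_f inj_on_def in2_eq_in2_iff)

lemma glue_case_in1:
  assumes z: "z \<in> pts Z1" "z \<notin> Y"
  shows "glue_case Z1 Z2 Y h F1 F2 (in1 z) = F1 z"
proof -
  have "in1 z \<notin> in2 ` pts Z2" using in1_eq_in2_iff[OF z(1)] z(2) by blast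
  moreover have "inj_on in1 (pts Z1 - Y)" using in1_eq_in1_iff by (auto intro!: inj_onI)
  ultimately show ?thesis
    unfolding glue_case_def using z by (simp add: the_inv_into_f_f)
qed

text \<open>Quotient and sum each ask for a local lift, and the two shrinkings combine into one.
  Only openness of plot domains is assumed, so that the lemma also serves the dual spaces.\<close>

lemma plot_glued_iff:
  assumes "\<And>n U p. plot Z1 n U p \<Longrightarrow> openin (Euclidean_space n) U"
    and "\<And>n U p. plot Z2 n U p \<Longrightarrow> openin (Euclidean_space n) U"
  shows "plot glued n U p \<longleftrightarrow> openin (Euclidean_space n) U \<and> (\<forall>u\<in>U. \<exists>W. u \<in> W \<and> W \<subseteq> U \<and>
    ((\<exists>q. plot Z1 n W q \<and> (\<forall>w\<in>W. p w = in1 (q w))) \<or> (\<exists>q. plot Z2 n W q \<and> (\<forall>w\<in>W. p w = in2 (q w)))))"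
    (is "?L \<longleftrightarrow> _ \<and> (\<forall>u\<in>U. ?R u)")
proof
  assume L: ?L
  then have U: "openin (Euclidean_space n) U"
    by (simp add: glue_space_def quotient_space_def)
  have "?R u" if u: "u \<in> U" for u
  proof -
    from L u obtain W q where W: "u \<in> W" "W \<subseteq> U" "plot (sum_space Z1 Z2) n W q"
      "\<forall>w\<in>W. p w = glue_rel Z1 Z2 Y h `` {q w}"
      unfolding glue_space_def quotient_space_def dspace.simps by blast
    from W(1,3) obtain W' where W': "u \<in> W'" "W' \<subseteq> W"
      "(\<exists>q'. plot Z1 n W' q' \<and> (\<forall>w\<in>W'. q w = Inl (q' w))) \<or> (\<exists>q'. plot Z2 n W' q' \<and> (\<forall>w\<in>W'. q w = Inr (q' w)))"
      unfolding sum_space_def dspace.simps by blast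
    have pW: "p w = glue_rel Z1 Z2 Y h `` {q w}" if "w \<in> W'" for w using W(4) W'(2) that by blast
    show ?thesis
    proof (intro exI conjI)
      show "(\<exists>q. plot Z1 n W' q \<and> (\<forall>w\<in>W'. p w = in1 (q w))) \<or> (\<exists>q. plot Z2 n W' q \<and> (\<forall>w\<in>W'. p w = in2 (q w)))"
        using W'(3)
      proof (elim disjE exE conjE)
        fix q' assume "plot Z1 n W' q'" "\<forall>w\<in>W'. q w = Inl (q' w)"
        then show ?thesis by (intro disjI1 exI[of _ q']) (simp add: pW glue_in1_def)
      next
        fix q' assume "plot Z2 n W' q'" "\<forall>w\<in>W'. q w = Inr (q' w)"
        then show ?thesis by (intro disjI2 exI[of _ q']) (simp add: pW glue_in2_def)
      qed
    qed (use W W' in blast)+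
  qed
  with U show "openin (Euclidean_space n) U \<and> (\<forall>u\<in>U. ?R u)" by blast
next
  assume R: "openin (Euclidean_space n) U \<and> (\<forall>u\<in>U. ?R u)"
  have "\<exists>W q. u \<in> W \<and> W \<subseteq> U \<and> plot (sum_space Z1 Z2) n W q \<and> (\<forall>w\<in>W. p w = glue_rel Z1 Z2 Y h `` {q w})"
    if u: "u \<in> U" for u
  proof -
    have "?R u" using R u by blast
    then show ?thesis
    proof (elim exE conjE disjE)
      fix W q assume W: "u \<in> W" "W \<subseteq> U" and q: "plot Z1 n W q" "\<forall>w\<in>W. p w = in1 (q w)"
      have "plot (sum_space Z1 Z2) n W (\<lambda>w. Inl (q w))"
        using q(1) assms(1)[OF q(1)] by (auto simp: sum_space_def)
      then show ?thesis using W q(2) unfolding glue_in1_def by blast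
    next
      fix W q assume W: "u \<in> W" "W \<subseteq> U" and q: "plot Z2 n W q" "\<forall>w\<in>W. p w = in2 (q w)"
      have "plot (sum_space Z1 Z2) n W (\<lambda>w. Inr (q w))"
        using q(1) assms(2)[OF q(1)] by (auto simp: sum_space_def)
      then show ?thesis using W q(2) unfolding glue_in2_def by blast
    qed
  qed
  with R show ?L
    unfolding glue_space_def quotient_space_def dspace.simps by blast
qed

end

section \<open>The diffeology of a glued space\<close>

locale diffeological_glue_data = glue_data Z1 Z2 Y h
  for Z1 :: "'a dspace" and Z2 :: "'b dspace" and Y and h +
  assumes Z1: "diffeological_space Z1" and Z2: "diffeological_space Z2"
begin

lemma plot_glued:
  "plot glued n U p \<longleftrightarrow> openin (Euclidean_space n) U \<and> (\<forall>u\<in>U. \<exists>W. u \<in> W \<and> W \<subseteq> U \<and>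
    ((\<exists>q. plot Z1 n W q \<and> (\<forall>w\<in>W. p w = in1 (q w))) \<or> (\<exists>q. plot Z2 n W q \<and> (\<forall>w\<in>W. p w = in2 (q w)))))"
  by (rule plot_glued_iff) (erule plot_openin[OF Z1] plot_openin[OF Z2])+

lemma plot_in1: "plot Z1 n U q \<Longrightarrow> plot glued n U (\<lambda>u. in1 (q u))"
  unfolding plot_glued
  by (intro conjI ballI exI[of _ U] disjI1 exI[of _ q]) (auto intro: plot_openin[OF Z1])

lemma plot_in2: "plot Z2 n U q \<Longrightarrow> plot glued n U (\<lambda>u. in2 (q u))"
  unfolding plot_glued
  by (intro conjI ballI exI[of _ U] disjI2 exI[of _ q]) (auto intro: plot_openin[OF Z2])

lemma plot_glued_cases:
  assumes "plot glued n U p" "u \<in> U"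
  obtains (in1) W q where "u \<in> W" "W \<subseteq> U" "plot Z1 n W q" "\<And>w. w \<in> W \<Longrightarrow> p w = in1 (q w)"
  | (in2) W q where "u \<in> W" "W \<subseteq> U" "plot Z2 n W q" "\<And>w. w \<in> W \<Longrightarrow> p w = in2 (q w)"
proof -
  have "\<exists>W. u \<in> W \<and> W \<subseteq> U \<and>
    ((\<exists>q. plot Z1 n W q \<and> (\<forall>w\<in>W. p w = in1 (q w))) \<or> (\<exists>q. plot Z2 n W q \<and> (\<forall>w\<in>W. p w = in2 (q w))))"
    using assms unfolding plot_glued by blast
  then show thesis
  proof (elim exE conjE disjE)
    fix W q assume "u \<in> W" "W \<subseteq> U" "plot Z1 n W q" "\<forall>w\<in>W. p w = in1 (q w)"
    then show thesis by (intro in1[of W q]) simp_all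
  next
    fix W q assume "u \<in> W" "W \<subseteq> U" "plot Z2 n W q" "\<forall>w\<in>W. p w = in2 (q w)"
    then show thesis by (intro in2[of W q]) simp_all
  qed
qed

lemma plot_glued_openin: "plot glued n U p \<Longrightarrow> openin (Euclidean_space n) U"
  unfolding plot_glued by blast

lemma diffeological_glued: "diffeological_space glued"
proof (rule diffeological_spaceI)
  show "openin (Euclidean_space n) U" if "plot glued n U p" for n U p
    using that by (rule plot_glued_openin)
  show "p u \<in> pts glued" if "plot glued n U p" "u \<in> U" for n U p u
    using that
    by (cases rule: plot_glued_cases) (simp_all add: in1_pts in2_pts plot_in[OF Z1] plot_in[OF Z2])
  show "plot glued n U (\<lambda>_. x)" if U: "openin (Euclidean_space n) U" and "x \<in> pts glued" for n U x
    using that(2) plot_in1[OF plot_const[OF Z1 U]] plot_in2[OF plot_const[OF Z2 U]]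
    unfolding pts_glued by blast
next
  fix n U p
  assume U: "openin (Euclidean_space n) U"
    and loc: "\<And>u. u \<in> U \<Longrightarrow> \<exists>W q. u \<in> W \<and> W \<subseteq> U \<and> plot glued n W q \<and> (\<forall>w\<in>W. p w = q w)"
  show "plot glued n U p"
    unfolding plot_glued
  proof (intro conjI ballI)
    fix u assume "u \<in> U"
    from loc[OF this] obtain W q where W: "u \<in> W" "W \<subseteq> U" "plot glued n W q" "\<forall>w\<in>W. p w = q w"
      by (elim exE conjE)
    from W(3,1) show "\<exists>W. u \<in> W \<and> W \<subseteq> U \<and> ((\<exists>q. plot Z1 n W q \<and> (\<forall>w\<in>W. p w = in1 (q w))) \<or>
        (\<exists>q. plot Z2 n W q \<and> (\<forall>w\<in>W. p w = in2 (q w))))"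
    proof (cases rule: plot_glued_cases)
      case (in1 W' q')
      then show ?thesis using W(2,4) by (intro exI[of _ W'] conjI disjI1 exI[of _ q']) auto
    next
      case (in2 W' q')
      then show ?thesis using W(2,4) by (intro exI[of _ W'] conjI disjI2 exI[of _ q']) auto
    qed
  qed (fact U)
next
  fix n U p m S F
  assume p: "plot glued n U p" and F: "plot (euclid n) m S F" "F ` S \<subseteq> U"
  show "plot glued m S (\<lambda>s. p (F s))"
    unfolding plot_glued
  proof (intro conjI ballI)
    show "openin (Euclidean_space m) S" by (rule euclid_plot_openin[OF F(1)])
    fix s assume s: "s \<in> S"
    have FS: "plot (euclid n) m {s \<in> S. F s \<in> W} F" "F ` {s \<in> S. F s \<in> W} \<subseteq> W"
      if "openin (Euclidean_space n) W" for W
      using euclid_plot_compose[OF F(1) euclid_plot_id[OF euclid_plot_preimage[OF F(1) that]]] by auto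
    have "F s \<in> U" using s F(2) by blast
    with p show "\<exists>W. s \<in> W \<and> W \<subseteq> S \<and> ((\<exists>q. plot Z1 m W q \<and> (\<forall>w\<in>W. p (F w) = in1 (q w))) \<or>
        (\<exists>q. plot Z2 m W q \<and> (\<forall>w\<in>W. p (F w) = in2 (q w))))"
    proof (cases rule: plot_glued_cases)
      case (in1 W q)
      have "plot Z1 m {s \<in> S. F s \<in> W} (\<lambda>s. q (F s))"
        by (rule plot_compose[OF Z1 in1(3) FS[OF plot_openin[OF Z1 in1(3)]]])
      then show ?thesis
        using s in1(1,4) by (intro exI[of _ "{s \<in> S. F s \<in> W}"] conjI disjI1 exI[of _ "\<lambda>s. q (F s)"]) auto
    next
      case (in2 W q)
      have "plot Z2 m {s \<in> S. F s \<in> W} (\<lambda>s. q (F s))"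
        by (rule plot_compose[OF Z2 in2(3) FS[OF plot_openin[OF Z2 in2(3)]]])
      then show ?thesis
        using s in2(1,4) by (intro exI[of _ "{s \<in> S. F s \<in> W}"] conjI disjI2 exI[of _ "\<lambda>s. q (F s)"]) auto
    qed
  qed
qed

end


subsection \<open>Duals of transported fibres\<close>

text \<open>Inverse of precomposition with \<open>j\<close>; the restriction to the image of
  \<open>j\<close> makes the result extensional, as members of \<open>smooth_dual\<close> must
  be.\<close>

definition transport_dual :: "('v \<Rightarrow> 'w) \<Rightarrow> (real, 'v) module \<Rightarrow> ('v \<Rightarrow> real) \<Rightarrow> 'w \<Rightarrow> real" where
  "transport_dual j E \<eta> = (\<lambda>c\<in>j ` carrier E. \<eta> (the_inv_into (carrier E) j c))"

lemma transport_dual_eval: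
  "inj_on j (carrier E) \<Longrightarrow> v \<in> carrier E \<Longrightarrow> transport_dual j E \<eta> (j v) = \<eta> v"
  by (simp add: transport_dual_def the_inv_into_f_f)

lemma transport_dual_unique:
  assumes j: "inj_on j (carrier E)" and \<xi>: "\<xi> \<in> extensional (j ` carrier E)"
    and eq: "\<And>v. v \<in> carrier E \<Longrightarrow> \<xi> (j v) = \<eta> v"
  shows "transport_dual j E \<eta> = \<xi>"
proof (rule extensionalityI[of _ "j ` carrier E"])
  show "transport_dual j E \<eta> c = \<xi> c" if "c \<in> j ` carrier E" for c
    using that eq by (auto simp: transport_dual_eval[OF j])
qed (use \<xi> in \<open>simp_all add: transport_dual_def\<close>)

text \<open>Smoothness of a transported functional needs the plots of the target to lift locally
  through \<open>j\<close>. For the glued bundle such lifts come from \<open>plot_fibre_in1\<close>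
  and \<open>plot_fibre_in2\<close>.\<close>

lemma transport_dual_in:
  assumes E: "vectorspace class_ring E" and j: "inj_on j (carrier E)" and D: "diffeological_space D" "pts D = carrier E"
    and plots: "\<And>n U p. plot D' n U p \<Longrightarrow> openin (Euclidean_space n) U"
      "\<And>n U p u. plot D' n U p \<Longrightarrow> u \<in> U \<Longrightarrow>
        \<exists>W q. u \<in> W \<and> W \<subseteq> U \<and> plot D n W q \<and> (\<forall>w\<in>W. p w = j (q w))"
    and \<eta>: "\<eta> \<in> carrier (smooth_dual D E)"
  shows "transport_dual j E \<eta> \<in> carrier (smooth_dual D' (transport_vs j E))"
  unfolding carrier_smooth_dual carrier_transport_vs[OF j]
proof (intro conjI)
  show "transport_dual j E \<eta> \<in> extensional (j ` carrier E)" by (simp add: transport_dual_def)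
  show "transport_dual j E \<eta> \<in> module_hom class_ring (transport_vs j E) real_vs"
    using \<eta> vs_add[OF E] vs_smult[OF E]
    by (auto simp: module_hom_real_vs carrier_transport_vs[OF j] add_transport_vs[OF j] smult_transport_vs[OF j]
        transport_dual_eval[OF j] carrier_smooth_dual)
  show "smooth_map D' real_space (transport_dual j E \<eta>)"
  proof (rule smooth_realI)
    fix n U p assume p: "plot D' n U p"
    show U: "openin (Euclidean_space n) U" by (rule plots(1)[OF p])
    show "C_infinity n U (\<lambda>u. transport_dual j E \<eta> (p u))"
    proof (rule C_infinity_local[OF U])
      fix u assume "u \<in> U"
      from plots(2)[OF p this] obtain W q where W: "u \<in> W" "W \<subseteq> U" "plot D n W q" "\<forall>w\<in>W. p w = j (q w)"
        by (elim exE conjE)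
      have oW: "openin (Euclidean_space n) W" by (rule plot_openin[OF D(1) W(3)])
      have "C_infinity n W (\<lambda>u. \<eta> (q u))"
        by (rule smooth_realD[OF _ W(3)]) (use \<eta> in \<open>simp add: carrier_smooth_dual\<close>)
      then have "C_infinity n W (\<lambda>u. transport_dual j E \<eta> (p u))"
        by (rule C_infinity_transform[OF _ oW])
          (use W(4) plot_in[OF D(1) W(3)] D(2) in \<open>simp add: transport_dual_eval[OF j]\<close>)
      then show "\<exists>W. openin (Euclidean_space n) W \<and> u \<in> W \<and> W \<subseteq> U \<and>
          C_infinity n W (\<lambda>u. transport_dual j E \<eta> (p u))"
        using W(1,2) oW by blast
    qed
  qed
qed

text \<open>For the opposite direction it is enough that \<open>j\<close> carries plots to
  plots.\<close>

lemma transport_dual_pull: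
  assumes E: "vectorspace class_ring E" and j: "inj_on j (carrier E)" and D: "diffeological_space D" "pts D = carrier E"
    and plots: "\<And>n U p. plot D n U p \<Longrightarrow> plot D' n U (\<lambda>u. j (p u))"
    and \<xi>: "\<xi> \<in> carrier (smooth_dual D' (transport_vs j E))"
  shows "(\<lambda>v\<in>carrier E. \<xi> (j v)) \<in> carrier (smooth_dual D E)"
    and "transport_dual j E (\<lambda>v\<in>carrier E. \<xi> (j v)) = \<xi>"
proof -
  show "(\<lambda>v\<in>carrier E. \<xi> (j v)) \<in> carrier (smooth_dual D E)"
    unfolding carrier_smooth_dual
  proof (intro conjI)
    have lin: "\<xi> \<in> module_hom class_ring (transport_vs j E) real_vs"
      using \<xi> by (simp add: carrier_smooth_dual)
    show "(\<lambda>v\<in>carrier E. \<xi> (j v)) \<in> module_hom class_ring E real_vs"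
      unfolding module_hom_real_vs
    proof (intro conjI ballI allI)
      fix v assume v: "v \<in> carrier E"
      have "\<xi> (j (r \<odot>\<^bsub>E\<^esub> v)) = r * \<xi> (j v)" for r
        using linear_functional_smult[OF lin, of "j v" r] v
        by (simp add: carrier_transport_vs[OF j] smult_transport_vs[OF j])
      then show "(\<lambda>v\<in>carrier E. \<xi> (j v)) (r \<odot>\<^bsub>E\<^esub> v) = r * (\<lambda>v\<in>carrier E. \<xi> (j v)) v" for r
        using v vs_smult[OF E] by simp
      fix w assume w: "w \<in> carrier E"
      have "\<xi> (j (v \<oplus>\<^bsub>E\<^esub> w)) = \<xi> (j v) + \<xi> (j w)"
        using linear_functional_add[OF lin, of "j v" "j w"] v w
        by (simp add: carrier_transport_vs[OF j] add_transport_vs[OF j])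
      then show "(\<lambda>v\<in>carrier E. \<xi> (j v)) (v \<oplus>\<^bsub>E\<^esub> w) = (\<lambda>v\<in>carrier E. \<xi> (j v)) v + (\<lambda>v\<in>carrier E. \<xi> (j v)) w"
        using v w vs_add[OF E] by simp
    qed
    show "smooth_map D real_space (\<lambda>v\<in>carrier E. \<xi> (j v))"
    proof (rule smooth_realI)
      fix n U p assume p: "plot D n U p"
      show U: "openin (Euclidean_space n) U" by (rule plot_openin[OF D(1) p])
      have "C_infinity n U (\<lambda>u. \<xi> (j (p u)))"
        by (rule smooth_realD[OF _ plots[OF p]]) (use \<xi> in \<open>simp add: carrier_smooth_dual\<close>)
      then show "C_infinity n U (\<lambda>u. (\<lambda>v\<in>carrier E. \<xi> (j v)) (p u))"
        by (rule C_infinity_transform[OF _ U]) (use plot_in[OF D(1) p] D(2) in simp)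
    qed
  qed simp
  show "transport_dual j E (\<lambda>v\<in>carrier E. \<xi> (j v)) = \<xi>"
    by (rule transport_dual_unique[OF j])
      (use \<xi> in \<open>simp_all add: carrier_smooth_dual carrier_transport_vs[OF j]\<close>)
qed

section \<open>The gluing-dual map\<close>

locale compatible_gluing = M1: metric_bundle V1 g1 + M2: metric_bundle V2 g2
  for V1 :: "('x1, 'v1) fibred_space"
    and g1 :: "'x1 \<Rightarrow> 'x1 \<times> (('x1 \<times> ('v1 \<Rightarrow> real)) \<times> ('x1 \<times> ('v1 \<Rightarrow> real)) \<Rightarrow>\<^sub>0 real) set"
    and V2 :: "('x2, 'v2) fibred_space"
    and g2 :: "'x2 \<Rightarrow> 'x2 \<times> (('x2 \<times> ('v2 \<Rightarrow> real)) \<times> ('x2 \<times> ('v2 \<Rightarrow> real)) \<Rightarrow>\<^sub>0 real) set" +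
  fixes Y :: "'x1 set" and f :: "'x1 \<Rightarrow> 'x2" and ft :: "'v1 \<Rightarrow> 'v2"
  assumes gluing: "bundle_gluing V1 V2 Y ft f" and f_inj: "inj_on f Y"
    and compat: "compatible_forms V1 Y ft f (\<lambda>x. tensor_form (g1 x)) (\<lambda>x. tensor_form (g2 x))"
    and dual_compat: "compatible_forms (dual_bundle V2) (f ` Y) (dual_lift V1 Y ft f) (inv_into Y f)
           (dual_metric V2 g2) (dual_metric V1 g1)"
begin

lemma Y_base: "Y \<subseteq> pts (Base V1)"
  using gluing by (simp add: bundle_gluing_def)

lemma f_base: "y \<in> Y \<Longrightarrow> f y \<in> pts (Base V2)"
  using gluing smooth_map_in[of "subset_space (Base V1) Y" "Base V2" f y]
  by (auto simp: bundle_gluing_def)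

lemma ft_fib: "y \<in> Y \<Longrightarrow> v \<in> carrier (Fib V1 y) \<Longrightarrow> ft v \<in> carrier (Fib V2 (f y))"
  using gluing by (auto simp: bundle_gluing_def module_hom_def)

lemma over_V1: "v \<in> over V1 Y \<longleftrightarrow> v \<in> pts (Total V1) \<and> Proj V1 v \<in> Y"
  by (simp add: over_def)

lemma over_dual_V2: "b \<in> over (dual_bundle V2) (f ` Y) \<longleftrightarrow> b \<in> dual_points V2 \<and> fst b \<in> f ` Y"
  by (simp add: over_def)

lemma ft_total: "v \<in> over V1 Y \<Longrightarrow> ft v \<in> pts (Total V2)"
  and ft_proj: "v \<in> over V1 Y \<Longrightarrow> Proj V2 (ft v) = f (Proj V1 v)"
  using gluing smooth_map_in[of "subset_space (Total V1) (over V1 Y)" "Total V2" ft v]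
  by (auto simp: bundle_gluing_def over_V1)

lemma ft_plot:
  assumes "plot (Total V1) n U v" "\<And>u. u \<in> U \<Longrightarrow> Proj V1 (v u) \<in> Y"
  shows "plot (Total V2) n U (\<lambda>u. ft (v u))"
proof (rule smooth_mapD[of "subset_space (Total V1) (over V1 Y)"])
  show "smooth_map (subset_space (Total V1) (over V1 Y)) (Total V2) ft"
    using gluing by (simp add: bundle_gluing_def)
  show "plot (subset_space (Total V1) (over V1 Y)) n U v"
    using assms plot_in[OF bundle_total[OF M1.V] assms(1)] by (auto simp: over_V1)
qed

lemma Fib_V1: "x \<in> pts (Base V1) \<Longrightarrow> v \<in> carrier (Fib V1 x) \<longleftrightarrow> v \<in> pts (Total V1) \<and> Proj V1 v = x"
  by (simp add: bundle_carrier[OF M1.V])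

lemma Fib_V2: "x \<in> pts (Base V2) \<Longrightarrow> v \<in> carrier (Fib V2 x) \<longleftrightarrow> v \<in> pts (Total V2) \<and> Proj V2 v = x"
  by (simp add: bundle_carrier[OF M2.V])

lemma dual_points_iff:
  "\<xi> \<in> dual_points V \<longleftrightarrow> fst \<xi> \<in> pts (Base V) \<and> snd \<xi> \<in> fibre_dual V (fst \<xi>)"
  by (cases \<xi>) (simp add: dual_points_def)

section \<open>The dual lift is bijective over the glued part of the base\<close>

abbreviation lift :: "'x2 \<times> ('v2 \<Rightarrow> real) \<Rightarrow> 'x1 \<times> ('v1 \<Rightarrow> real)" where
  "lift \<equiv> dual_lift V1 Y ft f"

lemma lift_eq:
  "y \<in> Y \<Longrightarrow> fst b = f y \<Longrightarrow> lift b = (y, \<lambda>v\<in>carrier (Fib V1 y). snd b (ft v))"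
  by (simp add: dual_lift_def case_prod_beta Let_def inv_into_f_f[OF f_inj])

lemma lift_in:
  assumes b: "b \<in> dual_points V2" and y: "y \<in> Y" "fst b = f y"
  shows "lift b \<in> dual_points V1"
proof -
  have yB: "y \<in> pts (Base V1)" using y Y_base by blast
  note E = bundle_vs[OF M1.V yB]
  have b_lin: "snd b \<in> module_hom class_ring (Fib V2 (f y)) real_vs"
    and b_smooth: "smooth_map (fibre_space V2 (f y)) real_space (snd b)"
    using b y(2) by (simp_all add: dual_points_iff carrier_smooth_dual)
  have ft_lin: "ft \<in> module_hom class_ring (Fib V1 y) (Fib V2 (f y))"
    using gluing y by (simp add: bundle_gluing_def)
  have "(\<lambda>v\<in>carrier (Fib V1 y). snd b (ft v)) \<in> fibre_dual V1 y"
    unfolding carrier_smooth_dual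
  proof (intro conjI)
    show "(\<lambda>v\<in>carrier (Fib V1 y). snd b (ft v)) \<in> module_hom class_ring (Fib V1 y) real_vs"
      using vs_add[OF E] vs_smult[OF E] ft_fib[OF y(1)]
      by (simp add: module_hom_real_vs module_hom_add[OF ft_lin] module_hom_smult[OF ft_lin]
          linear_functional_add[OF b_lin] linear_functional_smult[OF b_lin])
    show "smooth_map (fibre_space V1 y) real_space (\<lambda>v\<in>carrier (Fib V1 y). snd b (ft v))"
    proof (rule smooth_realI)
      fix n U p assume p: "plot (fibre_space V1 y) n U p"
      then have pV: "plot (Total V1) n U p" and pE: "\<And>u. u \<in> U \<Longrightarrow> p u \<in> carrier (Fib V1 y)"
        by (auto simp: plot_fibre_space)
      show U: "openin (Euclidean_space n) U" by (rule plot_openin[OF bundle_total[OF M1.V] pV])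
      have "plot (Total V2) n U (\<lambda>u. ft (p u))"
        by (rule ft_plot[OF pV]) (use pE y(1) in \<open>simp add: Fib_V1[OF yB]\<close>)
      then have "plot (fibre_space V2 (f y)) n U (\<lambda>u. ft (p u))"
        using ft_fib[OF y(1) pE] by (auto simp: plot_fibre_space)
      from smooth_realD[OF b_smooth this]
      show "C_infinity n U (\<lambda>u. (\<lambda>v\<in>carrier (Fib V1 y). snd b (ft v)) (p u))"
        by (rule C_infinity_transform[OF _ U]) (simp add: pE)
    qed
  qed simp
  then show ?thesis
    unfolding lift_eq[OF y] by (simp add: dual_points_iff yB)
qed

lemma lift_pairing:
  assumes y: "y \<in> Y" and v: "v \<in> carrier (Fib V1 y)"
  shows "lift (metric_pairing V2 g2 (ft v)) = metric_pairing V1 g1 v"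
proof -
  have yB: "y \<in> pts (Base V1)" using y Y_base by blast
  have "M1.G y v w = M2.G (f y) (ft v) (ft w)" if "w \<in> carrier (Fib V1 y)" for w
    using compat y v that by (simp add: compatible_forms_def)
  then show ?thesis
    unfolding M2.metric_pairing_eq[OF f_base[OF y] ft_fib[OF y v]] M1.metric_pairing_eq[OF yB v]
    by (subst lift_eq[OF y]) (auto simp: ft_fib[OF y] intro!: restrict_ext)
qed

lemma lift_onto:
  assumes a: "a \<in> dual_points V1" "fst a \<in> Y"
  obtains b where "b \<in> dual_points V2" "fst b = f (fst a)" "lift b = a"
proof -
  obtain v where v: "v \<in> carrier (Fib V1 (fst a))" "metric_pairing V1 g1 v = a"
    using a(1) by (rule M1.metric_pairing_onto)
  note ftv = ft_fib[OF a(2) v(1)]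
  show thesis
  proof (rule that)
    show "metric_pairing V2 g2 (ft v) \<in> dual_points V2"
      by (rule M2.metric_pairing_in[OF f_base[OF a(2)] ftv])
    show "fst (metric_pairing V2 g2 (ft v)) = f (fst a)"
      by (simp add: M2.metric_pairing_eq[OF f_base[OF a(2)] ftv])
    show "lift (metric_pairing V2 g2 (ft v)) = a"
      using lift_pairing[OF a(2) v(1)] v(2) by simp
  qed
qed

text \<open>The dual pseudo-metric on \<open>V2\<close> is definite and, by compatibility, factors through \<open>lift\<close>.\<close>

lemma lift_inj:
  assumes b: "b \<in> dual_points V2" "fst b \<in> f ` Y" and b': "b' \<in> dual_points V2" "fst b' \<in> f ` Y"
    and eq: "lift b = lift b'"
  shows "b = b'"
proof -
  obtain y where y: "y \<in> Y" "fst b = f y" using b(2) by blast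
  obtain y' where y': "y' \<in> Y" "fst b' = f y'" using b'(2) by blast
  \<comment> \<open>A dual element carries its base point, so equal lifts lie over the same
    \<open>y\<close>, and \<open>b\<close> and \<open>b'\<close> lie in the same fibre.\<close>
  have "y = y'" using eq by (simp add: lift_eq[OF y] lift_eq[OF y'])
  then have fb': "fst b' = f y" using y' by simp
  note x = f_base[OF y(1)]
  note E = bundle_vs[OF M2.V x] and pm = M2.fibre_metric[OF x]
  obtain v where v: "v \<in> carrier (Fib V2 (f y))" "metric_pairing V2 g2 v = b"
    using M2.metric_pairing_onto[OF b(1)] y(2) by metis
  obtain w where w: "w \<in> carrier (Fib V2 (f y))" "metric_pairing V2 g2 w = b'"
    using M2.metric_pairing_onto[OF b'(1)] fb' by metis
  have b_fib: "b \<in> carrier (Fib (dual_bundle V2) (f y))" "b' \<in> carrier (Fib (dual_bundle V2) (f y))"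
    using b(1) b'(1) y(2) fb' by (simp_all add: dual_points_carrier)
  have dual: "dual_metric V2 g2 (f y) c c' = dual_metric V1 g1 (inv_into Y f (f y)) (lift c) (lift c')"
    if "c \<in> {b, b'}" "c' \<in> {b, b'}" for c c'
    using dual_compat y(1) b_fib that by (auto simp: compatible_forms_def)
  have G: "M2.G (f y) v v = dual_metric V2 g2 (f y) b b" "M2.G (f y) v w = dual_metric V2 g2 (f y) b b'"
    "M2.G (f y) w w = dual_metric V2 g2 (f y) b' b'"
    using M2.dual_metric_pairing[OF x] v w by (metis, metis, metis)
  \<comment> \<open>By \<open>dual_compat\<close> all three values equal the induced metric of
    \<open>V1\<close> at one and the same pair, because \<open>lift b = lift b'\<close>.\<close>
  have Gvw: "M2.G (f y) v v = M2.G (f y) v w" "M2.G (f y) w w = M2.G (f y) v w"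
    unfolding G using dual eq by simp_all
  \<comment> \<open>The difference of the two preimages turns out isotropic, so its pairing vanishes
    although the vector itself need not.\<close>
  define d where "d = v \<oplus>\<^bsub>Fib V2 (f y)\<^esub> ((-1) \<odot>\<^bsub>Fib V2 (f y)\<^esub> w)"
  have w': "(-1) \<odot>\<^bsub>Fib V2 (f y)\<^esub> w \<in> carrier (Fib V2 (f y))" by (rule vs_smult[OF E w(1)])
  have d: "d \<in> carrier (Fib V2 (f y))" unfolding d_def by (rule vs_add[OF E v(1) w'])
  have Gd: "M2.G (f y) d u = M2.G (f y) v u - M2.G (f y) w u" if "u \<in> carrier (Fib V2 (f y))" for u
    using linear_functional_add[OF form_linear_left[OF pm that] v(1) w']
      linear_functional_smult[OF form_linear_left[OF pm that] w(1), of "-1"] by (simp add: d_def)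
  have "M2.G (f y) d d = (M2.G (f y) v v - M2.G (f y) w v) - (M2.G (f y) v w - M2.G (f y) w w)"
    unfolding Gd[OF d] form_sym[OF pm v(1) d] form_sym[OF pm w(1) d] Gd[OF v(1)] Gd[OF w(1)] ..
  also have "\<dots> = 0" using Gvw form_sym[OF pm v(1) w(1)] by simp
  finally have "M2.G (f y) d u = 0" if "u \<in> carrier (Fib V2 (f y))" for u
    using form_isotropic[OF E pm d _ that] by simp
  then have "M2.G (f y) v u = M2.G (f y) w u" if "u \<in> carrier (Fib V2 (f y))" for u
    using Gd[OF that] that by simp
  then have "metric_pairing V2 g2 v = metric_pairing V2 g2 w"
    unfolding M2.metric_pairing_eq[OF x v(1)] M2.metric_pairing_eq[OF x w(1)]
    by (auto intro!: restrict_ext)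
  then show ?thesis using v(2) w(2) by simp
qed

section \<open>The glued bundle and its plots\<close>

sublocale B: diffeological_glue_data "Base V1" "Base V2" Y f
  by unfold_locales (use Y_base f_base bundle_base[OF M1.V] bundle_base[OF M2.V] in auto)

sublocale T: diffeological_glue_data "Total V1" "Total V2" "over V1 Y" ft
  by unfold_locales (use ft_total bundle_total[OF M1.V] bundle_total[OF M2.V] in \<open>auto simp: over_V1\<close>)

sublocale W: glue_data "Total (dual_bundle V2)" "Total (dual_bundle V1)" "over (dual_bundle V2) (f ` Y)" lift
  by unfold_locales (auto simp: over_dual_V2 intro: lift_in)

sublocale WB: glue_data "Base V2" "Base V1" "f ` Y" "inv_into Y f"
  by unfold_locales (use f_base Y_base in \<open>auto simp: inv_into_f_f[OF f_inj]\<close>)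

abbreviation V :: "(('x1 + 'x2) set, ('v1 + 'v2) set) fibred_space" where
  "V \<equiv> glue_bundle V1 V2 Y ft f"

lemma Base_V [simp]: "Base V = B.glued" and Total_V [simp]: "Total V = T.glued"
  by (simp_all add: glue_bundle_def)

lemma Proj_in2: "w \<in> pts (Total V2) \<Longrightarrow> Proj V (T.in2 w) = B.in2 (Proj V2 w)"
  by (simp add: glue_bundle_def T.glue_case_in2)

text \<open>The projection is defined by cases that give priority to the image of \<open>V2\<close>,
  so over \<open>Y\<close> it has to be read through \<open>ft\<close>.\<close>

lemma Proj_in1:
  assumes "v \<in> pts (Total V1)"
  shows "Proj V (T.in1 v) = B.in1 (Proj V1 v)"
proof (cases "v \<in> over V1 Y")
  case True
  then show ?thesis
    using Proj_in2[OF ft_total[OF True]] T.in1_in2[OF True] B.in1_in2 ft_proj[OF True] by (simp add: over_V1)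
next
  case False
  then show ?thesis using assms by (simp add: glue_bundle_def T.glue_case_in1)
qed

lemma Fib_in2: "x \<in> pts (Base V2) \<Longrightarrow> Fib V (B.in2 x) = transport_vs T.in2 (Fib V2 x)"
  by (simp add: glue_bundle_def B.glue_case_in2)

lemma Fib_in1: "x \<in> pts (Base V1) \<Longrightarrow> x \<notin> Y \<Longrightarrow> Fib V (B.in1 x) = transport_vs T.in1 (Fib V1 x)"
  by (simp add: glue_bundle_def B.glue_case_in1)

lemma inj_in2: "x \<in> pts (Base V2) \<Longrightarrow> inj_on T.in2 (carrier (Fib V2 x))"
  by (auto intro!: inj_onI simp: Fib_V2 T.in2_eq_in2_iff)

lemma inj_in1: "x \<in> pts (Base V1) \<Longrightarrow> x \<notin> Y \<Longrightarrow> inj_on T.in1 (carrier (Fib V1 x))"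
  by (auto intro!: inj_onI simp: Fib_V1 T.in1_eq_in1_iff over_V1)

lemma B_in1_inj: "x \<in> pts (Base V1) \<Longrightarrow> x' \<in> pts (Base V1) \<Longrightarrow> B.in1 x = B.in1 x' \<longleftrightarrow> x = x'"
  using B.in1_eq_in1_iff f_inj by (auto dest: inj_onD)

text \<open>If a plot over the second base lifts locally to \<open>V1\<close>, that lift lies over
  \<open>Y\<close>, and there \<open>ft\<close> replaces it by a lift to \<open>V2\<close>.\<close>

lemma plot_over_in2:
  assumes p: "plot T.glued n U p" and u: "u \<in> U"
    and r: "\<And>s. s \<in> U \<Longrightarrow> r s \<in> pts (Base V2)" "\<And>s. s \<in> U \<Longrightarrow> Proj V (p s) = B.in2 (r s)"
  obtains W w where "u \<in> W" "W \<subseteq> U" "plot (Total V2) n W w"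
    "\<And>s. s \<in> W \<Longrightarrow> p s = T.in2 (w s)" "\<And>s. s \<in> W \<Longrightarrow> Proj V2 (w s) = r s"
  using p u
proof (cases rule: T.plot_glued_cases)
  case (in1 W v)
  have v: "v s \<in> over V1 Y" "f (Proj V1 (v s)) = r s" if s: "s \<in> W" for s
  proof -
    have sU: "s \<in> U" using s in1(2) by blast
    have vs: "v s \<in> pts (Total V1)" by (rule plot_in[OF bundle_total[OF M1.V] in1(3) s])
    have "B.in1 (Proj V1 (v s)) = B.in2 (r s)"
      using Proj_in1[OF vs] r(2)[OF sU] in1(4)[OF s] by simp
    then show "v s \<in> over V1 Y" "f (Proj V1 (v s)) = r s"
      using B.in1_eq_in2_iff[OF bundle_fibre(1)[OF M1.V vs] r(1)[OF sU]] vs by (simp_all add: over_V1)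
  qed
  show thesis
  proof (rule that[OF in1(1,2)])
    show "plot (Total V2) n W (\<lambda>s. ft (v s))"
      by (rule ft_plot[OF in1(3)]) (use v(1) in \<open>simp add: over_V1\<close>)
    show "p s = T.in2 (ft (v s))" if "s \<in> W" for s
      using in1(4)[OF that] T.in1_in2[OF v(1)[OF that]] by simp
    show "Proj V2 (ft (v s)) = r s" if "s \<in> W" for s
      using ft_proj[OF v(1)[OF that]] v(2)[OF that] by simp
  qed
next
  case (in2 W w)
  show thesis
  proof (rule that[OF in2])
    fix s assume s: "s \<in> W"
    then have sU: "s \<in> U" using in2(2) by blast
    have ws: "w s \<in> pts (Total V2)" by (rule plot_in[OF bundle_total[OF M2.V] in2(3) s])
    have "B.in2 (Proj V2 (w s)) = B.in2 (r s)"
      using Proj_in2[OF ws] r(2)[OF sU] in2(4)[OF s] by simp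
    then show "Proj V2 (w s) = r s"
      using B.in2_eq_in2_iff[OF bundle_fibre(1)[OF M2.V ws] r(1)[OF sU]] by simp
  qed
qed

lemma plot_fibre_in2:
  assumes x: "x \<in> pts (Base V2)" and p: "plot (fibre_space V (B.in2 x)) n U p" and u: "u \<in> U"
  shows "\<exists>W q. u \<in> W \<and> W \<subseteq> U \<and> plot (fibre_space V2 x) n W q \<and> (\<forall>w\<in>W. p w = T.in2 (q w))"
proof -
  have pT: "plot T.glued n U p" and "\<And>s. s \<in> U \<Longrightarrow> p s \<in> T.in2 ` carrier (Fib V2 x)"
    using p by (auto simp: plot_fibre_space Fib_in2[OF x] carrier_transport_vs[OF inj_in2[OF x]])
  then have "Proj V (p s) = B.in2 x" if "s \<in> U" for s
    using that Proj_in2 by (fastforce simp: Fib_V2[OF x])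
  from plot_over_in2[OF pT u x this] obtain W w where w: "u \<in> W" "W \<subseteq> U" "plot (Total V2) n W w"
    "\<And>s. s \<in> W \<Longrightarrow> p s = T.in2 (w s)" "\<And>s. s \<in> W \<Longrightarrow> Proj V2 (w s) = x" by metis
  have "plot (fibre_space V2 x) n W w"
    using w(3,5) plot_in[OF bundle_total[OF M2.V] w(3)] by (auto simp: plot_fibre_space Fib_V2[OF x])
  then show ?thesis using w by blast
qed

text \<open>Off \<open>Y\<close> a lift to \<open>V2\<close> is impossible, as its base point would
  have to be glued to \<open>x\<close>.\<close>

lemma plot_fibre_in1:
  assumes x: "x \<in> pts (Base V1)" "x \<notin> Y" and p: "plot (fibre_space V (B.in1 x)) n U p" and u: "u \<in> U"
  shows "\<exists>W q. u \<in> W \<and> W \<subseteq> U \<and> plot (fibre_space V1 x) n W q \<and> (\<forall>w\<in>W. p w = T.in1 (q w))"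
proof -
  have pT: "plot T.glued n U p" and pE: "\<And>s. s \<in> U \<Longrightarrow> p s \<in> T.in1 ` carrier (Fib V1 x)"
    using p by (auto simp: plot_fibre_space Fib_in1[OF x] carrier_transport_vs[OF inj_in1[OF x]])
  have proj: "Proj V (p s) = B.in1 x" if "s \<in> U" for s
    using pE[OF that] Proj_in1 by (fastforce simp: Fib_V1[OF x(1)])
  from pT u show ?thesis
  proof (cases rule: T.plot_glued_cases)
    case (in1 W v)
    have "v s \<in> carrier (Fib V1 x)" if s: "s \<in> W" for s
    proof -
      have vs: "v s \<in> pts (Total V1)" by (rule plot_in[OF bundle_total[OF M1.V] in1(3) s])
      have "s \<in> U" using s in1(2) by blast
      then have "B.in1 (Proj V1 (v s)) = B.in1 x"
        using Proj_in1[OF vs] proj[of s] in1(4)[OF s] by simp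
      then show ?thesis
        using B_in1_inj[OF bundle_fibre(1)[OF M1.V vs] x(1)] vs by (simp add: Fib_V1[OF x(1)])
    qed
    then have "plot (fibre_space V1 x) n W v" using in1(3) by (auto simp: plot_fibre_space)
    then show ?thesis using in1(1,2,4) by blast
  next
    case (in2 W w)
    have wu: "w u \<in> pts (Total V2)" by (rule plot_in[OF bundle_total[OF M2.V] in2(3,1)])
    have "B.in1 x = B.in2 (Proj V2 (w u))"
      using Proj_in2[OF wu] proj[OF u] in2(4)[OF in2(1)] by simp
    then have False
      using B.in1_eq_in2_iff[OF x(1) bundle_fibre(1)[OF M2.V wu]] x(2) by simp
    then show ?thesis ..
  qed
qed

lemma plot_fibre_V_openin: "plot (fibre_space V c) n U p \<Longrightarrow> openin (Euclidean_space n) U"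
  by (auto simp: plot_fibre_space intro: T.plot_glued_openin)

end

section \<open>Functionals on the glued bundle from functionals on its parts\<close>

context compatible_gluing
begin

text \<open>Inverse of precomposition with the inclusion of a fibre of \<open>V2\<close>.\<close>

definition push2 :: "'x2 \<times> ('v2 \<Rightarrow> real) \<Rightarrow> ('x1 + 'x2) set \<times> (('v1 + 'v2) set \<Rightarrow> real)" where
  "push2 b = (B.in2 (fst b), transport_dual T.in2 (Fib V2 (fst b)) (snd b))"

text \<open>Over \<open>Y\<close> the glued fibre is a fibre of \<open>V2\<close>, so a functional
  on the fibre of \<open>V1\<close> must first be written as a dual lift; \<open>lift_onto\<close>
  and \<open>lift_inj\<close> make this possible in exactly one way.\<close>

definition push1 :: "'x1 \<times> ('v1 \<Rightarrow> real) \<Rightarrow> ('x1 + 'x2) set \<times> (('v1 + 'v2) set \<Rightarrow> real)" where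
  "push1 a = (if fst a \<in> Y then push2 (inv_into (over (dual_bundle V2) (f ` Y)) lift a)
     else (B.in1 (fst a), transport_dual T.in1 (Fib V1 (fst a)) (snd a)))"

lemma fst_push2 [simp]: "fst (push2 b) = B.in2 (fst b)"
  by (simp add: push2_def)

lemma push2_eval:
  "b \<in> dual_points V2 \<Longrightarrow> w \<in> carrier (Fib V2 (fst b)) \<Longrightarrow> snd (push2 b) (T.in2 w) = snd b w"
  by (simp add: push2_def transport_dual_eval inj_in2 dual_points_iff)

lemma push2_in:
  assumes "b \<in> dual_points V2"
  shows "push2 b \<in> dual_points V"
proof -
  have x: "fst b \<in> pts (Base V2)" and b: "snd b \<in> fibre_dual V2 (fst b)"
    using assms by (simp_all add: dual_points_iff)
  have "transport_dual T.in2 (Fib V2 (fst b)) (snd b) \<in> fibre_dual V (B.in2 (fst b))"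
    unfolding Fib_in2[OF x]
    by (rule transport_dual_in[OF bundle_vs[OF M2.V x] inj_in2[OF x] diffeological_fibre_space[OF M2.V]
          pts_fibre_space[OF M2.V x] plot_fibre_V_openin plot_fibre_in2[OF x] b])
  then show ?thesis by (simp add: push2_def dual_points_iff B.in2_pts x)
qed

lemma push2_pull:
  assumes p: "p \<in> dual_points V" "fst p = B.in2 x" and x: "x \<in> pts (Base V2)"
  shows "(x, \<lambda>w\<in>carrier (Fib V2 x). snd p (T.in2 w)) \<in> dual_points V2"
    and "push2 (x, \<lambda>w\<in>carrier (Fib V2 x). snd p (T.in2 w)) = p"
proof -
  have p': "snd p \<in> carrier (smooth_dual (fibre_space V (B.in2 x)) (transport_vs T.in2 (Fib V2 x)))"
    using p by (simp add: dual_points_iff Fib_in2[OF x])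
  have plots: "plot (fibre_space V (B.in2 x)) n U (\<lambda>u. T.in2 (q u))" if "plot (fibre_space V2 x) n U q" for n U q
    using that T.plot_in2[of n U q]
    by (auto simp: plot_fibre_space Fib_in2[OF x] carrier_transport_vs[OF inj_in2[OF x]])
  note pull = transport_dual_pull[OF bundle_vs[OF M2.V x] inj_in2[OF x] diffeological_fibre_space[OF M2.V]
      pts_fibre_space[OF M2.V x] plots p']
  show "(x, \<lambda>w\<in>carrier (Fib V2 x). snd p (T.in2 w)) \<in> dual_points V2"
    using pull(1) x by (simp add: dual_points_iff)
  show "push2 (x, \<lambda>w\<in>carrier (Fib V2 x). snd p (T.in2 w)) = p"
    using pull(2) p(2) by (simp add: push2_def prod_eq_iff)
qed

text \<open>The two charts agree on their overlap: injectivity of \<open>lift\<close> pins down the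
  choice made in \<open>push1\<close>.\<close>

lemma push1_lift:
  assumes b: "b \<in> dual_points V2" "fst b \<in> f ` Y"
  shows "push1 (lift b) = push2 b"
proof -
  obtain y where y: "y \<in> Y" "fst b = f y" using b(2) by blast
  have "inj_on lift (over (dual_bundle V2) (f ` Y))"
    by (rule inj_onI) (simp add: over_dual_V2 lift_inj)
  then have "inv_into (over (dual_bundle V2) (f ` Y)) lift (lift b) = b"
    using b by (intro inv_into_f_f) (simp_all add: over_dual_V2)
  moreover have "fst (lift b) \<in> Y" using y by (simp add: lift_eq[OF y])
  ultimately show ?thesis by (simp add: push1_def)
qed

lemma fst_push1:
  assumes "a \<in> dual_points V1"
  shows "fst (push1 a) = B.in1 (fst a)"
proof (cases "fst a \<in> Y")
  case True
  then obtain b where b: "b \<in> dual_points V2" "fst b = f (fst a)" "lift b = a"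
    using lift_onto[OF assms] by metis
  then show ?thesis using push1_lift[OF b(1)] True B.in1_in2[OF True] by auto
qed (simp add: push1_def)

lemma push1_in:
  assumes a: "a \<in> dual_points V1"
  shows "push1 a \<in> dual_points V"
proof (cases "fst a \<in> Y")
  case True
  then obtain b where b: "b \<in> dual_points V2" "fst b = f (fst a)" "lift b = a"
    using lift_onto[OF assms] by metis
  then show ?thesis using push1_lift[OF b(1)] True push2_in[OF b(1)] by auto
next
  case False
  have x: "fst a \<in> pts (Base V1)" and a': "snd a \<in> fibre_dual V1 (fst a)"
    using a by (simp_all add: dual_points_iff)
  have "transport_dual T.in1 (Fib V1 (fst a)) (snd a) \<in> fibre_dual V (B.in1 (fst a))"
    unfolding Fib_in1[OF x False]
    by (rule transport_dual_in[OF bundle_vs[OF M1.V x] inj_in1[OF x False] diffeological_fibre_space[OF M1.V]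
          pts_fibre_space[OF M1.V x] plot_fibre_V_openin plot_fibre_in1[OF x False] a'])
  then show ?thesis using False by (simp add: push1_def dual_points_iff B.in1_pts x)
qed

text \<open>Over \<open>Y\<close> the vector \<open>v\<close> is glued to \<open>ft v\<close>, and
  evaluation at \<open>ft v\<close> is what \<open>lift\<close> performs.\<close>

lemma push1_eval:
  assumes a: "a \<in> dual_points V1" and v: "v \<in> carrier (Fib V1 (fst a))"
  shows "snd (push1 a) (T.in1 v) = snd a v"
proof (cases "fst a \<in> Y")
  case True
  then obtain b where b: "b \<in> dual_points V2" "fst b = f (fst a)" "lift b = a"
    using lift_onto[OF a] by metis
  have "v \<in> over V1 Y" using v True a by (simp add: over_V1 Fib_V1 dual_points_iff)
  then have "snd (push1 a) (T.in1 v) = snd (push2 b) (T.in2 (ft v))"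
    using push1_lift[OF b(1)] b(2,3) True T.in1_in2 by auto
  also have "\<dots> = snd b (ft v)"
    by (rule push2_eval[OF b(1)]) (simp add: b(2) ft_fib[OF True v])
  also have "\<dots> = snd (lift b) v" using v by (simp add: lift_eq[OF True b(2)])
  finally show ?thesis using b(3) by simp
next
  case False
  then show ?thesis
    using a v by (simp add: push1_def transport_dual_eval inj_in1 dual_points_iff)
qed

lemma push1_pull:
  assumes p: "p \<in> dual_points V" "fst p = B.in1 x" and x: "x \<in> pts (Base V1)"
  shows "(x, \<lambda>v\<in>carrier (Fib V1 x). snd p (T.in1 v)) \<in> dual_points V1"
    and "push1 (x, \<lambda>v\<in>carrier (Fib V1 x). snd p (T.in1 v)) = p"
proof -
  let ?a = "(x, \<lambda>v\<in>carrier (Fib V1 x). snd p (T.in1 v))"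
  have "?a \<in> dual_points V1 \<and> push1 ?a = p"
  proof (cases "x \<in> Y")
    case True
    \<comment> \<open>Over \<open>Y\<close> the functional is read off on the fibre of
      \<open>V2\<close>. Its dual lift is \<open>?a\<close>, since \<open>v\<close> and
      \<open>ft v\<close> are the same point of the glued space.\<close>
    let ?b = "(f x, \<lambda>w\<in>carrier (Fib V2 (f x)). snd p (T.in2 w))"
    have b: "?b \<in> dual_points V2" "push2 ?b = p"
      using push2_pull[OF p(1) _ f_base[OF True]] p(2) B.in1_in2[OF True] by simp_all
    have "T.in1 v = T.in2 (ft v)" if "v \<in> carrier (Fib V1 x)" for v
      using that True by (intro T.in1_in2) (simp add: over_V1 Fib_V1[OF x])
    then have "lift ?b = ?a"
      using ft_fib[OF True] by (subst lift_eq[OF True]) (auto intro!: restrict_ext)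
    then show ?thesis
      using lift_in[OF b(1) True] push1_lift[OF b(1)] b(2) True by simp
  next
    case False
    have p': "snd p \<in> carrier (smooth_dual (fibre_space V (B.in1 x)) (transport_vs T.in1 (Fib V1 x)))"
      using p by (simp add: dual_points_iff Fib_in1[OF x False])
    have plots: "plot (fibre_space V (B.in1 x)) n U (\<lambda>u. T.in1 (q u))" if "plot (fibre_space V1 x) n U q" for n U q
      using that T.plot_in1[of n U q]
      by (auto simp: plot_fibre_space Fib_in1[OF x False] carrier_transport_vs[OF inj_in1[OF x False]])
    note pull = transport_dual_pull[OF bundle_vs[OF M1.V x] inj_in1[OF x False] diffeological_fibre_space[OF M1.V]
        pts_fibre_space[OF M1.V x] plots p']
    show ?thesis
      using pull x False p(2) by (simp add: dual_points_iff push1_def prod_eq_iff)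
  qed
  then show "?a \<in> dual_points V1" "push1 ?a = p" by blast+
qed

lemma dual_points_V_cases:
  assumes p: "p \<in> dual_points V"
  obtains (push1) a where "a \<in> dual_points V1" "fst a \<notin> Y" "p = push1 a"
  | (push2) b where "b \<in> dual_points V2" "p = push2 b"
proof -
  have "fst p \<in> B.in1 ` (pts (Base V1) - Y) \<union> B.in2 ` pts (Base V2)"
    using p by (simp add: dual_points_iff B.pts_glued)
  then show thesis
  proof
    assume "fst p \<in> B.in1 ` (pts (Base V1) - Y)"
    then obtain x where x: "x \<in> pts (Base V1)" "x \<notin> Y" "fst p = B.in1 x" by blast
    from push1[OF push1_pull(1)[OF p x(3,1)]] x(2) push1_pull(2)[OF p x(3,1)] show thesis by simp
  next
    assume "fst p \<in> B.in2 ` pts (Base V2)"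
    then obtain x where x: "x \<in> pts (Base V2)" "fst p = B.in2 x" by blast
    from push2[OF push2_pull(1)[OF p x(2,1)]] push2_pull(2)[OF p x(2,1)] show thesis by simp
  qed
qed

text \<open>A test plot over the base points of \<open>push2 (q u)\<close> lies over the second
  base, so \<open>plot_over_in2\<close> moves it into \<open>V2\<close>, where \<open>push2\<close>
  evaluates like \<open>q\<close>.\<close>

lemma push2_plot:
  assumes q: "plot (Total (dual_bundle V2)) n U q"
  shows "plot (Total (dual_bundle V)) n U (\<lambda>u. push2 (q u))"
proof -
  note BT = bundle_base[OF M2.V] bundle_total[OF M2.V]
  note q_iff = q[unfolded dual_plot_iff[OF BT(2)]]
  have qd: "q u \<in> dual_points V2" if "u \<in> U" for u using q_iff that by blast
  show ?thesis
    unfolding dual_plot_iff[of V, unfolded Total_V, OF T.diffeological_glued]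
  proof (intro conjI allI impI)
    show "openin (Euclidean_space n) U" using q_iff by blast
    show "(\<lambda>u. push2 (q u)) ` U \<subseteq> dual_points V" using push2_in qd by blast
    show "plot (Base V) n U (\<lambda>u. fst (push2 (q u)))"
      using B.plot_in2[of n U "\<lambda>u. fst (q u)"] q_iff by simp
    fix m S a v
    assume a: "plot (euclid n) m S a" "a ` S \<subseteq> U" and v: "plot T.glued m S v"
      "\<forall>s\<in>S. fst (push2 (q (a s))) = Proj V (v s)"
    have aS: "a s \<in> U" if "s \<in> S" for s using a(2) that by blast
    have qa: "plot (Total (dual_bundle V2)) m S (\<lambda>s. q (a s))"
      by (rule dual_plot_compose[OF BT q a])
    show "C_infinity m S (\<lambda>s. snd (push2 (q (a s))) (v s))"
    proof (rule C_infinity_local[OF euclid_plot_openin[OF a(1)]])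
      fix s assume s: "s \<in> S"
      obtain W w where W: "s \<in> W" "W \<subseteq> S" "plot (Total V2) m W w"
        "\<And>t. t \<in> W \<Longrightarrow> v t = T.in2 (w t)" "\<And>t. t \<in> W \<Longrightarrow> Proj V2 (w t) = fst (q (a t))"
      proof (rule plot_over_in2[OF v(1) s, of "\<lambda>s. fst (q (a s))"])
        show "fst (q (a s)) \<in> pts (Base V2)" if "s \<in> S" for s
          using qd[OF aS[OF that]] by (simp add: dual_points_iff)
        show "Proj V (v s) = B.in2 (fst (q (a s)))" if "s \<in> S" for s
          using v(2) that by simp
      qed (rule that)
      have oW: "openin (Euclidean_space m) W" by (rule plot_openin[OF BT(2) W(3)])
      have "C_infinity m W (\<lambda>t. snd (q (a t)) (w t))"
        by (rule dual_plot_eval[OF BT(2) dual_plot_restrict[OF BT qa oW W(2)] W(3)]) (simp add: W(5))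
      then have "C_infinity m W (\<lambda>s. snd (push2 (q (a s))) (v s))"
      proof (rule C_infinity_transform[OF _ oW])
        fix t assume t: "t \<in> W"
        have "q (a t) \<in> dual_points V2" using qd[OF aS] W(2) t by blast
        then show "snd (push2 (q (a t))) (v t) = snd (q (a t)) (w t)"
          unfolding W(4)[OF t]
          by (rule push2_eval) (use plot_fibre[OF M2.V W(3) t] W(5)[OF t] in simp)
      qed
      then show "\<exists>W. openin (Euclidean_space m) W \<and> s \<in> W \<and> W \<subseteq> S \<and>
          C_infinity m W (\<lambda>s. snd (push2 (q (a s))) (v s))"
        using oW W(1,2) by blast
    qed
  qed
qed

text \<open>The inverse of \<open>lift\<close> is smooth because plots of the dual of \<open>V1\<close> lift locally to plots of \<open>V1\<close>.\<close>

lemma lift_inverse_eval_smooth: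
  assumes q: "plot (Total (dual_bundle V1)) n U q" and w: "plot (Total V2) n U w"
    and qY: "\<And>u. u \<in> U \<Longrightarrow> fst (q u) \<in> Y" and eq: "\<And>u. u \<in> U \<Longrightarrow> Proj V2 (w u) = f (fst (q u))"
  shows "C_infinity n U (\<lambda>u. snd (push1 (q u)) (T.in2 (w u)))"
proof (rule C_infinity_local[OF plot_openin[OF bundle_total[OF M2.V] w]])
  fix u assume "u \<in> U"
  from M1.metric_pairing_local_lift[OF q this] obtain W v where
    W: "openin (Euclidean_space n) W" "u \<in> W" "W \<subseteq> U" "plot (Total V1) n W v"
    and v: "\<And>s. s \<in> W \<Longrightarrow> metric_pairing V1 g1 (v s) = q s" by blast
  have v_proj: "Proj V1 (v s) = fst (q s)" if "s \<in> W" for s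
    using v[OF that] by (auto simp: metric_pairing_def dest: arg_cong[of _ _ fst])
  have vY: "Proj V1 (v s) \<in> Y" if "s \<in> W" for s using v_proj[OF that] qY W(3) that by auto
  have v_fib: "v s \<in> carrier (Fib V1 (Proj V1 (v s)))" if "s \<in> W" for s
    by (rule plot_fibre[OF M1.V W(4) that])
  have ftv: "plot (Total V2) n W (\<lambda>s. ft (v s))" by (rule ft_plot[OF W(4) vY])
  have w': "plot (Total V2) n W w" by (rule plot_restrict[OF bundle_total[OF M2.V] w W(1,3)])
  have ftv_fib: "ft (v s) \<in> carrier (Fib V2 (f (Proj V1 (v s))))" if "s \<in> W" for s
    by (rule ft_fib[OF vY[OF that] v_fib[OF that]])
  have w_proj: "Proj V2 (w s) = f (Proj V1 (v s))" if "s \<in> W" for s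
    using eq v_proj[OF that] W(3) that by auto
  have "C_infinity n W (\<lambda>s. M2.G (f (Proj V1 (v s))) (ft (v s)) (w s))"
    by (rule M2.G_smooth[OF ftv w']) (use ftv_fib w_proj vY f_base in \<open>simp_all add: Fib_V2\<close>)
  then have "C_infinity n W (\<lambda>s. snd (push1 (q s)) (T.in2 (w s)))"
  proof (rule C_infinity_transform[OF _ W(1)])
    fix s assume s: "s \<in> W"
    let ?y = "Proj V1 (v s)" and ?b = "metric_pairing V2 g2 (ft (v s))"
    note x = f_base[OF vY[OF s]]
    have b: "?b = (f ?y, \<lambda>u\<in>carrier (Fib V2 (f ?y)). M2.G (f ?y) (ft (v s)) u)" "?b \<in> dual_points V2"
      by (rule M2.metric_pairing_eq[OF x ftv_fib[OF s]], rule M2.metric_pairing_in[OF x ftv_fib[OF s]])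
    have ws: "w s \<in> carrier (Fib V2 (f ?y))" using plot_fibre[OF M2.V w' s] w_proj[OF s] by simp
    have fb: "fst ?b = f ?y" by (subst b(1)) simp
    \<comment> \<open>The preimage of \<open>q s\<close> under the dual lift is given here by the
      explicit element \<open>?b\<close>, which replaces the choice in \<open>push1\<close> by a
      value of the metric of \<open>V2\<close>.\<close>
    have "push1 (q s) = push1 (lift ?b)"
      using lift_pairing[OF vY[OF s] v_fib[OF s]] v[OF s] by simp
    also have "\<dots> = push2 ?b" by (rule push1_lift[OF b(2)]) (use fb vY[OF s] in simp)
    finally have "snd (push1 (q s)) (T.in2 (w s)) = snd ?b (w s)"
      using push2_eval[OF b(2)] ws fb by simp
    also have "\<dots> = M2.G (f ?y) (ft (v s)) (w s)" by (subst b(1)) (simp add: ws)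
    finally show "snd (push1 (q s)) (T.in2 (w s)) = M2.G (f ?y) (ft (v s)) (w s)" .
  qed
  then show "\<exists>W. openin (Euclidean_space n) W \<and> u \<in> W \<and> W \<subseteq> U \<and>
      C_infinity n W (\<lambda>u. snd (push1 (q u)) (T.in2 (w u)))"
    using W by blast
qed

text \<open>A test plot of the glued space lifts locally either to \<open>V1\<close>, where
  \<open>push1\<close> evaluates like \<open>q\<close>, or to \<open>V2\<close>. In the second case
  the base points of \<open>q\<close> lie in \<open>Y\<close>, and the claim is
  \<open>lift_inverse_eval_smooth\<close>.\<close>

lemma push1_plot:
  assumes q: "plot (Total (dual_bundle V1)) n U q"
  shows "plot (Total (dual_bundle V)) n U (\<lambda>u. push1 (q u))"
proof -
  note BT = bundle_base[OF M1.V] bundle_total[OF M1.V]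
  note q_iff = q[unfolded dual_plot_iff[OF BT(2)]]
  have qd: "q u \<in> dual_points V1" if "u \<in> U" for u using q_iff that by blast
  have U: "openin (Euclidean_space n) U" using q_iff by blast
  show ?thesis
    unfolding dual_plot_iff[of V, unfolded Total_V, OF T.diffeological_glued]
  proof (intro conjI allI impI)
    show "(\<lambda>u. push1 (q u)) ` U \<subseteq> dual_points V" using push1_in qd by blast
    have "plot B.glued n U (\<lambda>u. B.in1 (fst (q u)))"
      by (rule B.plot_in1) (use q_iff in blast)
    then have "plot B.glued n U (\<lambda>u. fst (push1 (q u)))"
      by (rule plot_cong[OF B.diffeological_glued]) (simp add: fst_push1 qd)
    then show "plot (Base V) n U (\<lambda>u. fst (push1 (q u)))" by simp
    fix m S a v
    assume a: "plot (euclid n) m S a" "a ` S \<subseteq> U" and v: "plot T.glued m S v"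
      and v_proj: "\<forall>s\<in>S. fst (push1 (q (a s))) = Proj V (v s)"
    have qa: "plot (Total (dual_bundle V1)) m S (\<lambda>s. q (a s))"
      by (rule dual_plot_compose[OF BT q a])
    have qad: "q (a s) \<in> dual_points V1" if "s \<in> S" for s using qd a(2) that by blast
    have qaB: "fst (q (a s)) \<in> pts (Base V1)" if "s \<in> S" for s using qad[OF that] by (simp add: dual_points_iff)
    have eq: "B.in1 (fst (q (a s))) = Proj V (v s)" if "s \<in> S" for s
      using v_proj that fst_push1[OF qad[OF that]] by simp
    show "C_infinity m S (\<lambda>s. snd (push1 (q (a s))) (v s))"
    proof (rule C_infinity_local[OF euclid_plot_openin[OF a(1)]])
      fix s assume s: "s \<in> S"
      from v s show "\<exists>W. openin (Euclidean_space m) W \<and> s \<in> W \<and> W \<subseteq> S \<and>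
          C_infinity m W (\<lambda>s. snd (push1 (q (a s))) (v s))"
      proof (cases rule: T.plot_glued_cases)
        case (in1 W w)
        have oW: "openin (Euclidean_space m) W" by (rule plot_openin[OF BT(2) in1(3)])
        have w_proj: "Proj V1 (w t) = fst (q (a t))" if t: "t \<in> W" for t
        proof -
          have tS: "t \<in> S" using t in1(2) by blast
          have wt: "w t \<in> pts (Total V1)" by (rule plot_in[OF BT(2) in1(3) t])
          have "B.in1 (fst (q (a t))) = B.in1 (Proj V1 (w t))"
            using eq[OF tS] in1(4)[OF t] Proj_in1[OF wt] by simp
          then show ?thesis using B_in1_inj[OF qaB[OF tS] bundle_fibre(1)[OF M1.V wt]] by simp
        qed
        have "C_infinity m W (\<lambda>t. snd (q (a t)) (w t))"
          by (rule dual_plot_eval[OF BT(2) dual_plot_restrict[OF BT qa oW in1(2)] in1(3)]) (simp add: w_proj)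
        then have "C_infinity m W (\<lambda>s. snd (push1 (q (a s))) (v s))"
        proof (rule C_infinity_transform[OF _ oW])
          fix t assume t: "t \<in> W"
          have "q (a t) \<in> dual_points V1" using qad in1(2) t by blast
          then show "snd (push1 (q (a t))) (v t) = snd (q (a t)) (w t)"
            unfolding in1(4)[OF t]
            by (rule push1_eval) (use plot_fibre[OF M1.V in1(3) t] w_proj[OF t] in simp)
        qed
        then show ?thesis using oW in1(1,2) by blast
      next
        case (in2 W w)
        have oW: "openin (Euclidean_space m) W" by (rule plot_openin[OF bundle_total[OF M2.V] in2(3)])
        \<comment> \<open>A vector from \<open>V2\<close> over a base point from \<open>V1\<close>
          forces that point into \<open>Y\<close>, and this on the whole open set
          \<open>W\<close>.\<close>
        have qY: "fst (q (a t)) \<in> Y \<and> f (fst (q (a t))) = Proj V2 (w t)" if t: "t \<in> W" for t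
        proof -
          have tS: "t \<in> S" using t in2(2) by blast
          have wt: "w t \<in> pts (Total V2)" by (rule plot_in[OF bundle_total[OF M2.V] in2(3) t])
          have "B.in1 (fst (q (a t))) = B.in2 (Proj V2 (w t))"
            using eq[OF tS] in2(4)[OF t] Proj_in2[OF wt] by simp
          then show ?thesis using B.in1_eq_in2_iff[OF qaB[OF tS] bundle_fibre(1)[OF M2.V wt]] by simp
        qed
        have "C_infinity m W (\<lambda>t. snd (push1 (q (a t))) (T.in2 (w t)))"
          by (rule lift_inverse_eval_smooth[OF dual_plot_restrict[OF BT qa oW in2(2)] in2(3)]) (simp_all add: qY)
        then have "C_infinity m W (\<lambda>s. snd (push1 (q (a s))) (v s))"
          by (rule C_infinity_transform[OF _ oW]) (simp add: in2(4))
        then show ?thesis using oW in2(1,2) by blast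
      qed
    qed
  qed (fact U)
qed

section \<open>The gluing-dual map in the two charts\<close>

abbreviation \<Phi> :: "('x1 + 'x2) set \<times> (('v1 + 'v2) set \<Rightarrow> real) \<Rightarrow>
    (('x2 \<times> ('v2 \<Rightarrow> real)) + ('x1 \<times> ('v1 \<Rightarrow> real))) set" where
  "\<Phi> \<equiv> gluing_dual_map V1 V2 Y ft f"

text \<open>Over the image of \<open>Y\<close> the map is defined by the dual lift and lands in the
  dual of \<open>V1\<close>, but the gluing identifies \<open>W.in2 (lift b)\<close> with
  \<open>W.in1 b\<close>; so one formula covers both cases.\<close>

lemma \<Phi>_push2:
  assumes b: "b \<in> dual_points V2"
  shows "\<Phi> (push2 b) = W.in1 b"
proof -
  have x: "fst b \<in> pts (Base V2)" and b': "snd b \<in> fibre_dual V2 (fst b)"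
    using b by (simp_all add: dual_points_iff)
  have "(\<lambda>w\<in>carrier (Fib V2 (fst b)). snd (push2 b) (T.in2 w)) = (\<lambda>w\<in>carrier (Fib V2 (fst b)). snd b w)"
    by (rule restrict_ext) (simp add: push2_eval[OF b])
  also have "\<dots> = snd b" using b' by (simp add: carrier_smooth_dual extensional_restrict)
  finally have pull: "(fst b, \<lambda>w\<in>carrier (Fib V2 (fst b)). snd (push2 b) (T.in2 w)) = b"
    by (simp add: prod_eq_iff)
  have "\<Phi> (push2 b) = (if fst b \<in> f ` Y then W.in2 (lift b) else W.in1 b)"
    unfolding gluing_dual_map_def Let_def case_prod_beta fst_push2 B.glue_case_in2[OF x] pull ..
  then show ?thesis
    using W.in1_in2[of b] b by (simp add: over_dual_V2)
qed

text \<open>Over \<open>Y\<close> the claim reduces to \<open>\<Phi>_push2\<close> for the preimage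
  of \<open>a\<close> under the dual lift, and the gluing brings the value back to
  \<open>a\<close>.\<close>

lemma \<Phi>_push1:
  assumes a: "a \<in> dual_points V1"
  shows "\<Phi> (push1 a) = W.in2 a"
proof (cases "fst a \<in> Y")
  case True
  then obtain b where b: "b \<in> dual_points V2" "fst b = f (fst a)" "lift b = a"
    using lift_onto[OF a] by metis
  have "\<Phi> (push1 a) = W.in1 b" using push1_lift[OF b(1)] \<Phi>_push2[OF b(1)] b(2,3) True by auto
  also have "\<dots> = W.in2 a" using W.in1_in2[of b] b True by (simp add: over_dual_V2)
  finally show ?thesis .
next
  case False
  have x: "fst a \<in> pts (Base V1)" and a': "snd a \<in> fibre_dual V1 (fst a)"
    using a by (simp_all add: dual_points_iff)
  have "(\<lambda>v\<in>carrier (Fib V1 (fst a)). snd (push1 a) (T.in1 v)) = (\<lambda>v\<in>carrier (Fib V1 (fst a)). snd a v)"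
    by (rule restrict_ext) (simp add: push1_eval[OF a])
  also have "\<dots> = snd a" using a' by (simp add: carrier_smooth_dual extensional_restrict)
  finally have pull: "(fst a, \<lambda>v\<in>carrier (Fib V1 (fst a)). snd (push1 a) (T.in1 v)) = a"
    by (simp add: prod_eq_iff)
  show ?thesis
    unfolding gluing_dual_map_def Let_def case_prod_beta fst_push1[OF a] B.glue_case_in1[OF x False] pull ..
qed

lemma lift_over_fst: "b \<in> dual_points V2 \<Longrightarrow> fst b \<in> f ` Y \<Longrightarrow> fst (lift b) = inv_into Y f (fst b)"
  by (auto simp: dual_lift_def case_prod_beta Let_def)

text \<open>Gluing along a map that is not injective would identify points within the dual of
  \<open>V2\<close>; \<open>lift_inj\<close> excludes this. Coincidences between the two parts occur
  only over \<open>Y\<close>, which the representatives taken from the dual of \<open>V1\<close>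
  avoid.\<close>

lemma \<Phi>_bij: "bij_betw \<Phi> (dual_points V) (pts W.glued)"
proof (rule bij_betw_imageI)
  have in1_inj: "b = b'" if "b \<in> dual_points V2" "b' \<in> dual_points V2" "W.in1 b = W.in1 b'" for b b'
  proof -
    have "b = b' \<or> fst b \<in> f ` Y \<and> fst b' \<in> f ` Y \<and> lift b = lift b'"
      using that W.in1_eq_in1_iff[of b b'] unfolding pts_Total_dual_bundle over_dual_V2 by blast
    then show ?thesis using lift_inj[OF that(1) _ that(2)] by blast
  qed
  have in1_in2: "fst a \<in> Y" if "b \<in> dual_points V2" "a \<in> dual_points V1" "W.in1 b = W.in2 a" for a b
    using that W.in1_eq_in2_iff[of b a] by (auto simp: over_dual_V2 lift_eq)
  show "inj_on \<Phi> (dual_points V)"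
  proof (rule inj_onI)
    fix p p' assume p: "p \<in> dual_points V" and p': "p' \<in> dual_points V" and eq: "\<Phi> p = \<Phi> p'"
    from p show "p = p'"
    proof (cases rule: dual_points_V_cases)
      case p: (push1 a)
      from p' show ?thesis
      proof (cases rule: dual_points_V_cases)
        case (push1 a')
        then show ?thesis using eq p W.in2_eq_in2_iff[of a a'] by (simp add: \<Phi>_push1)
      next
        case (push2 b)
        then show ?thesis using eq p in1_in2[of b a] by (simp add: \<Phi>_push1 \<Phi>_push2)
      qed
    next
      case p: (push2 b)
      from p' show ?thesis
      proof (cases rule: dual_points_V_cases)
        case (push1 a)
        then show ?thesis using eq p in1_in2[of b a] by (simp add: \<Phi>_push1 \<Phi>_push2)
      next
        case (push2 b')
        then show ?thesis using eq p in1_inj[of b b'] by (simp add: \<Phi>_push2)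
      qed
    qed
  qed
  show "\<Phi> ` dual_points V = pts W.glued"
  proof (intro equalityI subsetI)
    fix c assume "c \<in> \<Phi> ` dual_points V"
    then obtain p where p: "p \<in> dual_points V" "c = \<Phi> p" by blast
    from p(1) show "c \<in> pts W.glued"
    proof (cases rule: dual_points_V_cases)
      case (push1 a)
      then show ?thesis using p(2) W.in2_pts[of a] by (simp add: \<Phi>_push1)
    next
      case (push2 b)
      then show ?thesis using p(2) W.in1_pts[of b] by (simp add: \<Phi>_push2)
    qed
  next
    fix c assume "c \<in> pts W.glued"
    then consider b where "b \<in> dual_points V2" "c = W.in1 b" | a where "a \<in> dual_points V1" "c = W.in2 a"
      unfolding W.pts_glued by auto
    then show "c \<in> \<Phi> ` dual_points V"
      by cases (metis \<Phi>_push2 push2_in imageI, metis \<Phi>_push1 push1_in imageI)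
  qed
qed

lemma plot_W:
  "plot W.glued n U p \<longleftrightarrow> openin (Euclidean_space n) U \<and> (\<forall>u\<in>U. \<exists>W. u \<in> W \<and> W \<subseteq> U \<and>
    ((\<exists>q. plot (Total (dual_bundle V2)) n W q \<and> (\<forall>w\<in>W. p w = W.in1 (q w))) \<or>
     (\<exists>q. plot (Total (dual_bundle V1)) n W q \<and> (\<forall>w\<in>W. p w = W.in2 (q w)))))"
  by (rule W.plot_glued_iff)
    (simp_all add: dual_plot_iff[OF bundle_total[OF M1.V]] dual_plot_iff[OF bundle_total[OF M2.V]])

text \<open>This direction only restricts functionals. The base points lift locally to one of the
  two bases, which selects the chart; the restricted functional is tested against a plot of that
  part by including the plot into the glued space.\<close>

lemma \<Phi>_smooth: "smooth_map (Total (dual_bundle V)) W.glued \<Phi>"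
proof (rule smooth_mapI)
  show "\<Phi> p \<in> pts W.glued" if "p \<in> pts (Total (dual_bundle V))" for p
    using \<Phi>_bij that by (auto simp: bij_betw_def)
  fix n U q assume q: "plot (Total (dual_bundle V)) n U q"
  note q_iff = q[unfolded dual_plot_iff[of V, unfolded Total_V, OF T.diffeological_glued] Base_V]
  have qd: "q u \<in> dual_points V" if "u \<in> U" for u using q_iff that by blast
  have base: "plot B.glued n U (\<lambda>u. fst (q u))" using q_iff by blast
  have V_dual: "diffeological_space (Base V)" "diffeological_space (Total V)"
    by (simp_all add: B.diffeological_glued T.diffeological_glued)
  show "plot W.glued n U (\<lambda>u. \<Phi> (q u))"
    unfolding plot_W
  proof (intro conjI ballI)
    show "openin (Euclidean_space n) U" using q_iff by blast
    fix u assume "u \<in> U"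
    with base show "\<exists>W. u \<in> W \<and> W \<subseteq> U \<and>
        ((\<exists>q'. plot (Total (dual_bundle V2)) n W q' \<and> (\<forall>w\<in>W. \<Phi> (q w) = W.in1 (q' w))) \<or>
         (\<exists>q'. plot (Total (dual_bundle V1)) n W q' \<and> (\<forall>w\<in>W. \<Phi> (q w) = W.in2 (q' w))))"
    proof (cases rule: B.plot_glued_cases)
      case (in1 W r)
      have W: "openin (Euclidean_space n) W" by (rule plot_openin[OF bundle_base[OF M1.V] in1(3)])
      have rB: "r s \<in> pts (Base V1)" if "s \<in> W" for s by (rule plot_in[OF bundle_base[OF M1.V] in1(3) that])
      let ?q = "\<lambda>s. (r s, \<lambda>v\<in>carrier (Fib V1 (r s)). snd (q s) (T.in1 v))"
      have pull: "?q s \<in> dual_points V1" "push1 (?q s) = q s" if s: "s \<in> W" for s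
        using push1_pull[OF qd in1(4)[OF s] rB[OF s]] s in1(2) by blast+
      have "plot (Total (dual_bundle V1)) n W ?q"
        unfolding dual_plot_iff[OF bundle_total[OF M1.V]]
      proof (intro conjI allI impI)
        fix m S a v
        assume a: "plot (euclid n) m S a" "a ` S \<subseteq> W" and v: "plot (Total V1) m S v"
          and eq: "\<forall>s\<in>S. fst (?q (a s)) = Proj V1 (v s)"
        have qa: "plot (Total (dual_bundle V)) m S (\<lambda>s. q (a s))"
          by (rule dual_plot_compose[OF V_dual q a(1)]) (use a(2) in1(2) in blast)
        have "C_infinity m S (\<lambda>s. snd (q (a s)) (T.in1 (v s)))"
        proof (rule dual_plot_eval[OF V_dual(2) qa])
          show "plot (Total V) m S (\<lambda>s. T.in1 (v s))" using T.plot_in1[OF v] by simp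
          show "fst (q (a s)) = Proj V (T.in1 (v s))" if s: "s \<in> S" for s
            using in1(4)[of "a s"] a(2) eq s Proj_in1[OF plot_in[OF bundle_total[OF M1.V] v s]] by auto
        qed
        then show "C_infinity m S (\<lambda>s. snd (?q (a s)) (v s))"
          by (rule C_infinity_transform[OF _ euclid_plot_openin[OF a(1)]])
            (use plot_fibre[OF M1.V v] eq in simp)
      qed (use W in1(3) pull(1) in auto)
      moreover have "\<Phi> (q w) = W.in2 (?q w)" if "w \<in> W" for w
        using \<Phi>_push1[OF pull(1)[OF that]] pull(2)[OF that] by simp
      ultimately show ?thesis
        using in1(1,2) by (intro exI[of _ W] conjI disjI2 exI[of _ ?q] ballI)
    next
      case (in2 W r)
      have W: "openin (Euclidean_space n) W" by (rule plot_openin[OF bundle_base[OF M2.V] in2(3)])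
      have rB: "r s \<in> pts (Base V2)" if "s \<in> W" for s by (rule plot_in[OF bundle_base[OF M2.V] in2(3) that])
      let ?q = "\<lambda>s. (r s, \<lambda>v\<in>carrier (Fib V2 (r s)). snd (q s) (T.in2 v))"
      have pull: "?q s \<in> dual_points V2" "push2 (?q s) = q s" if s: "s \<in> W" for s
        using push2_pull[OF qd in2(4)[OF s] rB[OF s]] s in2(2) by blast+
      have "plot (Total (dual_bundle V2)) n W ?q"
        unfolding dual_plot_iff[OF bundle_total[OF M2.V]]
      proof (intro conjI allI impI)
        fix m S a v
        assume a: "plot (euclid n) m S a" "a ` S \<subseteq> W" and v: "plot (Total V2) m S v"
          and eq: "\<forall>s\<in>S. fst (?q (a s)) = Proj V2 (v s)"
        have qa: "plot (Total (dual_bundle V)) m S (\<lambda>s. q (a s))"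
          by (rule dual_plot_compose[OF V_dual q a(1)]) (use a(2) in2(2) in blast)
        have "C_infinity m S (\<lambda>s. snd (q (a s)) (T.in2 (v s)))"
        proof (rule dual_plot_eval[OF V_dual(2) qa])
          show "plot (Total V) m S (\<lambda>s. T.in2 (v s))" using T.plot_in2[OF v] by simp
          show "fst (q (a s)) = Proj V (T.in2 (v s))" if s: "s \<in> S" for s
            using in2(4)[of "a s"] a(2) eq s Proj_in2[OF plot_in[OF bundle_total[OF M2.V] v s]] by auto
        qed
        then show "C_infinity m S (\<lambda>s. snd (?q (a s)) (v s))"
          by (rule C_infinity_transform[OF _ euclid_plot_openin[OF a(1)]])
            (use plot_fibre[OF M2.V v] eq in simp)
      qed (use W in2(3) pull(1) in auto)
      moreover have "\<Phi> (q w) = W.in1 (?q w)" if "w \<in> W" for w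
        using \<Phi>_push2[OF pull(1)[OF that]] pull(2)[OF that] by simp
      ultimately show ?thesis
        using in2(1,2) by (intro exI[of _ W] conjI disjI1 exI[of _ ?q] ballI)
    qed
  qed
qed

text \<open>By \<open>\<Phi>_push2\<close> and \<open>\<Phi>_push1\<close> the inverse is
  \<open>push2\<close> on the dual of \<open>V2\<close> and \<open>push1\<close> on the dual of
  \<open>V1\<close>, and plots of the glued duals lift locally to one of these.\<close>

lemma \<Phi>_inverse_smooth:
  "smooth_map W.glued (Total (dual_bundle V)) (inv_into (dual_points V) \<Phi>)"
proof (rule smooth_mapI)
  let ?\<Psi> = "inv_into (dual_points V) \<Phi>"
  have \<Psi>: "?\<Psi> (\<Phi> p) = p" if "p \<in> dual_points V" for p
    using \<Phi>_bij that by (auto simp: bij_betw_def intro: inv_into_f_f)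
  show "?\<Psi> c \<in> pts (Total (dual_bundle V))" if "c \<in> pts W.glued" for c
    using \<Phi>_bij that inv_into_into[of c \<Phi> "dual_points V"] by (simp add: bij_betw_def)
  fix n U p assume p: "plot W.glued n U p"
  then have U: "openin (Euclidean_space n) U" unfolding plot_W by blast
  show "plot (Total (dual_bundle V)) n U (\<lambda>u. ?\<Psi> (p u))"
  proof (rule dual_plot_local[OF _ _ U])
    fix u assume u: "u \<in> U"
    from p u obtain W where W: "u \<in> W" "W \<subseteq> U"
      "(\<exists>q. plot (Total (dual_bundle V2)) n W q \<and> (\<forall>w\<in>W. p w = W.in1 (q w))) \<or>
       (\<exists>q. plot (Total (dual_bundle V1)) n W q \<and> (\<forall>w\<in>W. p w = W.in2 (q w)))"
      unfolding plot_W by blast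
    from W(3) have "\<exists>q. plot (Total (dual_bundle V)) n W q \<and> (\<forall>w\<in>W. ?\<Psi> (p w) = q w)"
    proof (elim disjE exE conjE)
      fix q assume q: "plot (Total (dual_bundle V2)) n W q" "\<forall>w\<in>W. p w = W.in1 (q w)"
      have "q w \<in> dual_points V2" if "w \<in> W" for w
        using q(1) that unfolding dual_plot_iff[OF bundle_total[OF M2.V]] by blast
      then have "?\<Psi> (p w) = push2 (q w)" if "w \<in> W" for w
        using \<Psi>[OF push2_in] \<Phi>_push2 q(2) that by simp
      then show ?thesis using push2_plot[OF q(1)] by blast
    next
      fix q assume q: "plot (Total (dual_bundle V1)) n W q" "\<forall>w\<in>W. p w = W.in2 (q w)"
      have "q w \<in> dual_points V1" if "w \<in> W" for w
        using q(1) that unfolding dual_plot_iff[OF bundle_total[OF M1.V]] by blast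
      then have "?\<Psi> (p w) = push1 (q w)" if "w \<in> W" for w
        using \<Psi>[OF push1_in] \<Phi>_push1 q(2) that by simp
      then show ?thesis using push1_plot[OF q(1)] by blast
    qed
    with W(1,2) show "\<exists>W q. u \<in> W \<and> W \<subseteq> U \<and> plot (Total (dual_bundle V)) n W q \<and> (\<forall>w\<in>W. ?\<Psi> (p w) = q w)"
      by blast
  qed (simp_all add: B.diffeological_glued T.diffeological_glued)
qed

lemma \<Phi>_switch:
  assumes p: "p \<in> dual_points V"
  shows "Proj (glue_bundle (dual_bundle V2) (dual_bundle V1) (f ` Y) lift (inv_into Y f)) (\<Phi> p) =
    switch_map V1 V2 Y f (fst p)"
proof -
  let ?W = "glue_bundle (dual_bundle V2) (dual_bundle V1) (f ` Y) lift (inv_into Y f)"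
  have Proj2: "Proj ?W (W.in2 a) = WB.in2 (fst a)" if "a \<in> dual_points V1" for a
    using that by (simp add: glue_bundle_def W.glue_case_in2)
  from p show ?thesis
  proof (cases rule: dual_points_V_cases)
    case (push1 a)
    have x: "fst a \<in> pts (Base V1)" using push1(1) by (simp add: dual_points_iff)
    show ?thesis
      unfolding push1(3) \<Phi>_push1[OF push1(1)] Proj2[OF push1(1)] fst_push1[OF push1(1)]
        switch_map_def Let_def B.glue_case_in1[OF x push1(2)] ..
  next
    case (push2 b)
    have x: "fst b \<in> pts (Base V2)" using push2(1) by (simp add: dual_points_iff)
    have switch: "switch_map V1 V2 Y f (B.in2 (fst b)) =
        (if fst b \<in> f ` Y then WB.in2 (inv_into Y f (fst b)) else WB.in1 (fst b))"
      unfolding switch_map_def Let_def B.glue_case_in2[OF x] ..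
    show ?thesis
    proof (cases "fst b \<in> f ` Y")
      case True
      then obtain y where y: "y \<in> Y" "fst b = f y" by blast
      \<comment> \<open>The projection of the target gives priority to the image of the dual of
        \<open>V1\<close>, so over the image of \<open>Y\<close> the point must be represented
        there.\<close>
      have "Proj ?W (W.in1 b) = Proj ?W (W.in2 (lift b))"
        using W.in1_in2[of b] push2(1) True by (simp add: over_dual_V2)
      then show ?thesis
        using Proj2[OF lift_in[OF push2(1) y]] lift_over_fst[OF push2(1) True] True
        by (simp add: push2(2) \<Phi>_push2[OF push2(1)] switch)
    next
      case False
      then have "Proj ?W (W.in1 b) = WB.in1 (fst b)"
        using push2(1) by (simp add: glue_bundle_def W.glue_case_in1 over_dual_V2)
      then show ?thesis using False by (simp add: push2(2) \<Phi>_push2[OF push2(1)] switch)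
    qed
  qed
qed

lemma gluing_dual_commutative: "gluing_dual_commutative V1 V2 Y ft f"
proof -
  have "Total (glue_bundle (dual_bundle V2) (dual_bundle V1) (f ` Y) lift (inv_into Y f)) = W.glued"
    by (simp add: glue_bundle_def)
  then show ?thesis
    using \<Phi>_bij \<Phi>_smooth \<Phi>_inverse_smooth \<Phi>_switch
    by (simp add: gluing_dual_commutative_def Let_def diffeomorphism_def)
qed

end

theorem theorem4p5:
  fixes V1 :: "('x1, 'v1) fibred_space" and V2 :: "('x2, 'v2) fibred_space"
    and Y :: "'x1 set" and f :: "'x1 \<Rightarrow> 'x2" and ft :: "'v1 \<Rightarrow> 'v2"
    and g1 :: "'x1 \<Rightarrow> 'x1 \<times> (('x1 \<times> ('v1 \<Rightarrow> real)) \<times> ('x1 \<times> ('v1 \<Rightarrow> real)) \<Rightarrow>\<^sub>0 real) set"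
    and g2 :: "'x2 \<Rightarrow> 'x2 \<times> (('x2 \<times> ('v2 \<Rightarrow> real)) \<times> ('x2 \<times> ('v2 \<Rightarrow> real)) \<Rightarrow>\<^sub>0 real) set"
  assumes "vector_pseudo_bundle V1" and "locally_trivial V1" and "finite_dim_fibres V1"
    and "vector_pseudo_bundle V2" and "locally_trivial V2" and "finite_dim_fibres V2"
    and "bundle_gluing V1 V2 Y ft f"
    and "diffeomorphism (subset_space (Base V1) Y) (subset_space (Base V2) (f ` Y)) f"
    and "pseudo_metric V1 g1" and "pseudo_metric V2 g2"
    and "compatible_forms V1 Y ft f (\<lambda>x. tensor_form (g1 x)) (\<lambda>x. tensor_form (g2 x))"
    and "compatible_forms (dual_bundle V2) (f ` Y) (dual_lift V1 Y ft f) (inv_into Y f)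
           (dual_metric V2 g2) (dual_metric V1 g1)"
  shows "gluing_dual_commutative V1 V2 Y ft f"
proof -
  have "pts (Base V1) \<inter> Y = Y"
    using assms(7) by (auto simp: bundle_gluing_def)
  then have "inj_on f Y"
    using assms(8) by (simp add: diffeomorphism_def bij_betw_def)
  then interpret compatible_gluing V1 g1 V2 g2 Y f ft
    using assms by unfold_locales
  show ?thesis by (rule gluing_dual_commutative)
qed

end
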